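(* Fix $\alpha,\beta\in(0,1)$ and $\gamma\ge 1$. Let $p_n\ge n$ with $p_n/n\to\gamma$, $r_n=n^{1-\beta}$, $\delta_n=n^{-\alpha}$, and write $p=p_n$, $r=r_n$, $\delta=\delta_n$. For data $X_1,\dots,X_n\in\mathbb{R}^p$ consider the null $H_0^{(n)}:X_i\stackrel{iid}{\sim}N(0,I_p)$ and two alternatives: $H_1^{(n)}$ (Rare and Weak Spike model): $(X_i\mid Q)\stackrel{iid}{\sim}N\big(0,(I_p-\delta QQ')^{-1}\big)$, with $Q$ uniformly distributed on the Stiefel manifold $\mathbb{S}(p,r)$; $\widetilde H_1^{(n)}$ (Gaussian proxy model): $(X_i\mid Y)\stackrel{iid}{\sim}N\big(0,[I_p-(\delta/p)YY']^{-1}\big)$, where $Y=Z\cdot 1\{\|Z\|\le\frac12\sqrt{p/\delta}\}$ and $Z\in\mathbb{R}^{p\times r}$ has i.i.d. $N(0,1)$ entries. Let $LR_n$ and $\widetilde{LR}_n$ be the likelihood ratios of $H_1^{(n)}$ and of $\widetilde H_1^{(n)}$, respectively, with respect to $H_0^{(n)}$. If $\alpha>\max\{1-5\beta/4,\ (1-\beta)/2\}$, then as $n\to\infty$, $$E_0|LR_n-1|-E_0|\widetilde{LR}_n-1|\to0.$$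
   Context: $\mathbb{S}(p,r)=\{Q\in\mathbb{R}^{p\times r}:Q'Q=I_r\}$ is the Stiefel manifold; "uniform" means the law invariant under left multiplication by orthogonal $p\times p$ matrices. $r_n=n^{1-\beta}$ is understood as rounded to an integer. $\|\cdot\|$ is the spectral norm; $E_0$ is expectation under $H_0^{(n)}$. Under each alternative, the random matrix ($Q$ or $Y$) is drawn once, common to all $i$, and the joint density of the data is the mixture over it; the likelihood ratio is the joint density under the alternative divided by the joint density under $H_0^{(n)}$. *)

theory Defs
  imports
    "HOL-Probability.Probability"
    "Jordan_Normal_Form.Determinant"
    "Jordan_Normal_Form.Gauss_Jordan_Elimination"
begin

(* Points of R^p are functions in space (PiM {..<p} (\<lambda>_. lborel)); p x r matrices are the
   matrices of Jordan_Normal_Form.  Several names below are qualified because HOL-Analysis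
   also defines mat, vec and det. *)

(* The Borel sigma-algebra on the p x r matrices, transported from the product space of entries. *)
definition mat_borel :: "nat \<Rightarrow> nat \<Rightarrow> real mat measure" where
  "mat_borel p r = vimage_algebra (carrier_mat p r)
     (\<lambda>A. \<lambda>ij\<in>{..<p} \<times> {..<r}. A $$ ij) (PiM ({..<p} \<times> {..<r}) (\<lambda>_. borel))"

definition gaussian_mat :: "nat \<Rightarrow> nat \<Rightarrow> real mat measure" where
  "gaussian_mat p r = distr (PiM ({..<p} \<times> {..<r}) (\<lambda>_. density lborel std_normal_density))
     (mat_borel p r) (Matrix.mat p r)"

definition stiefel :: "nat \<Rightarrow> nat \<Rightarrow> real mat set" where
  "stiefel p r = {Q \<in> carrier_mat p r. transpose_mat Q * Q = 1\<^sub>m r}"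

(* For r <= p there is exactly one such measure; stiefel p p is the orthogonal group. *)
definition uniform_on_stiefel :: "nat \<Rightarrow> nat \<Rightarrow> real mat measure \<Rightarrow> bool" where
  "uniform_on_stiefel p r \<mu> \<longleftrightarrow>
     prob_space \<mu> \<and> space \<mu> = stiefel p r \<and>
     sets \<mu> = sets (restrict_space (mat_borel p r) (stiefel p r)) \<and>
     (\<forall>U\<in>stiefel p p. distr \<mu> \<mu> (\<lambda>Q. U * Q) = \<mu>)"

definition vec_norm2 :: "real Matrix.vec \<Rightarrow> real" where
  "vec_norm2 v = sqrt (scalar_prod v v)"

definition spectral_norm :: "real mat \<Rightarrow> real" where
  "spectral_norm A = (SUP v\<in>{v \<in> carrier_vec (dim_col A). vec_norm2 v \<le> 1}. vec_norm2 (A *\<^sub>v v))"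

(* Unspecified when A is not invertible. *)
definition mat_inv :: "real mat \<Rightarrow> real mat" where
  "mat_inv A = the (mat_inverse A)"

definition mvn_density :: "nat \<Rightarrow> real mat \<Rightarrow> (nat \<Rightarrow> real) \<Rightarrow> real" where
  "mvn_density p \<Sigma> x =
     exp (- scalar_prod (Matrix.vec p x) (mat_inv \<Sigma> *\<^sub>v Matrix.vec p x) / 2) /
     sqrt ((2 * pi) ^ p * Determinant.det \<Sigma>)"

definition mvn :: "nat \<Rightarrow> real mat \<Rightarrow> (nat \<Rightarrow> real) measure" where
  "mvn p \<Sigma> = density (PiM {..<p} (\<lambda>_. lborel)) (\<lambda>x. ennreal (mvn_density p \<Sigma> x))"

definition null_law :: "nat \<Rightarrow> nat \<Rightarrow> (nat \<Rightarrow> nat \<Rightarrow> real) measure" where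
  "null_law n p = PiM {..<n} (\<lambda>_. mvn p (1\<^sub>m p))"

definition iid_density :: "nat \<Rightarrow> nat \<Rightarrow> real mat \<Rightarrow> (nat \<Rightarrow> nat \<Rightarrow> real) \<Rightarrow> real" where
  "iid_density n p \<Sigma> x = (\<Prod>i<n. mvn_density p \<Sigma> (x i))"

definition spiked_cov :: "nat \<Rightarrow> real \<Rightarrow> real mat \<Rightarrow> real mat" where
  "spiked_cov p c A = mat_inv (1\<^sub>m p - c \<cdot>\<^sub>m (A * transpose_mat A))"

(* The random matrix A, with law M, is drawn once and shared by all n observations. *)
definition mixture_LR ::
  "nat \<Rightarrow> nat \<Rightarrow> real \<Rightarrow> real mat measure \<Rightarrow> (nat \<Rightarrow> nat \<Rightarrow> real) \<Rightarrow> real" where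
  "mixture_LR n p c M x =
     (\<integral>A. iid_density n p (spiked_cov p c A) x \<partial>M) / iid_density n p (1\<^sub>m p) x"

definition truncated_gaussian_mat :: "nat \<Rightarrow> nat \<Rightarrow> real \<Rightarrow> real mat measure" where
  "truncated_gaussian_mat p r t = distr (gaussian_mat p r) (mat_borel p r)
     (\<lambda>Z. if spectral_norm Z \<le> t then Z else 0\<^sub>m p r)"

end

theory Submission
  imports Defs
begin

text \<open>
  Given the drawn matrix, the likelihood ratio of either model is a product over the sample of
  \<open>exp (|A' x|\<^sup>2 / 2)\<close>, normalised under the null law. The decisive quantity is
  \<open>m = n \<delta>\<^sup>2 r\<^sup>2 / p\<close>.

  If \<open>\<alpha> < 1 - \<beta>\<close> then \<open>m\<close> tends to infinity, and already the total squared norm of the data separates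
  the null law from each alternative, so both expectations tend to 2.

  If \<open>\<alpha> \<ge> 1 - \<beta>\<close> then \<open>m\<close> stays bounded and the two likelihood ratios are close in \<open>L\<^sup>2\<close>: the null
  expectation of the product of the ratios given \<open>A\<close> and given \<open>B\<close> is
  \<open>exp (n |A' B|\<^sup>2 / 2)\<close>, with the Frobenius norm and up to a factor \<open>1 + o(1)\<close> in the exponent, and
  its average over two independent draws is \<open>exp (m / 2)\<close> in the limit for each of the three pairs of models.
  When at least one of the draws is Gaussian this is an explicit computation. Two uniform frames are
  compared with a frame and a Gaussian matrix by rotating the Gaussian matrix to triangular form and
  applying Jensen's inequality. The truncation is negligible because the fourth Schatten norm of a
  Gaussian \<open>p \<times> r\<close> matrix has fourth moment of order \<open>r p\<^sup>2\<close>, and \<open>r \<delta>\<^sup>2\<close> tends to 0 when \<open>\<alpha> > (1 - \<beta>) / 2\<close>.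
\<close>

section \<open>Gaussian product measures\<close>

text \<open>The squared L2 distance of two ratios combines two second moments, bounded above, and a
  mixed moment, bounded below. These must agree up to a vanishing relative error in the exponent.
  Determinants are not expanded for this: \<open>gmom\<close> is built one column at a time, and a
  column d contributes a factor 1 / sqrt (1 - x) with |d|^2 \<le> x \<le> |d|^2 / (1 - \<zeta>).
  Every loss is then a factor 1 / (1 - O(\<zeta>)) in the exponent, harmless once the squared
  operator norm \<zeta> tends to 0.

  This shapes the treatment of the proxy model. Its truncation only guarantees the squared norm 1/4
  after scaling, so the Gaussian matrix is split further. On a good event the scaled squared norm is
  at most \<eta> = n^(-e) and the truncation does nothing; the complement has mass of order r
  \<delta>^2 / \<eta>^2. Taking e as a quarter of 2 \<alpha> - (1 - \<beta>) makes both \<eta> and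
  this mass vanish.

  The moment of two uniform frames is not evaluated. It is dominated by the frame-Gaussian moment,
  which factorises over the columns of the Gaussian matrix.\<close>

definition dotp :: "nat \<Rightarrow> (nat \<Rightarrow> real) \<Rightarrow> (nat \<Rightarrow> real) \<Rightarrow> real" where
  "dotp m u v = (\<Sum>i<m. u i * v i)"

text \<open>An \<open>m \<times> k\<close> matrix is represented by the family of its columns: \<open>D j i\<close> is the entry in row \<open>i\<close>
  and column \<open>j\<close>.\<close>

definition qform :: "nat \<Rightarrow> nat \<Rightarrow> (nat \<Rightarrow> nat \<Rightarrow> real) \<Rightarrow> (nat \<Rightarrow> real) \<Rightarrow> real" where
  "qform m k D z = (\<Sum>j<k. (dotp m (D j) z)\<^sup>2)"

abbreviation std_normal :: "real measure" where
  "std_normal \<equiv> density lborel (\<lambda>x. ennreal (std_normal_density x))"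

abbreviation gauss :: "nat \<Rightarrow> (nat \<Rightarrow> real) measure" where
  "gauss m \<equiv> PiM {..<m} (\<lambda>_. std_normal)"

text \<open>With D the matrix of columns \<open>D j\<close>, this is det (I - D D^T)^(-1/2), the
  normalising constant of a Gaussian tilted by the quadratic form. It lives in
  \<open>ennreal\<close> because it is infinite once the operator norm of D reaches 1.\<close>

definition gmom :: "nat \<Rightarrow> nat \<Rightarrow> (nat \<Rightarrow> nat \<Rightarrow> real) \<Rightarrow> ennreal" where
  "gmom m k D = (\<integral>\<^sup>+z. ennreal (exp (qform m k D z / 2)) \<partial>gauss m)"

interpretation std_normal: prob_space std_normal
  by (rule prob_space_normal_density) simp

interpretation std_normal_sf: product_sigma_finite "\<lambda>_. std_normal"
  by standard

lemma prob_space_gauss: "prob_space (gauss m)"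
  by (rule prob_space_PiM) (rule std_normal.prob_space_axioms)

lemma prob_space_gauss_ix: "prob_space (PiM I (\<lambda>_. std_normal))"
  by (rule prob_space_PiM) (rule std_normal.prob_space_axioms)

lemma sigma_finite_gauss: "sigma_finite_measure (gauss m)"
  by (rule prob_space_imp_sigma_finite[OF prob_space_gauss])

lemma measurable_dotp [measurable (raw)]:
  assumes "f \<in> M \<rightarrow>\<^sub>M gauss m"
  shows "(\<lambda>x. dotp m u (f x)) \<in> borel_measurable M"
proof -
  have "(\<lambda>x. f x i) \<in> borel_measurable M" if "i < m" for i
    using measurable_compose[OF assms measurable_component_singleton[of i "{..<m}" "\<lambda>_. std_normal"]] that
    by simp
  then show ?thesis unfolding dotp_def by (auto intro!: borel_measurable_sum)
qed

lemma measurable_dotp_self [measurable (raw)]: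
  assumes "f \<in> M \<rightarrow>\<^sub>M gauss m" "g \<in> M \<rightarrow>\<^sub>M gauss m"
  shows "(\<lambda>x. dotp m (f x) (g x)) \<in> borel_measurable M"
proof -
  have "(\<lambda>x. f x i) \<in> borel_measurable M" "(\<lambda>x. g x i) \<in> borel_measurable M" if "i < m" for i
    using measurable_compose[OF assms(1) measurable_component_singleton[of i "{..<m}" "\<lambda>_. std_normal"]]
      measurable_compose[OF assms(2) measurable_component_singleton[of i "{..<m}" "\<lambda>_. std_normal"]] that
    by simp_all
  then show ?thesis unfolding dotp_def by (auto intro!: borel_measurable_sum borel_measurable_times)
qed

lemma measurable_qform [measurable (raw)]:
  "f \<in> M \<rightarrow>\<^sub>M gauss m \<Longrightarrow> (\<lambda>x. qform m k D (f x)) \<in> borel_measurable M"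
  unfolding qform_def by (intro borel_measurable_sum borel_measurable_power measurable_dotp)

section \<open>Substitutions in Gaussian integrals\<close>

lemma nn_integral_std_normal:
  "f \<in> borel_measurable borel \<Longrightarrow>
    (\<integral>\<^sup>+z. f z \<partial>std_normal) = (\<integral>\<^sup>+z. ennreal (std_normal_density z) * f z \<partial>lborel)"
  by (subst nn_integral_density) auto

lemma nn_integral_std_normal_shift:
  fixes y :: real
  assumes f [measurable]: "f \<in> borel_measurable borel"
  shows "(\<integral>\<^sup>+z. ennreal (exp (- y * z - y\<^sup>2 / 2)) * f (z + y) \<partial>std_normal) = (\<integral>\<^sup>+z. f z \<partial>std_normal)"
proof -
  have *: "std_normal_density z * exp (- y * z - y\<^sup>2 / 2) = std_normal_density (z + y)" for z
    unfolding std_normal_density_def mult.assoc exp_add[symmetric]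
    by (simp add: power2_eq_square field_simps)
  have "(\<integral>\<^sup>+z. ennreal (exp (- y * z - y\<^sup>2 / 2)) * f (z + y) \<partial>std_normal) =
    (\<integral>\<^sup>+z. ennreal (std_normal_density (y + 1 * z)) * f (y + 1 * z) \<partial>lborel)"
    by (subst nn_integral_std_normal, measurable, intro nn_integral_cong)
       (simp add: *[symmetric] ennreal_mult mult.assoc add.commute)
  also have "\<dots> = (\<integral>\<^sup>+z. ennreal (std_normal_density z) * f z \<partial>lborel)"
    by (subst nn_integral_real_affine[where c = 1 and t = y], simp_all)
  also have "\<dots> = (\<integral>\<^sup>+z. f z \<partial>std_normal)"
    by (simp add: nn_integral_std_normal)
  finally show ?thesis .
qed

lemma nn_integral_std_normal_exp_sq:
  assumes t: "t < 1"
  shows "(\<integral>\<^sup>+z. ennreal (exp (t * z\<^sup>2 / 2)) \<partial>std_normal) = ennreal (1 / sqrt (1 - t))"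
proof -
  define s where "s = 1 / sqrt (1 - t)"
  have s: "s > 0" "s\<^sup>2 = 1 / (1 - t)" using t by (auto simp: s_def power_divide)
  \<comment> \<open>The tilted density is s times the normal density with variance 1 / (1 - t), so
    its mass is s.\<close>
  have *: "std_normal_density z * exp (t * z\<^sup>2 / 2) = s * normal_density 0 s z" for z
  proof -
    have "sqrt (2 * pi * s\<^sup>2) = sqrt (2 * pi) * s" using s(1) by (simp add: real_sqrt_mult)
    moreover have "exp (- z\<^sup>2 / 2) * exp (t * z\<^sup>2 / 2) = exp (- z\<^sup>2 / (2 * s\<^sup>2))"
      unfolding exp_add[symmetric] s(2) using t by (simp add: field_simps)
    ultimately show ?thesis
      unfolding normal_density_def using s by simp
  qed
  have "(\<integral>\<^sup>+z. ennreal (exp (t * z\<^sup>2 / 2)) \<partial>std_normal) = (\<integral>\<^sup>+z. ennreal s * ennreal (normal_density 0 s z) \<partial>lborel)"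
    by (subst nn_integral_std_normal, measurable, intro nn_integral_cong)
       (use s in \<open>simp add: *[symmetric] ennreal_mult'[symmetric]\<close>)
  also have "\<dots> = ennreal s * (\<integral>\<^sup>+z. ennreal (normal_density 0 s z) \<partial>lborel)"
    by (rule nn_integral_cmult) measurable
  also have "(\<integral>\<^sup>+z. ennreal (normal_density 0 s z) \<partial>lborel) = 1"
    using s by (subst nn_integral_eq_integral) auto
  finally show ?thesis by (simp add: s_def)
qed

lemma nn_integral_std_normal_scale:
  fixes a :: real
  assumes a: "a > 0" and f [measurable]: "f \<in> borel_measurable borel"
  shows "(\<integral>\<^sup>+z. ennreal (a * exp (- (a\<^sup>2 - 1) * z\<^sup>2 / 2)) * f (a * z) \<partial>std_normal) = (\<integral>\<^sup>+z. f z \<partial>std_normal)"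
proof -
  have *: "std_normal_density z * (a * exp (- (a\<^sup>2 - 1) * z\<^sup>2 / 2)) = a * std_normal_density (0 + a * z)" for z
  proof -
    have "exp (- z\<^sup>2 / 2) * exp (- (a\<^sup>2 - 1) * z\<^sup>2 / 2) = exp (- (0 + a * z)\<^sup>2 / 2)"
      unfolding exp_add[symmetric] by (simp add: power_mult_distrib field_simps)
    then show ?thesis unfolding std_normal_density_def by simp
  qed
  have "(\<integral>\<^sup>+z. ennreal (a * exp (- (a\<^sup>2 - 1) * z\<^sup>2 / 2)) * f (a * z) \<partial>std_normal) =
    (\<integral>\<^sup>+z. ennreal a * (ennreal (std_normal_density (0 + a * z)) * f (0 + a * z)) \<partial>lborel)"
  proof (subst nn_integral_std_normal, measurable, intro nn_integral_cong)
    fix z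
    have "ennreal (std_normal_density z) * ennreal (a * exp (- (a\<^sup>2 - 1) * z\<^sup>2 / 2)) =
       ennreal a * ennreal (std_normal_density (0 + a * z))"
      unfolding ennreal_mult'[OF normal_density_nonneg, symmetric] * using a by (simp add: ennreal_mult')
    then show "ennreal (std_normal_density z) * (ennreal (a * exp (- (a\<^sup>2 - 1) * z\<^sup>2 / 2)) * f (a * z)) =
       ennreal a * (ennreal (std_normal_density (0 + a * z)) * f (0 + a * z))"
      by (simp add: mult.assoc[symmetric])
  qed
  also have "\<dots> = ennreal a * (\<integral>\<^sup>+z. ennreal (std_normal_density (0 + a * z)) * f (0 + a * z) \<partial>lborel)"
    by (rule nn_integral_cmult) measurable
  also have "\<dots> = (\<integral>\<^sup>+z. ennreal (std_normal_density z) * f z \<partial>lborel)"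
    using a by (subst nn_integral_real_affine[where c = a and t = 0 and f = "\<lambda>z. ennreal (std_normal_density z) * f z"], simp_all)
  also have "\<dots> = (\<integral>\<^sup>+z. f z \<partial>std_normal)"
    by (simp add: nn_integral_std_normal)
  finally show ?thesis .
qed

text \<open>A substitution valid in each coordinate is valid in the product: the weighted image of
  the product law is compared with the product law on boxes, where the integral factorises.
  Translations and scalings are the two instances.\<close>

lemma nn_integral_PiM_std_normal_map:
  fixes w :: "'i \<Rightarrow> real \<Rightarrow> ennreal" and T :: "'i \<Rightarrow> real \<Rightarrow> real"
  assumes I: "finite I"
    and w: "\<And>i. i \<in> I \<Longrightarrow> w i \<in> borel_measurable borel"
    and T': "\<And>i. i \<in> I \<Longrightarrow> T i \<in> borel_measurable borel"
    and eq: "\<And>i g. i \<in> I \<Longrightarrow> g \<in> borel_measurable borel \<Longrightarrow>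
      (\<integral>\<^sup>+z. w i z * g (T i z) \<partial>std_normal) = (\<integral>\<^sup>+z. g z \<partial>std_normal)"
    and f [measurable]: "f \<in> borel_measurable (PiM I (\<lambda>_. std_normal))"
  shows "(\<integral>\<^sup>+z. f z \<partial>PiM I (\<lambda>_. std_normal)) =
    (\<integral>\<^sup>+z. (\<Prod>i\<in>I. w i (z i)) * f (\<lambda>i\<in>I. T i (z i)) \<partial>PiM I (\<lambda>_. std_normal))"
proof -
  let ?G = "PiM I (\<lambda>_. std_normal)"
  let ?w = "\<lambda>z. \<Prod>i\<in>I. w i (z i)"
  let ?T = "\<lambda>z. \<lambda>i\<in>I. T i (z i)"
  have comp: "(\<lambda>z. z i) \<in> ?G \<rightarrow>\<^sub>M borel" if "i \<in> I" for i
    using measurable_component_singleton[OF that, of "\<lambda>_. std_normal"] by simp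
  have T [measurable]: "?T \<in> ?G \<rightarrow>\<^sub>M ?G"
    using measurable_compose[OF comp T'] by (intro measurable_restrict) auto
  have W [measurable]: "?w \<in> borel_measurable ?G"
    using measurable_compose[OF comp w] by (intro borel_measurable_prod_ennreal) auto
  let ?P = "distr (density ?G ?w) ?G ?T"
  have "?P = ?G"
  proof (rule std_normal_sf.PiM_eqI[OF I])
    fix A assume "\<And>i. i \<in> I \<Longrightarrow> A i \<in> sets std_normal"
    then have A: "i \<in> I \<Longrightarrow> A i \<in> sets borel" for i by auto
    have box: "PiE I A \<in> sets ?G" using A I by (intro sets_PiM_I_finite) auto
    have "?P (PiE I A) = (\<integral>\<^sup>+z. ?w z * indicator (PiE I A) (?T z) \<partial>?G)"
      using box measurable_sets[OF T box] by (subst emeasure_distr) (auto simp: emeasure_density intro!: nn_integral_cong split: split_indicator)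
    also have "\<dots> = (\<integral>\<^sup>+z. (\<Prod>i\<in>I. w i (z i) * indicator (A i) (T i (z i))) \<partial>?G)"
    proof (intro nn_integral_cong)
      fix z
      have "indicator (PiE I A) (?T z) = (\<Prod>i\<in>I. indicator (A i) (T i (z i)) :: ennreal)"
      proof (cases "\<forall>i\<in>I. T i (z i) \<in> A i")
        case True then show ?thesis by (auto simp: indicator_def PiE_def Pi_def)
      next
        case False
        then obtain i where i: "i \<in> I" "T i (z i) \<notin> A i" by auto
        then have "(\<Prod>i\<in>I. indicator (A i) (T i (z i)) :: ennreal) = 0" using I by (intro prod_zero bexI[of _ i]) auto
        moreover have "?T z \<notin> PiE I A" using i by (auto simp: PiE_def Pi_def)
        ultimately show ?thesis by simp
      qed
      then show "?w z * indicator (PiE I A) (?T z) = (\<Prod>i\<in>I. w i (z i) * indicator (A i) (T i (z i)))"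
        by (simp add: prod.distrib)
    qed
    also have "\<dots> = (\<Prod>i\<in>I. \<integral>\<^sup>+z. w i z * indicator (A i) (T i z) \<partial>std_normal)"
    proof (rule std_normal_sf.product_nn_integral_prod[OF I])
      fix i assume i: "i \<in> I"
      have [measurable]: "A i \<in> sets borel" "w i \<in> borel_measurable borel" "T i \<in> borel_measurable borel"
        using A[OF i] w[OF i] T'[OF i] by auto
      show "(\<lambda>z. w i z * indicator (A i) (T i z)) \<in> borel_measurable std_normal" by measurable
    qed
    also have "\<dots> = (\<Prod>i\<in>I. emeasure std_normal (A i))"
    proof (intro prod.cong refl)
      fix i assume i: "i \<in> I"
      then have "A i \<in> sets borel" using A by auto
      then show "(\<integral>\<^sup>+z. w i z * indicator (A i) (T i z) \<partial>std_normal) = emeasure std_normal (A i)"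
        using eq[OF i, of "indicator (A i)"] by simp
    qed
    finally show "?P (PiE I A) = (\<Prod>i\<in>I. emeasure std_normal (A i))" .
  qed auto
  then have "(\<integral>\<^sup>+z. f z \<partial>?G) = (\<integral>\<^sup>+z. f z \<partial>?P)" by simp
  also have "\<dots> = (\<integral>\<^sup>+z. ?w z * f (?T z) \<partial>?G)"
    by (subst nn_integral_distr, measurable, subst nn_integral_density) auto
  finally show ?thesis .
qed

lemma nn_integral_gauss_shift:
  fixes y :: "nat \<Rightarrow> real"
  assumes f: "f \<in> borel_measurable (gauss m)"
  shows "(\<integral>\<^sup>+z. f z \<partial>gauss m) =
    (\<integral>\<^sup>+z. ennreal (exp (- dotp m y z - dotp m y y / 2)) * f (\<lambda>i\<in>{..<m}. z i + y i) \<partial>gauss m)"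
proof -
  have w: "ennreal (exp (- dotp m y z - dotp m y y / 2)) = (\<Prod>i<m. ennreal (exp (- y i * z i - (y i)\<^sup>2 / 2)))" for z
    by (simp add: dotp_def prod_ennreal exp_sum[symmetric] sum_subtractf sum_negf sum_divide_distrib power2_eq_square)
  show ?thesis unfolding w
    by (rule nn_integral_PiM_std_normal_map[OF finite_lessThan _ _ nn_integral_std_normal_shift f]) measurable
qed

lemma nn_integral_gauss_scale:
  fixes a :: real
  assumes a: "a > 0" and f: "f \<in> borel_measurable (gauss m)"
  shows "(\<integral>\<^sup>+z. f z \<partial>gauss m) =
    (\<integral>\<^sup>+z. ennreal (a ^ m * exp (- (a\<^sup>2 - 1) * dotp m z z / 2)) * f (\<lambda>i\<in>{..<m}. a * z i) \<partial>gauss m)"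
proof -
  have w: "ennreal (a ^ m * exp (- (a\<^sup>2 - 1) * dotp m z z / 2)) = (\<Prod>i<m. ennreal (a * exp (- (a\<^sup>2 - 1) * (z i)\<^sup>2 / 2)))" for z
  proof -
    have "(\<Sum>i<m. - (a\<^sup>2 - 1) * (z i)\<^sup>2 / 2) = - (a\<^sup>2 - 1) * dotp m z z / 2"
      by (simp only: dotp_def sum_distrib_left sum_divide_distrib power2_eq_square)
    then show ?thesis using a by (simp add: prod_ennreal prod.distrib exp_sum[symmetric])
  qed
  show ?thesis unfolding w
    by (rule nn_integral_PiM_std_normal_map[OF finite_lessThan _ _ nn_integral_std_normal_scale[OF a] f]) measurable
qed

section \<open>Inner products and tilted Gaussian integrals\<close>

lemma dotp_add_right: "dotp m u (\<lambda>i. v i + w i) = dotp m u v + dotp m u w"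
  by (simp add: dotp_def algebra_simps sum.distrib)

lemma dotp_minus_left: "dotp m (\<lambda>i. v i - w i) u = dotp m v u - dotp m w u"
  by (simp add: dotp_def algebra_simps sum_subtractf)

lemma dotp_commute: "dotp m u v = dotp m v u"
  by (simp add: dotp_def mult.commute)

lemma dotp_scale_left: "dotp m (\<lambda>i. c * v i) u = c * dotp m v u"
  by (simp add: dotp_def algebra_simps sum_distrib_left)

lemma dotp_scale_right: "dotp m u (\<lambda>i. c * v i) = c * dotp m u v"
  by (simp add: dotp_def algebra_simps sum_distrib_left)

lemma dotp_sum_left: "dotp m (\<lambda>i. \<Sum>j\<in>J. f j i) u = (\<Sum>j\<in>J. dotp m (f j) u)"
  unfolding dotp_def by (simp add: sum_distrib_right) (rule sum.swap)

lemma dotp_cong: "(\<And>i. i < m \<Longrightarrow> u i = u' i) \<Longrightarrow> (\<And>i. i < m \<Longrightarrow> v i = v' i) \<Longrightarrow> dotp m u v = dotp m u' v'"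
  by (simp add: dotp_def)

lemma dotp_restrict: "dotp m u (restrict v {..<m}) = dotp m u v"
  by (simp add: dotp_def)

lemma dotp_self_nonneg [simp]: "dotp m u u \<ge> 0"
  by (simp add: dotp_def sum_nonneg)

lemma qform_nonneg [simp]: "qform m k D z \<ge> 0"
  by (simp add: qform_def sum_nonneg)

text \<open>The hypothesis is the system (I - D D^T) y = w in coordinates. This is its weak form,
  tested against v, and the later estimates on y come from choosing v well.\<close>

lemma dotp_tilt_eq:
  assumes y: "\<forall>i<m. y i - (\<Sum>j<k. D j i * dotp m (D j) y) = w i"
  shows "dotp m w v = dotp m y v - (\<Sum>j<k. dotp m (D j) y * dotp m (D j) v)"
proof -
  have "dotp m w v = dotp m (\<lambda>i. y i - (\<Sum>j<k. D j i * dotp m (D j) y)) v"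
    by (rule dotp_cong) (simp_all add: y)
  also have "\<dots> = dotp m y v - (\<Sum>j<k. dotp m (\<lambda>i. D j i * dotp m (D j) y) v)"
    by (simp add: dotp_minus_left dotp_sum_left)
  also have "(\<lambda>j. dotp m (\<lambda>i. D j i * dotp m (D j) y) v) = (\<lambda>j. dotp m (D j) y * dotp m (D j) v)"
    by (subst mult.commute, subst dotp_scale_left) simp
  finally show ?thesis .
qed

text \<open>The vector \<open>y\<close> is the centre of the Gaussian law with precision \<open>I - D\<^sup>T D\<close> tilted by \<open>w\<close>.\<close>

lemma gauss_tilt:
  assumes y: "\<forall>i<m. y i - (\<Sum>j<k. D j i * dotp m (D j) y) = w i"
  shows "(\<integral>\<^sup>+z. ennreal (exp (qform m k D z / 2 + dotp m w z)) \<partial>gauss m) =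
    gmom m k D * ennreal (exp (dotp m w y / 2))"
proof -
  note w = dotp_tilt_eq[OF y]
  have q: "qform m k D (\<lambda>i. z i + y i) = qform m k D z + 2 * (\<Sum>j<k. dotp m (D j) y * dotp m (D j) z) + qform m k D y" for z
    unfolding qform_def dotp_add_right power2_sum sum.distrib sum_distrib_left by (simp add: algebra_simps)
  have r: "qform m k D (restrict v {..<m}) = qform m k D v" for v
    by (simp add: qform_def dotp_restrict)
  have q': "qform m k D y = (\<Sum>j<k. dotp m (D j) y * dotp m (D j) y)"
    by (simp add: qform_def power2_eq_square)
  \<comment> \<open>Completing the square: after the shift by y the terms linear in z cancel,
    precisely because y solves the system.\<close>
  have e: "- dotp m y z - dotp m y y / 2 + (qform m k D (\<lambda>i. z i + y i) / 2 + dotp m w (\<lambda>i. z i + y i))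
     = dotp m w y / 2 + qform m k D z / 2" for z
    unfolding q dotp_add_right w q' by (simp add: field_simps)
  have "(\<integral>\<^sup>+z. ennreal (exp (qform m k D z / 2 + dotp m w z)) \<partial>gauss m) =
     (\<integral>\<^sup>+z. ennreal (exp (dotp m w y / 2)) * ennreal (exp (qform m k D z / 2)) \<partial>gauss m)"
    by (subst nn_integral_gauss_shift[where y = y], measurable)
       (simp add: r dotp_restrict ennreal_mult'[symmetric] exp_add[symmetric] e)
  also have "\<dots> = ennreal (exp (dotp m w y / 2)) * gmom m k D"
    unfolding gmom_def by (rule nn_integral_cmult) measurable
  finally show ?thesis by (simp add: mult.commute)
qed

section \<open>Exponential moments of Gaussian quadratic forms\<close>

lemma nn_integral_swap:
  assumes "sigma_finite_measure M" "sigma_finite_measure N"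
    and "(\<lambda>(x, y). f x y) \<in> borel_measurable (M \<Otimes>\<^sub>M N)"
  shows "(\<integral>\<^sup>+x. (\<integral>\<^sup>+y. f x y \<partial>N) \<partial>M) = (\<integral>\<^sup>+y. (\<integral>\<^sup>+x. f x y \<partial>M) \<partial>N)"
proof -
  interpret M: sigma_finite_measure M by fact
  interpret N: sigma_finite_measure N by fact
  interpret pair_sigma_finite M N ..
  show ?thesis using Fubini'[OF assms(3)] by simp
qed

lemma measurable_gauss_component:
  assumes "f \<in> M \<rightarrow>\<^sub>M gauss m" "i < m"
  shows "(\<lambda>x. f x i) \<in> borel_measurable M"
  using measurable_compose[OF assms(1) measurable_component_singleton[of i "{..<m}" "\<lambda>_. std_normal"]] assms(2)
  by simp

lemma measurable_dotp_fun:
  assumes "\<And>j. j < k \<Longrightarrow> u j \<in> borel_measurable M" "f \<in> M \<rightarrow>\<^sub>M gauss k"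
  shows "(\<lambda>x. dotp k (\<lambda>j. u j x) (f x)) \<in> borel_measurable M"
  unfolding dotp_def using assms(1) measurable_gauss_component[OF assms(2)]
  by (auto intro!: borel_measurable_sum borel_measurable_times)

lemma dotp_minus_right: "dotp m u (\<lambda>i. v i - w i) = dotp m u v - dotp m u w"
  by (simp add: dotp_def algebra_simps sum_subtractf)

lemma sqrt_exp: "sqrt (exp u) = exp (u / 2)"
  by (rule real_sqrt_unique) (simp_all add: power2_eq_square flip: exp_add)

text \<open>The Loewner inequality D D^T \<le> \<eta> I. Note that \<eta> bounds the square of the
  operator norm.\<close>

definition op_bounded :: "nat \<Rightarrow> nat \<Rightarrow> (nat \<Rightarrow> nat \<Rightarrow> real) \<Rightarrow> real \<Rightarrow> bool" where
  "op_bounded m k D \<eta> \<longleftrightarrow> (\<forall>z. qform m k D z \<le> \<eta> * dotp m z z)"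

definition precm :: "nat \<Rightarrow> nat \<Rightarrow> (nat \<Rightarrow> nat \<Rightarrow> real) \<Rightarrow> real mat" where
  "precm m k D = Matrix.mat m m (\<lambda>(i, i'). (if i = i' then 1 else 0) - (\<Sum>j<k. D j i * D j i'))"

lemma precm_carrier [simp]: "precm m k D \<in> carrier_mat m m"
  by (simp add: precm_def)

section \<open>The linear system with matrix I - D D^T\<close>

lemma precm_mult_vec:
  assumes "i < m"
  shows "(precm m k D *\<^sub>v Matrix.vec m y) $ i = y i - (\<Sum>j<k. D j i * dotp m (D j) y)"
proof -
  have "(precm m k D *\<^sub>v Matrix.vec m y) $ i = (\<Sum>i'<m. ((if i = i' then 1 else 0) - (\<Sum>j<k. D j i * D j i')) * y i')"
    using assms by (simp add: precm_def scalar_prod_def lessThan_atLeast0)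
  also have "\<dots> = (\<Sum>i'<m. (if i = i' then y i' else 0) - (\<Sum>j<k. D j i * D j i' * y i'))"
    by (intro sum.cong refl) (simp add: left_diff_distrib sum_distrib_right)
  also have "\<dots> = (\<Sum>i'<m. (if i = i' then y i' else 0)) - (\<Sum>i'<m. \<Sum>j<k. D j i * D j i' * y i')"
    by (rule sum_subtractf)
  also have "(\<Sum>i'<m. \<Sum>j<k. D j i * D j i' * y i') = (\<Sum>j<k. D j i * dotp m (D j) y)"
    by (subst sum.swap) (simp add: dotp_def sum_distrib_left mult.assoc)
  finally show ?thesis using assms by simp
qed

lemma dotp_Cauchy_Schwarz: "(dotp m u v)\<^sup>2 \<le> dotp m u u * dotp m v v"
  using Cauchy_Schwarz_ineq_sum[of u v "{..<m}"] by (simp add: dotp_def power2_eq_square)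

lemma dotp_self_eq_0: "dotp m u u = 0 \<longleftrightarrow> (\<forall>i<m. u i = 0)"
  unfolding dotp_def by (subst sum_nonneg_eq_0_iff) auto

lemma qform_eq: "qform m k D y = (\<Sum>j<k. dotp m (D j) y * dotp m (D j) y)"
  by (simp add: qform_def power2_eq_square)

text \<open>Coercivity: for a kernel vector y the weak form tested with y gives 0 \<ge> (1 - \<eta>)
  |y|^2.\<close>

lemma det_precm_nonzero:
  assumes "op_bounded m k D \<eta>" "\<eta> < 1"
  shows "Determinant.det (precm m k D) \<noteq> 0"
proof
  assume "Determinant.det (precm m k D) = 0"
  then obtain v where v: "v \<in> carrier_vec m" "v \<noteq> 0\<^sub>v m" "precm m k D *\<^sub>v v = 0\<^sub>v m"
    using det_0_iff_vec_prod_zero_field[OF precm_carrier[of m k D]] by auto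
  define y where "y = (\<lambda>i. v $ i)"
  have vy: "v = Matrix.vec m y" using v(1) by (auto simp: y_def)
  have y: "\<forall>i<m. y i - (\<Sum>j<k. D j i * dotp m (D j) y) = 0"
    using precm_mult_vec[of _ m k D y] v(3) unfolding vy by auto
  have "0 = dotp m y y - qform m k D y"
    using dotp_tilt_eq[of m y D k "\<lambda>_. 0" y] y by (simp add: dotp_def qform_eq)
  also have "\<dots> \<ge> (1 - \<eta>) * dotp m y y" using assms(1) unfolding op_bounded_def by (simp add: algebra_simps)
  finally have "dotp m y y \<le> 0" using assms(2) by (simp add: mult_le_0_iff)
  then have "dotp m y y = 0" using dotp_self_nonneg[of m y] by linarith
  then show False using v(1,2) by (auto simp: dotp_self_eq_0 y_def)
qed

lemma tilt_solvable:
  assumes "op_bounded m k D \<eta>" "\<eta> < 1"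
  obtains y where "\<forall>i<m. y i - (\<Sum>j<k. D j i * dotp m (D j) y) = w i"
proof -
  from det_non_zero_imp_unit[OF precm_carrier det_precm_nonzero[OF assms], of "()"]
  obtain B where B: "B \<in> carrier_mat m m" "precm m k D * B = 1\<^sub>m m"
    by (auto simp: Units_def ring_mat_def)
  define y where "y = (\<lambda>i. (B *\<^sub>v Matrix.vec m w) $ i)"
  have "Matrix.vec m y = B *\<^sub>v Matrix.vec m w" using B by (auto simp: y_def)
  then have "precm m k D *\<^sub>v Matrix.vec m y = (precm m k D * B) *\<^sub>v Matrix.vec m w"
    using B(1) by (simp add: assoc_mult_mat_vec[OF precm_carrier])
  also have "\<dots> = Matrix.vec m w" using B by simp
  finally show ?thesis using precm_mult_vec[of _ m k D y] that by (metis index_vec)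
qed

lemma dotp_tilt_lower:
  assumes y: "\<forall>i<m. y i - (\<Sum>j<k. D j i * dotp m (D j) y) = w i"
    and op: "op_bounded m k D \<eta>"
  shows "(1 - \<eta>) * dotp m y y \<le> dotp m w y"
proof -
  have "qform m k D y \<le> \<eta> * dotp m y y" using op by (simp add: op_bounded_def)
  then show ?thesis using dotp_tilt_eq[OF y, of y] by (simp add: qform_eq algebra_simps)
qed

text \<open>Cauchy-Schwarz gives (w.y)^2 \<le> |w|^2 |y|^2, and coercivity replaces |y|^2 by w.y /
  (1 - \<eta>); one factor w.y is then cancelled.\<close>

lemma dotp_tilt_upper:
  assumes y: "\<forall>i<m. y i - (\<Sum>j<k. D j i * dotp m (D j) y) = w i"
    and op: "op_bounded m k D \<eta>" "\<eta> < 1"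
  shows "dotp m w y \<le> dotp m w w / (1 - \<eta>)"
proof (cases "dotp m w y \<le> 0")
  case True
  moreover have "0 \<le> dotp m w w / (1 - \<eta>)" using op(2) by simp
  ultimately show ?thesis by linarith
next
  case False
  have "(dotp m w y)\<^sup>2 \<le> dotp m w w * dotp m y y" by (rule dotp_Cauchy_Schwarz)
  also have "dotp m y y \<le> dotp m w y / (1 - \<eta>)"
    using dotp_tilt_lower[OF y op(1)] op(2) by (simp add: field_simps)
  finally have "dotp m w y * dotp m w y \<le> (dotp m w w / (1 - \<eta>)) * dotp m w y"
    by (simp add: power2_eq_square mult_left_mono)
  then show ?thesis using False by (meson mult_right_le_imp_le not_le)
qed

lemma qform_transpose:
  "qform k m (\<lambda>i j. D j i) g = dotp m (\<lambda>i. \<Sum>j<k. D j i * g j) (\<lambda>i. \<Sum>j<k. D j i * g j)"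
  by (simp add: qform_def dotp_def power2_eq_square)

lemma dotp_lincomb: "dotp m (\<lambda>i. \<Sum>j<k. D j i * g j) v = (\<Sum>j<k. g j * dotp m (D j) v)"
  unfolding dotp_sum_left by (subst mult.commute, subst dotp_scale_left) simp

text \<open>With w = D g one has |w|^2 = g . D^T w, so |w|^4 \<le> |g|^2 |D^T w|^2 \<le> \<eta>
  |g|^2 |w|^2, and |w|^2 cancels.\<close>

lemma op_bounded_transpose:
  assumes op: "op_bounded m k D \<eta>" and "\<eta> \<ge> 0"
  shows "op_bounded k m (\<lambda>i j. D j i) \<eta>"
  unfolding op_bounded_def
proof
  fix g
  define w where "w = (\<lambda>i. \<Sum>j<k. D j i * g j)"
  have q: "qform k m (\<lambda>i j. D j i) g = dotp m w w" unfolding w_def by (rule qform_transpose)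
  have "dotp m w w = dotp k g (\<lambda>j. dotp m (D j) w)"
    by (subst (1) w_def, subst dotp_lincomb) (simp add: dotp_def)
  then have "(dotp m w w)\<^sup>2 \<le> dotp k g g * qform m k D w"
    using dotp_Cauchy_Schwarz[of k g "\<lambda>j. dotp m (D j) w"] by (simp add: qform_def dotp_def power2_eq_square)
  also have "\<dots> \<le> dotp k g g * (\<eta> * dotp m w w)" using op by (intro mult_left_mono) (auto simp: op_bounded_def)
  finally have *: "dotp m w w * dotp m w w \<le> (\<eta> * dotp k g g) * dotp m w w" by (simp add: power2_eq_square mult_ac)
  show "qform k m (\<lambda>i j. D j i) g \<le> \<eta> * dotp k g g"
  proof (cases "dotp m w w = 0")
    case True then show ?thesis using \<open>\<eta> \<ge> 0\<close> unfolding q by simp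
  next
    case False
    then have "dotp m w w > 0" using dotp_self_nonneg[of m w] by linarith
    then show ?thesis using * unfolding q by (simp add: mult_le_cancel_right)
  qed
qed

text \<open>The number w.y is w^T (I - D D^T)^(-1) w. Its Neumann series starts with |w|^2 + |D^T
  w|^2; the lower bound cuts the series there, and the upper bound sums the rest geometrically. The
  second term is kept because it produces the cross term between two draws.\<close>

lemma dotp_tilt_bounds:
  assumes y: "\<forall>i<m. y i - (\<Sum>j<k. D j i * dotp m (D j) y) = w i"
    and op: "op_bounded m k D \<eta>" "\<eta> < 1" "\<eta> \<ge> 0"
  shows "dotp m w w + qform m k D w \<le> dotp m w y"
    and "dotp m w y \<le> dotp m w w + qform m k D w / (1 - \<eta>)"
proof -
  define u where "u = (\<lambda>j. dotp m (D j) y)"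
  define v where "v = (\<lambda>j. dotp m (D j) w)"
  have wy: "dotp m w y = dotp m w w + dotp k v u"
    using dotp_tilt_eq[OF y, of w] unfolding dotp_commute[of m y w] u_def v_def dotp_def[of k]
    by (simp add: mult.commute)
  have vv: "dotp k v v = qform m k D w" by (simp add: v_def qform_eq) (simp add: dotp_def)
  have opT: "op_bounded k m (\<lambda>i j. D j i) \<eta>" by (rule op_bounded_transpose[OF op(1,3)])
  \<comment> \<open>The vector u = D^T y solves the dual system (I - D^T D) u = D^T w, so the
    general upper bound applies to v.u.\<close>
  have u: "\<forall>j<k. u j - (\<Sum>i<m. D j i * dotp k (\<lambda>j. D j i) u) = v j"
  proof (intro allI impI)
    fix j assume "j < k"
    have "(\<Sum>i<m. D j i * dotp k (\<lambda>j. D j i) u) = dotp m (D j) (\<lambda>i. \<Sum>j<k. D j i * dotp m (D j) y)"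
      by (simp add: u_def dotp_def)
    moreover have "v j = dotp m (D j) (\<lambda>i. y i - (\<Sum>j<k. D j i * dotp m (D j) y))"
      unfolding v_def by (rule dotp_cong) (simp_all add: y)
    ultimately show "u j - (\<Sum>i<m. D j i * dotp k (\<lambda>j. D j i) u) = v j"
      by (simp add: u_def dotp_minus_right)
  qed
  have uv: "dotp k v u = dotp k v v + (\<Sum>i<m. dotp k (\<lambda>j. D j i) u * dotp k (\<lambda>j. D j i) v)"
    using dotp_tilt_eq[OF u, of v] unfolding dotp_commute[of k u v] by simp
  \<comment> \<open>Returning by D gives a solution of the original system with right-hand side D v.
    Its coercivity shows that the remainder of the series is nonnegative.\<close>
  define u' where "u' = (\<lambda>i. dotp k (\<lambda>j. D j i) u)"
  define v' where "v' = (\<lambda>i. dotp k (\<lambda>j. D j i) v)"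
  have u': "\<forall>i<m. u' i - (\<Sum>j<k. D j i * dotp m (D j) u') = v' i"
  proof (intro allI impI)
    fix i assume "i < m"
    have "v' i = dotp k (\<lambda>j. D j i) (\<lambda>j. u j - (\<Sum>i<m. D j i * dotp k (\<lambda>j. D j i) u))"
      unfolding v'_def by (rule dotp_cong) (simp_all add: u)
    also have "\<dots> = u' i - (\<Sum>j<k. D j i * dotp m (D j) u')"
      by (simp add: u'_def dotp_minus_right) (simp add: dotp_def mult.commute)
    finally show "u' i - (\<Sum>j<k. D j i * dotp m (D j) u') = v' i" by simp
  qed
  have "0 \<le> (1 - \<eta>) * dotp m u' u'" using op(2) by simp
  also have "\<dots> \<le> dotp m v' u'" by (rule dotp_tilt_lower[OF u' op(1)])
  finally have "0 \<le> (\<Sum>i<m. u' i * v' i)" by (simp add: dotp_def mult.commute)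
  then show "dotp m w w + qform m k D w \<le> dotp m w y"
    unfolding wy vv[symmetric] uv u'_def v'_def by simp
  show "dotp m w y \<le> dotp m w w + qform m k D w / (1 - \<eta>)"
    using dotp_tilt_upper[OF u opT op(2)] unfolding wy vv by simp
qed

section \<open>Gaussian integrals built up column by column\<close>

lemma nn_integral_std_normal_exp_linear:
  "(\<integral>\<^sup>+t. ennreal (exp (t * s)) \<partial>std_normal) = ennreal (exp (s\<^sup>2 / 2))"
proof -
  have "(\<integral>\<^sup>+t. ennreal (exp (t * s)) \<partial>std_normal) =
    (\<integral>\<^sup>+t. ennreal (exp (- s * t - s\<^sup>2 / 2)) * ennreal (exp ((t + s) * s)) \<partial>std_normal)"
    by (subst nn_integral_std_normal_shift) auto
  also have "\<dots> = (\<integral>\<^sup>+t. ennreal (exp (s\<^sup>2 / 2)) \<partial>std_normal)"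
    by (intro nn_integral_cong) (simp add: ennreal_mult'[symmetric] exp_add[symmetric] power2_eq_square field_simps)
  finally show ?thesis using std_normal.emeasure_space_1 by simp
qed

lemma gmom_0 [simp]: "gmom m 0 D = 1"
  using prob_space.emeasure_space_1[OF prob_space_gauss] by (simp add: gmom_def qform_def)

lemma nn_integral_gauss_exp_linear:
  "(\<integral>\<^sup>+z. ennreal (exp (dotp m w z)) \<partial>gauss m) = ennreal (exp (dotp m w w / 2))"
  using gauss_tilt[of m w "\<lambda>_ _. 0" 0 w] by (simp add: qform_def)

lemma gmom_cong: "(\<And>z. qform m k D z = qform m k' D' z) \<Longrightarrow> gmom m k D = gmom m k' D'"
  by (simp add: gmom_def)

lemma qform_Suc: "qform m (Suc k) D z = qform m k D z + (dotp m (D k) z)\<^sup>2"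
  by (simp add: qform_def)

lemma op_bounded_Suc: "op_bounded m (Suc k) D \<eta> \<Longrightarrow> op_bounded m k D \<eta>"
  unfolding op_bounded_def qform_Suc by (meson add_increasing2 order_trans order.refl zero_le_power2)

text \<open>A rank-one update. The square of the new linear form is linearised by an auxiliary
  normal variable t, the integral over z becomes a tilt by t times the new column, and a
  one-dimensional Gaussian integral in t remains.\<close>

lemma gmom_Suc:
  assumes op: "op_bounded m (Suc k) D \<eta>" "\<eta> < 1"
    and y: "\<forall>i<m. y i - (\<Sum>j<k. D j i * dotp m (D j) y) = D k i"
  shows "0 \<le> dotp m (D k) y" "dotp m (D k) y < 1"
    and "gmom m (Suc k) D = gmom m k D * ennreal (1 / sqrt (1 - dotp m (D k) y))"
proof -
  let ?d = "D k"
  \<comment> \<open>The operator bound for all k + 1 columns, tested at y. The left-over multiple of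
    |y|^2 is what later excludes the value 1.\<close>
  have "(dotp m ?d y)\<^sup>2 + (1 - \<eta>) * dotp m y y \<le> dotp m ?d y"
  proof -
    have "qform m (Suc k) D y \<le> \<eta> * dotp m y y" using op(1) by (simp add: op_bounded_def)
    moreover have "dotp m ?d y = dotp m y y - qform m k D y"
      using dotp_tilt_eq[OF y, of y] by (simp add: qform_eq)
    ultimately show ?thesis unfolding qform_Suc left_diff_distrib by linarith
  qed
  moreover have "0 \<le> (1 - \<eta>) * dotp m y y" using op(2) by simp
  ultimately have sq: "(dotp m ?d y)\<^sup>2 \<le> dotp m ?d y" by linarith
  show nn: "0 \<le> dotp m ?d y" using sq zero_le_power2 order_trans by blast
  show lt: "dotp m ?d y < 1"
  proof (rule ccontr)
    assume "\<not> dotp m ?d y < 1"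
    then have *: "dotp m ?d y = 1" using sq by (simp add: power2_eq_square)
    have "(1 - \<eta>) * dotp m y y \<le> 0"
      using \<open>(dotp m ?d y)\<^sup>2 + (1 - \<eta>) * dotp m y y \<le> dotp m ?d y\<close> * by simp
    then have "dotp m y y = 0" using op(2) dotp_self_nonneg[of m y] by (simp add: mult_le_0_iff)
    then have "dotp m ?d y = 0" using dotp_Cauchy_Schwarz[of m ?d y] by simp
    with * show False by simp
  qed
  have ty: "\<forall>i<m. t * y i - (\<Sum>j<k. D j i * dotp m (D j) (\<lambda>i. t * y i)) = t * D k i" for t
  proof (intro allI impI)
    fix i assume "i < m"
    then have "D k i = y i - (\<Sum>j<k. D j i * dotp m (D j) y)" using y by simp
    then show "t * y i - (\<Sum>j<k. D j i * dotp m (D j) (\<lambda>i. t * y i)) = t * D k i"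
      by (simp add: dotp_scale_right right_diff_distrib sum_distrib_left mult_ac)
  qed
  \<comment> \<open>Linearisation: exp (s^2 / 2) is the mean of exp (t s) for a standard normal
    t.\<close>
  have "gmom m (Suc k) D = (\<integral>\<^sup>+z. (\<integral>\<^sup>+t. ennreal (exp (qform m k D z / 2 + t * dotp m ?d z)) \<partial>std_normal) \<partial>gauss m)"
    unfolding gmom_def
  proof (intro nn_integral_cong)
    fix z
    have "(\<integral>\<^sup>+t. ennreal (exp (qform m k D z / 2 + t * dotp m ?d z)) \<partial>std_normal) =
       ennreal (exp (qform m k D z / 2)) * (\<integral>\<^sup>+t. ennreal (exp (t * dotp m ?d z)) \<partial>std_normal)"
      by (subst nn_integral_cmult[symmetric]) (auto simp: exp_add ennreal_mult')
    then show "ennreal (exp (qform m (Suc k) D z / 2)) = (\<integral>\<^sup>+t. ennreal (exp (qform m k D z / 2 + t * dotp m ?d z)) \<partial>std_normal)"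
      by (simp add: nn_integral_std_normal_exp_linear qform_Suc add_divide_distrib exp_add ennreal_mult')
  qed
  also have "\<dots> = (\<integral>\<^sup>+t. (\<integral>\<^sup>+z. ennreal (exp (qform m k D z / 2 + t * dotp m ?d z)) \<partial>gauss m) \<partial>std_normal)"
  proof (rule nn_integral_swap[OF sigma_finite_gauss std_normal.sigma_finite_measure_axioms])
    show "(\<lambda>(z, t). ennreal (exp (qform m k D z / 2 + t * dotp m ?d z))) \<in> borel_measurable (gauss m \<Otimes>\<^sub>M std_normal)"
      by measurable
  qed
  also have "\<dots> = (\<integral>\<^sup>+t. gmom m k D * ennreal (exp (dotp m ?d y * t\<^sup>2 / 2)) \<partial>std_normal)"
  proof (intro nn_integral_cong)
    fix t
    show "(\<integral>\<^sup>+z. ennreal (exp (qform m k D z / 2 + t * dotp m ?d z)) \<partial>gauss m) =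
       gmom m k D * ennreal (exp (dotp m ?d y * t\<^sup>2 / 2))"
      using gauss_tilt[of m "\<lambda>i. t * y i" D k "\<lambda>i. t * D k i", OF ty]
      by (simp add: dotp_scale_left dotp_scale_right power2_eq_square mult_ac)
  qed
  also have "\<dots> = gmom m k D * (\<integral>\<^sup>+t. ennreal (exp (dotp m ?d y * t\<^sup>2 / 2)) \<partial>std_normal)"
    by (rule nn_integral_cmult) measurable
  also have "\<dots> = gmom m k D * ennreal (1 / sqrt (1 - dotp m ?d y))"
    by (simp add: nn_integral_std_normal_exp_sq[OF lt])
  finally show "gmom m (Suc k) D = gmom m k D * ennreal (1 / sqrt (1 - dotp m ?d y))" .
qed

lemma inverse_sqrt_bounds:
  fixes x :: real
  assumes "0 \<le> x" "x < 1"
  shows "exp (x / 2) \<le> 1 / sqrt (1 - x)" "1 / sqrt (1 - x) \<le> exp (x / (1 - x) / 2)"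
proof -
  have "1 - x \<le> exp (- x)" using exp_ge_add_one_self[of "- x"] by simp
  then have "sqrt (1 - x) \<le> sqrt (exp (- x))" by (rule real_sqrt_le_mono)
  also have "\<dots> = exp (- x / 2)" by (simp add: sqrt_exp)
  finally show "exp (x / 2) \<le> 1 / sqrt (1 - x)" using assms by (simp add: exp_minus field_simps)
  have "1 / (1 - x) \<le> exp (x / (1 - x))"
    using exp_ge_add_one_self[of "x / (1 - x)"] assms by (simp add: field_simps)
  then have "sqrt (1 / (1 - x)) \<le> sqrt (exp (x / (1 - x)))" by (rule real_sqrt_le_mono)
  also have "\<dots> = exp (x / (1 - x) / 2)" by (simp add: sqrt_exp)
  finally show "1 / sqrt (1 - x) \<le> exp (x / (1 - x) / 2)" by (simp add: real_sqrt_divide)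
qed

text \<open>The update factor is 1 / sqrt (1 - x) with x = d^T (I - D D^T)^(-1) d, and x differs
  from |d|^2 only by a factor between 1 and 1 / (1 - \<zeta>).\<close>

lemma gmom_Suc_bounds:
  assumes op: "op_bounded m (Suc k) D \<zeta>" "\<zeta> < 1 / 2" "0 \<le> \<zeta>"
  shows "gmom m k D * ennreal (exp (dotp m (D k) (D k) / 2)) \<le> gmom m (Suc k) D"
    and "gmom m (Suc k) D \<le> gmom m k D * ennreal (exp (dotp m (D k) (D k) / (1 - 2 * \<zeta>) / 2))"
proof -
  let ?d = "D k"
  have op': "op_bounded m k D \<zeta>" using op(1) by (rule op_bounded_Suc)
  have z1: "\<zeta> < 1" using op by simp
  obtain y where y: "\<forall>i<m. y i - (\<Sum>j<k. D j i * dotp m (D j) y) = ?d i"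
    by (rule tilt_solvable[OF op' z1, of ?d]) blast
  note g = gmom_Suc[OF op(1) z1 y]
  define x where "x = dotp m ?d y"
  define n where "n = dotp m ?d ?d"
  have n0: "n \<ge> 0" by (simp add: n_def)
  have lo: "n \<le> x" using dotp_tilt_bounds(1)[OF y op' z1 op(3)] qform_nonneg[of m k D ?d] unfolding n_def x_def by linarith
  have up: "x \<le> n / (1 - \<zeta>)" using dotp_tilt_upper[OF y op' z1] by (simp add: n_def x_def)
  \<comment> \<open>The operator bound tested at the new column itself: n^2 is one of the summands
    on the left.\<close>
  have n: "n \<le> \<zeta>"
  proof -
    have "n\<^sup>2 \<le> qform m (Suc k) D ?d" unfolding qform_Suc n_def by simp
    also have "\<dots> \<le> \<zeta> * n" using op(1) by (simp add: op_bounded_def n_def)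
    finally show ?thesis using n0 op(3) by (cases "n = 0") (auto simp: power2_eq_square)
  qed
  have x: "0 \<le> x" "x < 1" using g by (auto simp: x_def)
  have "exp (n / 2) \<le> exp (x / 2)" using lo by simp
  also have "\<dots> \<le> 1 / sqrt (1 - x)" by (rule inverse_sqrt_bounds[OF x])
  finally have "exp (n / 2) \<le> 1 / sqrt (1 - x)" .
  then show "gmom m k D * ennreal (exp (dotp m (D k) (D k) / 2)) \<le> gmom m (Suc k) D"
    unfolding g(3) n_def x_def by (intro mult_left_mono ennreal_leI) auto
  \<comment> \<open>One \<zeta> is lost in passing from n to x and another in passing from x to x /
    (1 - x); together they give 1 - 2 \<zeta>.\<close>
  have "x * (1 - 2 * \<zeta>) \<le> n * (1 - x)"
  proof -
    have "x * (1 - \<zeta>) \<le> n" using up z1 by (simp add: field_simps)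
    moreover have "x * n \<le> x * \<zeta>" using n x by (intro mult_left_mono) auto
    ultimately show ?thesis by (simp add: algebra_simps)
  qed
  then have "x / (1 - x) \<le> n / (1 - 2 * \<zeta>)" using x op by (simp add: field_simps)
  then have "exp (x / (1 - x) / 2) \<le> exp (n / (1 - 2 * \<zeta>) / 2)" by (simp only: exp_le_cancel_iff divide_right_mono)
  with inverse_sqrt_bounds(2)[OF x] have "1 / sqrt (1 - x) \<le> exp (n / (1 - 2 * \<zeta>) / 2)" by linarith
  then show "gmom m (Suc k) D \<le> gmom m k D * ennreal (exp (dotp m (D k) (D k) / (1 - 2 * \<zeta>) / 2))"
    unfolding g(3) n_def x_def by (intro mult_left_mono ennreal_leI) auto
qed

text \<open>The first k columns are kept exactly, as \<open>gmom m k D\<close>; only the appended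
  columns are estimated. In the applications the exact block is a normalising constant, so no error
  is made in it.\<close>

lemma gmom_add_bounds:
  assumes "op_bounded m (k + l) D \<zeta>" "\<zeta> < 1 / 2" "0 \<le> \<zeta>"
  shows "gmom m k D * ennreal (exp ((\<Sum>j<l. dotp m (D (k + j)) (D (k + j))) / 2)) \<le> gmom m (k + l) D"
    and "gmom m (k + l) D \<le> gmom m k D * ennreal (exp ((\<Sum>j<l. dotp m (D (k + j)) (D (k + j))) / (1 - 2 * \<zeta>) / 2))"
proof -
  have "gmom m k D * ennreal (exp ((\<Sum>j<l. dotp m (D (k + j)) (D (k + j))) / 2)) \<le> gmom m (k + l) D \<and>
    gmom m (k + l) D \<le> gmom m k D * ennreal (exp ((\<Sum>j<l. dotp m (D (k + j)) (D (k + j))) / (1 - 2 * \<zeta>) / 2))"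
    using assms(1)
  proof (induction l)
    case 0
    then show ?case by simp
  next
    case (Suc l)
    have op: "op_bounded m (Suc (k + l)) D \<zeta>" using Suc.prems by simp
    note IH = Suc.IH[OF op_bounded_Suc[OF op]]
    note s = gmom_Suc_bounds[OF op assms(2,3)]
    let ?S = "\<Sum>j<l. dotp m (D (k + j)) (D (k + j))" and ?n = "dotp m (D (k + l)) (D (k + l))"
    have "gmom m k D * ennreal (exp ((?S + ?n) / 2)) = (gmom m k D * ennreal (exp (?S / 2))) * ennreal (exp (?n / 2))"
      by (simp add: add_divide_distrib exp_add ennreal_mult' mult.assoc)
    also have "\<dots> \<le> gmom m (k + l) D * ennreal (exp (?n / 2))" using IH by (intro mult_right_mono) auto
    finally have 1: "gmom m k D * ennreal (exp ((?S + ?n) / 2)) \<le> gmom m (Suc (k + l)) D" using s(1) by (rule order_trans)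
    have "gmom m (Suc (k + l)) D \<le> (gmom m k D * ennreal (exp (?S / (1 - 2 * \<zeta>) / 2))) * ennreal (exp (?n / (1 - 2 * \<zeta>) / 2))"
      using s(2) IH by (meson mult_right_mono order_trans zero_le)
    also have "\<dots> = gmom m k D * ennreal (exp ((?S + ?n) / (1 - 2 * \<zeta>) / 2))"
      by (simp add: add_divide_distrib exp_add ennreal_mult' mult.assoc)
    finally show ?case using 1 by (simp add: add.commute)
  qed
  then show "gmom m k D * ennreal (exp ((\<Sum>j<l. dotp m (D (k + j)) (D (k + j))) / 2)) \<le> gmom m (k + l) D"
    and "gmom m (k + l) D \<le> gmom m k D * ennreal (exp ((\<Sum>j<l. dotp m (D (k + j)) (D (k + j))) / (1 - 2 * \<zeta>) / 2))"
    by auto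
qed

lemma gmom_bounds:
  assumes "op_bounded m l D \<zeta>" "\<zeta> < 1 / 2" "0 \<le> \<zeta>"
  shows "ennreal (exp ((\<Sum>j<l. dotp m (D j) (D j)) / 2)) \<le> gmom m l D"
    and "gmom m l D \<le> ennreal (exp ((\<Sum>j<l. dotp m (D j) (D j)) / (1 - 2 * \<zeta>) / 2))"
  using gmom_add_bounds[of m 0 l D \<zeta>] assms by simp_all

text \<open>Both sides are the integral of exp (z^T D g) over independent Gaussian vectors z and g,
  in either order.\<close>

lemma gmom_transpose: "gmom k m (\<lambda>i j. D j i) = gmom m k D"
proof -
  have sw: "dotp k (\<lambda>j. dotp m (D j) z) g = dotp m (\<lambda>i. \<Sum>j<k. D j i * g j) z" for z g
    by (simp add: dotp_lincomb) (simp add: dotp_def mult.commute)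
  have "gmom m k D = (\<integral>\<^sup>+z. (\<integral>\<^sup>+g. ennreal (exp (dotp k (\<lambda>j. dotp m (D j) z) g)) \<partial>gauss k) \<partial>gauss m)"
    unfolding gmom_def nn_integral_gauss_exp_linear by (simp add: qform_def dotp_def power2_eq_square)
  also have "\<dots> = (\<integral>\<^sup>+g. (\<integral>\<^sup>+z. ennreal (exp (dotp k (\<lambda>j. dotp m (D j) z) g)) \<partial>gauss m) \<partial>gauss k)"
  proof (rule nn_integral_swap[OF sigma_finite_gauss sigma_finite_gauss])
    have [measurable]: "(\<lambda>x. dotp k (\<lambda>j. dotp m (D j) (fst x)) (snd x)) \<in> borel_measurable (gauss m \<Otimes>\<^sub>M gauss k)"
      by (intro measurable_dotp_fun measurable_dotp measurable_fst measurable_snd)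
    show "(\<lambda>(x, y). ennreal (exp (dotp k (\<lambda>j. dotp m (D j) x) y))) \<in> borel_measurable (gauss m \<Otimes>\<^sub>M gauss k)"
      unfolding case_prod_unfold by measurable
  qed
  also have "\<dots> = gmom k m (\<lambda>i j. D j i)"
    unfolding gmom_def sw nn_integral_gauss_exp_linear by (simp add: qform_transpose)
  finally show ?thesis by simp
qed

text \<open>The squared Frobenius norm of A^T B, the statistic that governs the product of two
  conditional likelihood ratios.\<close>

definition frob_cross :: "nat \<Rightarrow> nat \<Rightarrow> nat \<Rightarrow> (nat \<Rightarrow> nat \<Rightarrow> real) \<Rightarrow> (nat \<Rightarrow> nat \<Rightarrow> real) \<Rightarrow> real" where
  "frob_cross m k l A B = (\<Sum>j<k. \<Sum>j'<l. (dotp m (A j) (B j'))\<^sup>2)"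

text \<open>The form of B is linearised by an auxiliary Gaussian h, which tilts the integral of A by
  w = B h. The resolvent bounds turn the exponent into |B h|^2 + t^2 |A^T B h|^2. This is a form in
  h whose first block reproduces \<open>gmom m l B\<close> by transposition and whose second block
  has total squared norm t^2 |A^T B|^2.\<close>

lemma gauss_cross_bounds:
  fixes A B :: "nat \<Rightarrow> nat \<Rightarrow> real"
  assumes A: "op_bounded m k A \<eta>" and B: "op_bounded m l B \<eta>" and \<eta>: "0 \<le> \<eta>" "\<eta> \<le> 1 / 16"
  defines "X \<equiv> (\<integral>\<^sup>+x. ennreal (exp (qform m k A x / 2 + qform m l B x / 2)) \<partial>gauss m)"
  shows "gmom m k A * gmom m l B * ennreal (exp (frob_cross m k l A B / 2)) \<le> X"
    and "X \<le> gmom m k A * gmom m l B * ennreal (exp (frob_cross m k l A B / (1 - 4 * \<eta>) / 2))"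
proof -
  define w where "w h i = (\<Sum>j<l. B j i * h j)" for h i
  define C where "C j j' = dotp m (A j) (B j')" for j j'
  \<comment> \<open>Vectors in dimension l: first the m rows of B, then the k rows of A^T B scaled
    by t. The choices t = 1 and t^2 = 1 / (1 - \<eta>) are the lower and upper resolvent
    bounds.\<close>
  define S where "S t j = (if j < m then (\<lambda>j'. B j' j) else (\<lambda>j'. t * C (j - m) j'))" for t :: real and j
  have \<eta>1: "\<eta> < 1" using \<eta> by simp
  have sw: "(\<Sum>j<l. dotp m (B j) x * h j) = dotp m (w h) x" for x h
    unfolding w_def[abs_def] dotp_lincomb by (simp add: mult.commute)
  have X: "X = (\<integral>\<^sup>+h. (\<integral>\<^sup>+x. ennreal (exp (qform m k A x / 2 + dotp m (w h) x)) \<partial>gauss m) \<partial>gauss l)"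
  proof -
    have "X = (\<integral>\<^sup>+x. (\<integral>\<^sup>+h. ennreal (exp (qform m k A x / 2)) * ennreal (exp (dotp l (\<lambda>j. dotp m (B j) x) h)) \<partial>gauss l) \<partial>gauss m)"
      unfolding X_def
      by (intro nn_integral_cong, subst nn_integral_cmult)
         (auto simp: nn_integral_gauss_exp_linear exp_add ennreal_mult' qform_eq, simp add: dotp_def)
    also have "\<dots> = (\<integral>\<^sup>+x. (\<integral>\<^sup>+h. ennreal (exp (qform m k A x / 2 + (\<Sum>j<l. dotp m (B j) x * h j))) \<partial>gauss l) \<partial>gauss m)"
      by (simp add: ennreal_mult'[symmetric] exp_add[symmetric] dotp_def[of l])
    also have "\<dots> = (\<integral>\<^sup>+h. (\<integral>\<^sup>+x. ennreal (exp (qform m k A x / 2 + (\<Sum>j<l. dotp m (B j) x * h j))) \<partial>gauss m) \<partial>gauss l)"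
    proof (rule nn_integral_swap[OF sigma_finite_gauss sigma_finite_gauss])
      have [measurable]: "(\<lambda>x. \<Sum>j<l. dotp m (B j) (fst x) * snd x j) \<in> borel_measurable (gauss m \<Otimes>\<^sub>M gauss l)"
        using measurable_dotp_fun[of l "\<lambda>j x. dotp m (B j) (fst x)", OF measurable_dotp[OF measurable_fst] measurable_snd]
        by (simp add: dotp_def[of l])
      show "(\<lambda>(x, h). ennreal (exp (qform m k A x / 2 + (\<Sum>j<l. dotp m (B j) x * h j)))) \<in> borel_measurable (gauss m \<Otimes>\<^sub>M gauss l)"
        unfolding case_prod_unfold by measurable
    qed
    finally show ?thesis unfolding sw .
  qed
  have q: "qform l (m + k) (S t) h = dotp m (w h) (w h) + t\<^sup>2 * qform m k A (w h)" for t h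
  proof -
    have "qform l (m + k) (S t) h = (\<Sum>j<m. (dotp l (S t j) h)\<^sup>2) + (\<Sum>j<k. (dotp l (S t (m + j)) h)\<^sup>2)"
      unfolding qform_def by (induction k) auto
    also have "(\<Sum>j<m. (dotp l (S t j) h)\<^sup>2) = dotp m (w h) (w h)"
      by (simp add: S_def dotp_def w_def power2_eq_square)
    also have "(\<Sum>j<k. (dotp l (S t (m + j)) h)\<^sup>2) = (\<Sum>j<k. t\<^sup>2 * (dotp m (A j) (w h))\<^sup>2)"
    proof (intro sum.cong refl)
      fix j
      have "dotp m (A j) (w h) = dotp l (C j) h"
        unfolding dotp_commute[of m "A j" "w h"] sw[symmetric] dotp_def[of l] C_def
        by (intro sum.cong refl) (simp add: dotp_commute)
      then show "(dotp l (S t (m + j)) h)\<^sup>2 = t\<^sup>2 * (dotp m (A j) (w h))\<^sup>2"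
        by (simp add: S_def dotp_scale_left power_mult_distrib)
    qed
    finally show ?thesis by (simp add: qform_def sum_distrib_left)
  qed
  have Sm: "gmom l m (S t) = gmom m l B" for t
    unfolding gmom_transpose[symmetric, of m l B] by (rule gmom_cong) (simp add: qform_def S_def)
  have Ssum: "(\<Sum>j<k. dotp l (S t (m + j)) (S t (m + j))) = t\<^sup>2 * frob_cross m k l A B" for t
    by (simp add: S_def dotp_scale_left dotp_scale_right frob_cross_def C_def sum_distrib_left dotp_def[of l] power2_eq_square mult_ac)
  have opS: "op_bounded l (m + k) (S t) ((1 + t\<^sup>2 * \<eta>) * \<eta>)" for t
    unfolding op_bounded_def
  proof
    fix h
    have "dotp m (w h) (w h) \<le> \<eta> * dotp l h h"
      using op_bounded_transpose[OF B \<eta>(1)] unfolding op_bounded_def qform_transpose w_def by simp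
    moreover have "qform l (m + k) (S t) h \<le> dotp m (w h) (w h) + t\<^sup>2 * (\<eta> * dotp m (w h) (w h))"
      unfolding q using A by (auto simp: op_bounded_def intro!: mult_left_mono)
    moreover have "\<dots> = (1 + t\<^sup>2 * \<eta>) * dotp m (w h) (w h)" by (simp add: algebra_simps)
    moreover have "(1 + t\<^sup>2 * \<eta>) * dotp m (w h) (w h) \<le> (1 + t\<^sup>2 * \<eta>) * (\<eta> * dotp l h h)"
      using calculation(1) \<eta> by (intro mult_left_mono) auto
    ultimately show "qform l (m + k) (S t) h \<le> (1 + t\<^sup>2 * \<eta>) * \<eta> * dotp l h h" by (simp add: mult.assoc)
  qed
  have inner: "gmom m k A * ennreal (exp (qform l (m + k) (S 1) h / 2)) \<le> (\<integral>\<^sup>+x. ennreal (exp (qform m k A x / 2 + dotp m (w h) x)) \<partial>gauss m)"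
    "(\<integral>\<^sup>+x. ennreal (exp (qform m k A x / 2 + dotp m (w h) x)) \<partial>gauss m) \<le> gmom m k A * ennreal (exp (qform l (m + k) (S (sqrt (1 / (1 - \<eta>)))) h / 2))" for h
  proof -
    obtain y where y: "\<forall>i<m. y i - (\<Sum>j<k. A j i * dotp m (A j) y) = w h i"
      by (rule tilt_solvable[OF A \<eta>1, of "w h"]) blast
    note b = dotp_tilt_bounds[OF y A \<eta>1 \<eta>(1)]
    show "gmom m k A * ennreal (exp (qform l (m + k) (S 1) h / 2)) \<le> (\<integral>\<^sup>+x. ennreal (exp (qform m k A x / 2 + dotp m (w h) x)) \<partial>gauss m)"
      unfolding gauss_tilt[of m y A k "w h", OF y] q using b(1) by (intro mult_left_mono ennreal_leI) auto
    show "(\<integral>\<^sup>+x. ennreal (exp (qform m k A x / 2 + dotp m (w h) x)) \<partial>gauss m) \<le> gmom m k A * ennreal (exp (qform l (m + k) (S (sqrt (1 / (1 - \<eta>)))) h / 2))"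
      unfolding gauss_tilt[of m y A k "w h", OF y] q using b(2) \<eta>1 by (intro mult_left_mono ennreal_leI) auto
  qed
  have cm: "(\<integral>\<^sup>+h. gmom m k A * ennreal (exp (qform l (m + k) (S t) h / 2)) \<partial>gauss l) = gmom m k A * gmom l (m + k) (S t)" for t
    unfolding gmom_def[of l] by (rule nn_integral_cmult) measurable
  have "(1 + \<eta>) * \<eta> \<le> 17 / 16 * (1 / 16)" using \<eta> by (intro mult_mono) auto
  then have z1: "(1 + 1\<^sup>2 * \<eta>) * \<eta> < 1 / 2" "0 \<le> (1 + 1\<^sup>2 * \<eta>) * \<eta>" using \<eta> by auto
  have "gmom m k A * gmom m l B * ennreal (exp (frob_cross m k l A B / 2)) \<le> gmom m k A * gmom l (m + k) (S 1)"
    using gmom_add_bounds(1)[OF opS z1] unfolding Sm Ssum by (simp add: mult.assoc mult_left_mono)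
  also have "\<dots> \<le> X" unfolding X cm[symmetric] using inner(1) by (intro nn_integral_mono) auto
  finally show "gmom m k A * gmom m l B * ennreal (exp (frob_cross m k l A B / 2)) \<le> X" .
  let ?t = "sqrt (1 / (1 - \<eta>))"
  have t2: "?t\<^sup>2 = 1 / (1 - \<eta>)" using \<eta>1 by simp
  define Z where "Z = (1 + ?t\<^sup>2 * \<eta>) * \<eta>"
  have "?t\<^sup>2 \<le> 16 / 15" unfolding t2 using \<eta> by (simp add: field_simps)
  then have "?t\<^sup>2 * \<eta> \<le> 16 / 15 * (1 / 16)" using \<eta> by (intro mult_mono) auto
  then have "Z \<le> 16 / 15 * \<eta>" unfolding Z_def using \<eta>(1) by (intro mult_right_mono) auto
  moreover have Z0: "0 \<le> Z" unfolding Z_def t2 using \<eta> by simp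
  ultimately have z2: "Z < 1 / 2" and z3: "Z \<le> 16 / 15 * \<eta>" using \<eta> by auto
  have F: "frob_cross m k l A B \<ge> 0" unfolding frob_cross_def by (intro sum_nonneg) auto
  have "(1 - \<eta>) * (1 - 32 / 15 * \<eta>) \<le> (1 - \<eta>) * (1 - 2 * Z)"
    using z3 \<eta> by (intro mult_left_mono) auto
  \<comment> \<open>Two losses are merged: 1 / (1 - \<eta>) from the resolvent and 1 / (1 - 2 Z)
    from appending the second block. To first order they amount to 47/15, which is below 4.\<close>
  moreover have "1 - 4 * \<eta> \<le> (1 - \<eta>) * (1 - 32 / 15 * \<eta>)"
  proof -
    have "0 \<le> \<eta> * \<eta>" by simp
    moreover have "(1 - \<eta>) * (1 - 32 / 15 * \<eta>) = 1 - 47 / 15 * \<eta> + 32 / 15 * (\<eta> * \<eta>)" by (simp add: field_simps)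
    ultimately show ?thesis using \<eta>(1) by linarith
  qed
  ultimately have "1 - 4 * \<eta> \<le> (1 - \<eta>) * (1 - 2 * Z)" by linarith
  then have "frob_cross m k l A B / ((1 - \<eta>) * (1 - 2 * Z)) \<le> frob_cross m k l A B / (1 - 4 * \<eta>)"
    using F \<eta> z2 by (intro divide_left_mono mult_pos_pos) auto
  then have e: "?t\<^sup>2 * frob_cross m k l A B / (1 - 2 * Z) / 2 \<le> frob_cross m k l A B / (1 - 4 * \<eta>) / 2"
    unfolding t2 by (intro divide_right_mono) (simp_all only: divide_divide_eq_left times_divide_eq_left mult_1_left zero_le_numeral)
  have "X \<le> gmom m k A * gmom l (m + k) (S ?t)" unfolding X cm[symmetric] using inner(2) by (intro nn_integral_mono) auto
  also have "\<dots> \<le> gmom m k A * (gmom m l B * ennreal (exp (?t\<^sup>2 * frob_cross m k l A B / (1 - 2 * Z) / 2)))"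
    using gmom_add_bounds(2)[OF opS[of ?t, folded Z_def] z2 Z0] unfolding Sm Ssum by (intro mult_left_mono) auto
  also have "\<dots> \<le> gmom m k A * (gmom m l B * ennreal (exp (frob_cross m k l A B / (1 - 4 * \<eta>) / 2)))"
    using e by (intro mult_left_mono ennreal_leI) auto
  finally show "X \<le> gmom m k A * gmom m l B * ennreal (exp (frob_cross m k l A B / (1 - 4 * \<eta>) / 2))"
    by (simp add: mult.assoc)
qed

section \<open>Determinants and normal densities\<close>

text \<open>Sylvester's identity: the block matrix with rows (I, u) and (v, 1) is factorised in two
  ways into block triangular matrices.\<close>

lemma det_one_minus_outer:
  fixes u v :: "real mat"
  assumes u: "u \<in> carrier_mat m 1" and v: "v \<in> carrier_mat 1 m"
  shows "Determinant.det (1\<^sub>m m - u * v) = 1 - (v * u) $$ (0, 0)"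
proof -
  let ?I = "1\<^sub>m m :: real mat" and ?J = "1\<^sub>m 1 :: real mat" and ?N = "four_block_mat (1\<^sub>m m) u v (1\<^sub>m 1) :: real mat"
  have uv: "u * v \<in> carrier_mat m m" "v * u \<in> carrier_mat 1 1" using u v by auto
  have f1: "four_block_mat ?I (0\<^sub>m m 1) v ?J * four_block_mat ?I u (0\<^sub>m 1 m) (?J - v * u) = ?N"
    by (subst mult_four_block_mat[of _ m m _ 1 _ 1]) (use u v uv in \<open>auto intro!: cong_four_block_mat\<close>)
  have f2: "four_block_mat ?I u (0\<^sub>m 1 m) ?J * four_block_mat (?I - u * v) (0\<^sub>m m 1) v ?J = ?N"
    by (subst mult_four_block_mat[of _ m m _ 1 _ 1]) (use u v uv in \<open>auto intro!: cong_four_block_mat\<close>)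
  have up: "Determinant.det (four_block_mat A (0\<^sub>m m 1) v X) = Determinant.det A * Determinant.det X"
    if "A \<in> carrier_mat m m" "X \<in> carrier_mat 1 1" for A X
    by (rule det_four_block_mat_upper_right_zero[OF that(1) refl v that(2)])
  have low: "Determinant.det (four_block_mat A u (0\<^sub>m 1 m) X) = Determinant.det A * Determinant.det X"
    if "A \<in> carrier_mat m m" "X \<in> carrier_mat 1 1" for A X
    by (rule det_four_block_mat_lower_left_zero[OF that(1) u refl that(2)])
  have X: "?I \<in> carrier_mat m m" "?J \<in> carrier_mat 1 1" "?I - u * v \<in> carrier_mat m m" "?J - v * u \<in> carrier_mat 1 1"
    by (rule one_carrier_mat minus_carrier_mat[OF uv(1)] minus_carrier_mat[OF uv(2)])+
  note dm = det_mult[OF four_block_carrier_mat four_block_carrier_mat]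
  have d1: "Determinant.det ?N = Determinant.det (?J - v * u)"
    using dm[OF X(1,2) X(1,4), of "0\<^sub>m m 1" v u "0\<^sub>m 1 m"] unfolding f1 up[OF X(1,2)] low[OF X(1,4)] by simp
  have d2: "Determinant.det ?N = Determinant.det (?I - u * v)"
    using dm[OF X(1,2) X(3,2), of u "0\<^sub>m 1 m" "0\<^sub>m m 1" v] unfolding f2 up[OF X(3,2)] low[OF X(1,2)] by simp
  have "Determinant.det (?J - v * u) = (?J - v * u) $$ (0, 0)"
    by (rule det_single[OF X(4)])
  also have "\<dots> = 1 - (v * u) $$ (0, 0)" using u v by simp
  finally show ?thesis using d1 d2 by simp
qed

text \<open>Since (I - D D^T) y = d, the matrix with the extra column d factors as (I - D D^T) (I -
  y d^T).\<close>

lemma det_precm_Suc: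
  assumes y: "\<forall>i<m. y i - (\<Sum>j<k. D j i * dotp m (D j) y) = D k i"
  shows "Determinant.det (precm m (Suc k) D) = Determinant.det (precm m k D) * (1 - dotp m (D k) y)"
proof -
  let ?u = "Matrix.mat m 1 (\<lambda>(i, _). y i)" and ?v = "Matrix.mat 1 m (\<lambda>(_, i). D k i)"
  have uv: "?u * ?v = Matrix.mat m m (\<lambda>(i, i'). y i * D k i')"
    by (rule eq_matI) (auto simp: scalar_prod_def)
  have vu: "(?v * ?u) $$ (0, 0) = dotp m (D k) y" by (simp add: scalar_prod_def dotp_def lessThan_atLeast0)
  have "precm m (Suc k) D = precm m k D * (1\<^sub>m m - ?u * ?v)"
  proof (rule eq_matI)
    fix i i' assume "i < dim_row (precm m k D * (1\<^sub>m m - ?u * ?v))" "i' < dim_col (precm m k D * (1\<^sub>m m - ?u * ?v))"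
    then have i: "i < m" "i' < m" by (auto simp: precm_def)
    have "(precm m k D * (1\<^sub>m m - ?u * ?v)) $$ (i, i') =
      (\<Sum>l<m. precm m k D $$ (i, l) * ((if l = i' then 1 else 0) - y l * D k i'))"
      using i unfolding uv by (simp add: precm_def scalar_prod_def lessThan_atLeast0)
    also have "\<dots> = (\<Sum>l<m. (if l = i' then precm m k D $$ (i, l) else 0) - D k i' * (precm m k D $$ (i, l) * y l))"
      by (intro sum.cong refl) (simp add: algebra_simps)
    also have "\<dots> = precm m k D $$ (i, i') - D k i' * (\<Sum>l<m. precm m k D $$ (i, l) * y l)"
      using i by (simp add: sum_subtractf sum_distrib_left)
    also have "(\<Sum>l<m. precm m k D $$ (i, l) * y l) = (precm m k D *\<^sub>v Matrix.vec m y) $ i"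
      using i by (simp add: precm_def scalar_prod_def lessThan_atLeast0)
    also have "\<dots> = D k i" using precm_mult_vec[OF i(1), of k D y] y i by simp
    finally show "precm m (Suc k) D $$ (i, i') = (precm m k D * (1\<^sub>m m - ?u * ?v)) $$ (i, i')"
      using i by (simp add: precm_def)
  qed (auto simp: precm_def)
  moreover have "1\<^sub>m m - ?u * ?v \<in> carrier_mat m m" unfolding uv by (intro minus_carrier_mat) simp
  moreover have "Determinant.det (1\<^sub>m m - ?u * ?v) = 1 - dotp m (D k) y"
    unfolding vu[symmetric] by (rule det_one_minus_outer) auto
  ultimately show ?thesis using det_mult[of "precm m k D" m "1\<^sub>m m - ?u * ?v"] by simp
qed

text \<open>The integral and the determinant obey the same recursion when a column is added, so the
  closed form follows by induction without diagonalisation.\<close>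

lemma gmom_det:
  assumes "op_bounded m k D \<eta>" "\<eta> < 1"
  shows "Determinant.det (precm m k D) > 0"
    and "gmom m k D = ennreal (1 / sqrt (Determinant.det (precm m k D)))"
proof -
  have "Determinant.det (precm m k D) > 0 \<and> gmom m k D = ennreal (1 / sqrt (Determinant.det (precm m k D)))"
    using assms(1)
  proof (induction k)
    case 0
    have "precm m 0 D = 1\<^sub>m m" by (rule eq_matI) (auto simp: precm_def)
    then show ?case by simp
  next
    case (Suc k)
    obtain y where y: "\<forall>i<m. y i - (\<Sum>j<k. D j i * dotp m (D j) y) = D k i"
      by (rule tilt_solvable[OF op_bounded_Suc[OF Suc.prems] assms(2), of "D k"]) blast
    note g = gmom_Suc[OF Suc.prems assms(2) y]
    show ?case unfolding det_precm_Suc[OF y] g(3) using Suc.IH[OF op_bounded_Suc[OF Suc.prems]] g(1,2)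
      by (simp add: real_sqrt_mult ennreal_mult'[symmetric])
  qed
  then show "Determinant.det (precm m k D) > 0"
    and "gmom m k D = ennreal (1 / sqrt (Determinant.det (precm m k D)))" by auto
qed

section \<open>Inverse matrices and normal densities with spiked covariance\<close>

lemma mat_inv_inverse:
  assumes A: "A \<in> carrier_mat n n" and d: "Determinant.det A \<noteq> 0"
  shows "mat_inv A \<in> carrier_mat n n" "A * mat_inv A = 1\<^sub>m n" "mat_inv A * A = 1\<^sub>m n"
proof -
  obtain B where "mat_inverse A = Some B"
    using mat_inverse(1)[OF A, of "()"] det_non_zero_imp_unit[OF A d, of "()"] by (cases "mat_inverse A") auto
  then show "mat_inv A \<in> carrier_mat n n" "A * mat_inv A = 1\<^sub>m n" "mat_inv A * A = 1\<^sub>m n"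
    using mat_inverse(2)[OF A] by (auto simp: mat_inv_def)
qed

lemma det_mat_inv:
  assumes A: "A \<in> carrier_mat n n" and d: "Determinant.det A \<noteq> 0"
  shows "Determinant.det (mat_inv A) = 1 / Determinant.det A"
proof -
  have "Determinant.det A * Determinant.det (mat_inv A) = 1"
    using det_mult[OF A mat_inv_inverse(1)[OF A d]] mat_inv_inverse(2)[OF A d] by simp
  then show ?thesis using d by (simp add: field_simps)
qed

lemma mat_inv_unique:
  assumes A: "A \<in> carrier_mat n n" "B \<in> carrier_mat n n" "A * B = 1\<^sub>m n"
  shows "mat_inv A = B"
proof -
  have "Determinant.det A * Determinant.det B = 1" using det_mult[OF A(1,2)] A(3) by simp
  then have d: "Determinant.det A \<noteq> 0" by auto
  note m = mat_inv_inverse[OF A(1) d]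
  have "mat_inv A = mat_inv A * (A * B)" using m A by simp
  also have "\<dots> = (mat_inv A * A) * B" using m(1) A by (simp add: assoc_mult_mat[of _ n n _ n _ n])
  also have "\<dots> = B" using m(3) A by simp
  finally show ?thesis .
qed

lemma mat_inv_mat_inv:
  assumes A: "A \<in> carrier_mat n n" and d: "Determinant.det A \<noteq> 0"
  shows "mat_inv (mat_inv A) = A"
  by (rule mat_inv_unique[OF mat_inv_inverse(1)[OF A d] A mat_inv_inverse(3)[OF A d]])

lemma mvn_density_precm:
  assumes d: "Determinant.det (precm p r D) \<noteq> 0"
  shows "mvn_density p (mat_inv (precm p r D)) x =
    exp (- (dotp p x x - qform p r D x) / 2) / sqrt ((2 * pi) ^ p / Determinant.det (precm p r D))"
proof -
  have "scalar_prod (Matrix.vec p x) (precm p r D *\<^sub>v Matrix.vec p x) = (\<Sum>i<p. x i * (x i - (\<Sum>j<r. D j i * dotp p (D j) x)))"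
    unfolding scalar_prod_def using precm_mult_vec[of _ p r D x]
    by (auto simp: precm_def lessThan_atLeast0 intro!: sum.cong)
  also have "\<dots> = dotp p x x - (\<Sum>j<r. dotp p (D j) x * (\<Sum>i<p. D j i * x i))"
    by (simp add: right_diff_distrib sum_subtractf dotp_def[of p x x] sum_distrib_left)
       (subst sum.swap, simp add: mult_ac)
  also have "\<dots> = dotp p x x - qform p r D x" by (simp add: qform_eq) (simp add: dotp_def)
  finally show ?thesis
    unfolding mvn_density_def mat_inv_mat_inv[OF precm_carrier d] det_mat_inv[OF precm_carrier d] by simp
qed

lemma mvn_density_one: "mvn_density p (1\<^sub>m p) x = (\<Prod>i<p. std_normal_density (x i))"
proof -
  have p0: "precm p 0 (\<lambda>_ _. 0) = 1\<^sub>m p" by (rule eq_matI) (auto simp: precm_def)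
  have i: "mat_inv (1\<^sub>m p) = (1\<^sub>m p :: real mat)" by (rule mat_inv_unique[of _ p]) auto
  have "mvn_density p (1\<^sub>m p) x = exp (- dotp p x x / 2) / sqrt ((2 * pi) ^ p)"
    using mvn_density_precm[of p 0 "\<lambda>_ _. 0" x] unfolding p0 i by (simp add: qform_def)
  also have "\<dots> = (\<Prod>i<p. std_normal_density (x i))"
  proof -
    have "(\<Sum>i<p. - (x i)\<^sup>2 / 2) = - dotp p x x / 2"
      by (simp add: dotp_def power2_eq_square sum_negf sum_divide_distrib)
    then show ?thesis
      unfolding std_normal_density_def real_sqrt_power prod.distrib exp_sum[OF finite_lessThan, symmetric]
      by (simp add: power_one_over)
  qed
  finally show ?thesis .
qed

lemma mvn_one: "mvn p (1\<^sub>m p) = gauss p"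
proof -
  interpret L: product_sigma_finite "\<lambda>_. lborel :: real measure" by standard
  have [measurable]: "(\<lambda>x. \<Prod>i<p. ennreal (std_normal_density (x i))) \<in> borel_measurable (PiM {..<p} (\<lambda>_. lborel))"
    by measurable
  have e: "ennreal (mvn_density p (1\<^sub>m p) x) = (\<Prod>i<p. ennreal (std_normal_density (x i)))" for x
    unfolding mvn_density_one by (rule prod_ennreal[symmetric]) simp
  show ?thesis
  proof (rule std_normal_sf.PiM_eqI)
    show "sets (mvn p (1\<^sub>m p)) = sets (gauss p)" unfolding mvn_def by (simp cong: sets_PiM_cong)
    fix A assume A': "\<And>i. i \<in> {..<p} \<Longrightarrow> A i \<in> sets std_normal"
    then have A: "i < p \<Longrightarrow> A i \<in> sets borel" for i by auto
    have box: "PiE {..<p} A \<in> sets (PiM {..<p} (\<lambda>_. lborel))" using A by (intro sets_PiM_I_finite) auto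
    have "emeasure (mvn p (1\<^sub>m p)) (PiE {..<p} A) =
      (\<integral>\<^sup>+x. (\<Prod>i<p. ennreal (std_normal_density (x i))) * indicator (PiE {..<p} A) x \<partial>PiM {..<p} (\<lambda>_. lborel))"
      unfolding mvn_def e by (rule emeasure_density) (use box in measurable)
    also have "\<dots> = (\<integral>\<^sup>+x. (\<Prod>i<p. ennreal (std_normal_density (x i)) * indicator (A i) (x i)) \<partial>PiM {..<p} (\<lambda>_. lborel))"
    proof (intro nn_integral_cong)
      fix x assume "x \<in> space (PiM {..<p} (\<lambda>_. lborel :: real measure))"
      then have ext: "x \<in> extensional {..<p}" by (simp add: space_PiM PiE_def)
      have "indicator (PiE {..<p} A) x = (\<Prod>i<p. indicator (A i) (x i) :: ennreal)"
      proof (cases "\<forall>i<p. x i \<in> A i")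
        case True then show ?thesis using ext by (auto simp: indicator_def PiE_def Pi_def)
      next
        case False
        then obtain i where i: "i < p" "x i \<notin> A i" by auto
        then have "(\<Prod>i<p. indicator (A i) (x i) :: ennreal) = 0" by (intro prod_zero bexI[of _ i]) auto
        moreover have "x \<notin> PiE {..<p} A" using i by (auto simp: PiE_def Pi_def)
        ultimately show ?thesis by simp
      qed
      then show "(\<Prod>i<p. ennreal (std_normal_density (x i))) * indicator (PiE {..<p} A) x =
         (\<Prod>i<p. ennreal (std_normal_density (x i)) * indicator (A i) (x i))"
        by (simp add: prod.distrib)
    qed
    also have "\<dots> = (\<Prod>i<p. \<integral>\<^sup>+x. ennreal (std_normal_density x) * indicator (A i) x \<partial>lborel)"
      using A by (subst L.product_nn_integral_prod) auto
    also have "\<dots> = (\<Prod>i<p. emeasure std_normal (A i))"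
      using A by (intro prod.cong refl) (simp add: emeasure_density)
    finally show "emeasure (mvn p (1\<^sub>m p)) (PiE {..<p} A) = (\<Prod>i\<in>{..<p}. emeasure std_normal (A i))" .
  qed simp
qed

lemma null_law_eq: "null_law n p = PiM {..<n} (\<lambda>_. gauss p)"
  by (simp add: null_law_def mvn_one)

text \<open>The scalar is absorbed into the columns, so that I - c A A^T becomes
  \<open>precm\<close> without a further parameter.\<close>

definition mat_fam :: "real \<Rightarrow> real mat \<Rightarrow> nat \<Rightarrow> nat \<Rightarrow> real" where
  "mat_fam c A j i = sqrt c * A $$ (i, j)"

lemma one_minus_gram_eq_precm:
  assumes "A \<in> carrier_mat p r" "c \<ge> 0"
  shows "1\<^sub>m p - c \<cdot>\<^sub>m (A * transpose_mat A) = precm p r (mat_fam c A)"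
proof (rule eq_matI)
  have sc: "sqrt c * a * (sqrt c * b) = c * (a * b)" for a b
    using assms(2) by (metis (no_types, opaque_lifting) mult.assoc mult.left_commute real_sqrt_mult_self abs_of_nonneg)
  fix i i' assume "i < dim_row (precm p r (mat_fam c A))" "i' < dim_col (precm p r (mat_fam c A))"
  then have "i < p" "i' < p" by (auto simp: precm_def)
  then show "(1\<^sub>m p - c \<cdot>\<^sub>m (A * transpose_mat A)) $$ (i, i') = precm p r (mat_fam c A) $$ (i, i')"
    using assms(1) by (auto simp: precm_def scalar_prod_def mat_fam_def sc sum_distrib_left lessThan_atLeast0)
qed (use assms in \<open>auto simp: precm_def\<close>)

text \<open>The likelihood ratio given the drawn matrix, normalised by the Gaussian integral instead
  of the determinant; its null moments are then quotients of such integrals.\<close>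

definition lr_prod :: "nat \<Rightarrow> nat \<Rightarrow> nat \<Rightarrow> (nat \<Rightarrow> nat \<Rightarrow> real) \<Rightarrow> (nat \<Rightarrow> nat \<Rightarrow> real) \<Rightarrow> real" where
  "lr_prod n p r D x = (\<Prod>i<n. exp (qform p r D (x i) / 2)) / enn2real (gmom p r D) ^ n"

lemma iid_density_ratio:
  assumes A: "A \<in> carrier_mat p r" and c: "c \<ge> 0" and op: "op_bounded p r (mat_fam c A) \<eta>" "\<eta> < 1"
  shows "iid_density n p (spiked_cov p c A) x / iid_density n p (1\<^sub>m p) x = lr_prod n p r (mat_fam c A) x"
proof -
  let ?D = "mat_fam c A"
  let ?d = "Determinant.det (precm p r ?D)"
  note g = gmom_det[OF op]
  have d: "?d \<noteq> 0" using g(1) by simp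
  have p0: "precm p 0 (\<lambda>_ _. 0) = 1\<^sub>m p" by (rule eq_matI) (auto simp: precm_def)
  have i: "mat_inv (1\<^sub>m p) = (1\<^sub>m p :: real mat)" by (rule mat_inv_unique[of _ p]) auto
  have one: "mvn_density p (1\<^sub>m p) y = exp (- dotp p y y / 2) / sqrt ((2 * pi) ^ p)" for y
    using mvn_density_precm[of p 0 "\<lambda>_ _. 0" y] unfolding p0 i by (simp add: qform_def)
  have r: "mvn_density p (spiked_cov p c A) y / mvn_density p (1\<^sub>m p) y = exp (qform p r ?D y / 2) / enn2real (gmom p r ?D)" for y
  proof -
    have "exp (- (dotp p y y - qform p r ?D y) / 2) = exp (- dotp p y y / 2) * exp (qform p r ?D y / 2)"
      by (simp add: exp_add[symmetric] field_simps)
    moreover have "enn2real (gmom p r ?D) = 1 / sqrt ?d" unfolding g(2) using g(1) by simp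
    moreover have "sqrt ((2 * pi) ^ p / ?d) = sqrt ((2 * pi) ^ p) / sqrt ?d" by (rule real_sqrt_divide)
    moreover have "sqrt ((2 * pi) ^ p) > 0" "sqrt ?d > 0" using g(1) by auto
    ultimately show ?thesis
      unfolding spiked_cov_def one_minus_gram_eq_precm[OF A c] mvn_density_precm[OF d] one by simp
  qed
  show ?thesis unfolding iid_density_def prod_dividef[symmetric] r lr_prod_def
    by (simp add: prod_dividef)
qed

section \<open>Measurability of the spiked densities\<close>

lemma space_mat_borel [simp]: "space (mat_borel p r) = carrier_mat p r"
  by (simp add: mat_borel_def)

lemma measurable_mat_entry:
  assumes "i < p" "j < r"
  shows "(\<lambda>A. A $$ (i, j)) \<in> borel_measurable (mat_borel p r)"
proof -
  have "(\<lambda>A. \<lambda>ij\<in>{..<p} \<times> {..<r}. A $$ ij) \<in> mat_borel p r \<rightarrow>\<^sub>M PiM ({..<p} \<times> {..<r}) (\<lambda>_. borel)"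
    unfolding mat_borel_def by (rule measurable_vimage_algebra1) (auto simp: space_PiM)
  from measurable_compose[OF this measurable_component_singleton[of "(i, j)"]] assms
  show ?thesis by simp
qed

lemma measurable_into_mat_borel:
  assumes "\<And>x. x \<in> space M \<Longrightarrow> g x \<in> carrier_mat p r"
    and "\<And>i j. i < p \<Longrightarrow> j < r \<Longrightarrow> (\<lambda>x. g x $$ (i, j)) \<in> borel_measurable M"
  shows "g \<in> M \<rightarrow>\<^sub>M mat_borel p r"
  unfolding mat_borel_def
proof (rule measurable_vimage_algebra2)
  show "(\<lambda>x. \<lambda>ij\<in>{..<p} \<times> {..<r}. g x $$ ij) \<in> M \<rightarrow>\<^sub>M PiM ({..<p} \<times> {..<r}) (\<lambda>_. borel)"
    using assms(2) by (intro measurable_restrict) auto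
qed (use assms(1) in auto)

section \<open>Spectral norm and truncation\<close>

definition mat_rows :: "real mat \<Rightarrow> nat \<Rightarrow> nat \<Rightarrow> real" where
  "mat_rows A i j = A $$ (i, j)"

lemma qform_mat_rows:
  assumes "A \<in> carrier_mat p r" "v \<in> carrier_vec r"
  shows "scalar_prod (A *\<^sub>v v) (A *\<^sub>v v) = qform r p (mat_rows A) (\<lambda>i. v $ i)"
  using assms by (auto simp: scalar_prod_def qform_eq mat_rows_def dotp_def lessThan_atLeast0 intro!: sum.cong)

lemma scalar_prod_eq_dotp: "v \<in> carrier_vec r \<Longrightarrow> scalar_prod v v = dotp r (\<lambda>i. v $ i) (\<lambda>i. v $ i)"
  by (auto simp: scalar_prod_def dotp_def lessThan_atLeast0)

lemma qform_scale_arg: "qform m k D (\<lambda>i. c * z i) = c\<^sup>2 * qform m k D z"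
  by (simp add: qform_def dotp_scale_right power_mult_distrib sum_distrib_left)

lemma qform_scale: "qform m k (\<lambda>j i. c * D j i) z = c\<^sup>2 * qform m k D z"
  by (simp add: qform_def dotp_scale_left power_mult_distrib sum_distrib_left)

lemma op_bounded_scale: "op_bounded m k D \<eta> \<Longrightarrow> op_bounded m k (\<lambda>j i. c * D j i) (c\<^sup>2 * \<eta>)"
  unfolding op_bounded_def qform_scale by (simp add: mult.assoc mult_left_mono)

lemma qform_le_frobenius: "qform m k D z \<le> (\<Sum>j<k. dotp m (D j) (D j)) * dotp m z z"
  unfolding qform_def sum_distrib_right by (intro sum_mono dotp_Cauchy_Schwarz)

text \<open>Translates the supremum into a form inequality. The family consists of the rows here,
  because \<open>qform\<close> of the rows at v is |A v|^2.\<close>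

lemma spectral_norm_le_iff:
  assumes A: "A \<in> carrier_mat p r" and t: "t \<ge> 0"
  shows "spectral_norm A \<le> t \<longleftrightarrow> op_bounded r p (mat_rows A) (t\<^sup>2)"
proof -
  let ?S = "{v \<in> carrier_vec r. vec_norm2 v \<le> 1}"
  let ?F = "\<Sum>j<p. dotp r (mat_rows A j) (mat_rows A j)"
  have norm: "vec_norm2 (A *\<^sub>v v) = sqrt (qform r p (mat_rows A) (\<lambda>i. v $ i))" if "v \<in> carrier_vec r" for v
    unfolding vec_norm2_def qform_mat_rows[OF A that] by simp
  have S: "dotp r (\<lambda>i. v $ i) (\<lambda>i. v $ i) \<le> 1" "v \<in> carrier_vec r" if "v \<in> ?S" for v
    using that scalar_prod_eq_dotp[of v r] by (auto simp: vec_norm2_def)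
  \<comment> \<open>The Frobenius norm bounds the values. A conditionally complete supremum is only
    characterised by its upper bounds once this is known.\<close>
  have bdd: "bdd_above ((\<lambda>v. vec_norm2 (A *\<^sub>v v)) ` ?S)"
  proof (rule bdd_aboveI2)
    fix v assume v: "v \<in> ?S"
    have "qform r p (mat_rows A) (\<lambda>i. v $ i) \<le> ?F * dotp r (\<lambda>i. v $ i) (\<lambda>i. v $ i)" by (rule qform_le_frobenius)
    also have "\<dots> \<le> ?F * 1" using S[OF v] by (intro mult_left_mono sum_nonneg) auto
    finally show "vec_norm2 (A *\<^sub>v v) \<le> sqrt ?F" using norm[OF S(2)[OF v]] by simp
  qed
  have ne: "?S \<noteq> {}" by (auto intro!: exI[of _ "0\<^sub>v r"] simp: vec_norm2_def)
  have "spectral_norm A \<le> t \<longleftrightarrow> (\<forall>v\<in>?S. vec_norm2 (A *\<^sub>v v) \<le> t)"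
    unfolding spectral_norm_def using A cSUP_le_iff[OF ne bdd] by auto
  also have "\<dots> \<longleftrightarrow> op_bounded r p (mat_rows A) (t\<^sup>2)"
  proof
    assume L: "\<forall>v\<in>?S. vec_norm2 (A *\<^sub>v v) \<le> t"
    show "op_bounded r p (mat_rows A) (t\<^sup>2)"
      unfolding op_bounded_def
    proof
      fix z
      let ?n = "dotp r z z"
      show "qform r p (mat_rows A) z \<le> t\<^sup>2 * ?n"
      proof (cases "?n = 0")
        case True
        then show ?thesis using qform_le_frobenius[of r p "mat_rows A" z] by simp
      next
        case False
        then have n: "?n > 0" using dotp_self_nonneg[of r z] by linarith
        define v where "v = Matrix.vec r (\<lambda>i. (1 / sqrt ?n) * z i)"
        have vq: "qform r p (mat_rows A) (\<lambda>i. v $ i) = qform r p (mat_rows A) (\<lambda>i. (1 / sqrt ?n) * z i)"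
          unfolding qform_def by (intro sum.cong refl arg_cong[where f = "\<lambda>x. x\<^sup>2"] dotp_cong) (auto simp: v_def)
        have "dotp r (\<lambda>i. v $ i) (\<lambda>i. v $ i) = dotp r (\<lambda>i. (1 / sqrt ?n) * z i) (\<lambda>i. (1 / sqrt ?n) * z i)"
          by (rule dotp_cong) (auto simp: v_def)
        also have "\<dots> = 1" unfolding dotp_scale_left dotp_scale_right using n by (simp add: field_simps)
        finally have "v \<in> ?S" using scalar_prod_eq_dotp[of v r] by (auto simp: v_def vec_norm2_def)
        then have "sqrt (qform r p (mat_rows A) (\<lambda>i. v $ i)) \<le> t" using L norm by fastforce
        then have "qform r p (mat_rows A) (\<lambda>i. v $ i) \<le> t\<^sup>2" by (rule sqrt_le_D)
        then show ?thesis unfolding vq qform_scale_arg using n by (simp add: power_divide field_simps)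
      qed
    qed
  next
    assume R: "op_bounded r p (mat_rows A) (t\<^sup>2)"
    show "\<forall>v\<in>?S. vec_norm2 (A *\<^sub>v v) \<le> t"
    proof
      fix v assume v: "v \<in> ?S"
      have "qform r p (mat_rows A) (\<lambda>i. v $ i) \<le> t\<^sup>2 * dotp r (\<lambda>i. v $ i) (\<lambda>i. v $ i)" using R by (simp add: op_bounded_def)
      also have "\<dots> \<le> t\<^sup>2 * 1" using S[OF v] by (intro mult_left_mono) auto
      finally show "vec_norm2 (A *\<^sub>v v) \<le> t" unfolding norm[OF S(2)[OF v]] using t by (simp add: real_le_lsqrt)
    qed
  qed
  finally show ?thesis .
qed

text \<open>Both sides of the inequality are continuous in z, so rational vectors suffice. The
  quantifier becomes countable, which makes the truncation event measurable.\<close>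

lemma op_bounded_iff_rational: "op_bounded m k D \<eta> \<longleftrightarrow> (\<forall>z\<in>PiE {..<m} (\<lambda>_. \<rat>). qform m k D z \<le> \<eta> * dotp m z z)"
proof
  assume R: "\<forall>z\<in>PiE {..<m} (\<lambda>_. \<rat>). qform m k D z \<le> \<eta> * dotp m z z"
  show "op_bounded m k D \<eta>"
    unfolding op_bounded_def
  proof
    fix z :: "nat \<Rightarrow> real"
    have "\<exists>q\<in>\<rat>. z i - 1 / Suc n < q \<and> q < z i" for i n
      by (rule Rats_dense_in_real) simp
    then obtain q where q: "\<And>i n. q i n \<in> \<rat>" "\<And>i n. z i - 1 / Suc n < q i n" "\<And>i n. q i n < z i" by metis
    define y where "y n = restrict (\<lambda>i. q i n) {..<m}" for n
    have lim: "(\<lambda>n. q i n) \<longlonglongrightarrow> z i" for i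
    proof (rule tendsto_sandwich[where f = "\<lambda>n. z i - 1 / Suc n" and h = "\<lambda>n. z i"])
      show "(\<lambda>n. z i - 1 / real (Suc n)) \<longlonglongrightarrow> z i" using tendsto_diff[OF tendsto_const[of "z i"] LIMSEQ_Suc[OF lim_1_over_n]] by simp
    qed (use q in \<open>auto intro!: always_eventually less_imp_le\<close>)
    have ly: "(\<lambda>n. y n i) \<longlonglongrightarrow> z i" if "i < m" for i using lim[of i] that by (simp add: y_def)
    have l1: "(\<lambda>n. dotp m u (y n)) \<longlonglongrightarrow> dotp m u z" for u
      unfolding dotp_def by (intro tendsto_intros) (use ly in auto)
    have l2: "(\<lambda>n. dotp m (y n) (y n)) \<longlonglongrightarrow> dotp m z z"
      unfolding dotp_def by (intro tendsto_intros) (use ly in auto)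
    have "(\<lambda>n. qform m k D (y n)) \<longlonglongrightarrow> qform m k D z"
      unfolding qform_def by (intro tendsto_intros l1)
    moreover have "(\<lambda>n. \<eta> * dotp m (y n) (y n)) \<longlonglongrightarrow> \<eta> * dotp m z z"
      by (intro tendsto_intros l2)
    moreover have "\<exists>N. \<forall>n\<ge>N. qform m k D (y n) \<le> \<eta> * dotp m (y n) (y n)"
      using R q(1) by (auto simp: y_def)
    ultimately show "qform m k D z \<le> \<eta> * dotp m z z" by (rule LIMSEQ_le)
  qed
qed (auto simp: op_bounded_def)

lemma measurable_spectral_norm_le:
  assumes t: "t \<ge> 0"
  shows "{A \<in> carrier_mat p r. spectral_norm A \<le> t} \<in> sets (mat_borel p r)"
proof -
  have m: "(\<lambda>A. qform r p (mat_rows A) z) \<in> borel_measurable (mat_borel p r)" for z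
    unfolding qform_def dotp_def mat_rows_def
    by (intro borel_measurable_sum borel_measurable_power borel_measurable_times measurable_mat_entry) auto
  have c: "countable (PiE {..<r} (\<lambda>_. \<rat> :: real set))"
    by (intro countable_PiE countable_rat) auto
  have "{A \<in> carrier_mat p r. spectral_norm A \<le> t} =
    {A \<in> space (mat_borel p r). \<forall>z\<in>PiE {..<r} (\<lambda>_. \<rat>). qform r p (mat_rows A) z \<le> t\<^sup>2 * dotp r z z}"
    using spectral_norm_le_iff[OF _ t] op_bounded_iff_rational[of r p _ "t\<^sup>2"] by auto
  also have "\<dots> \<in> sets (mat_borel p r)"
    using m by (intro sets.sets_Collect_countable_All'[OF _ c] borel_measurable_le borel_measurable_const)
  finally show ?thesis .
qed

definition mat_trunc :: "nat \<Rightarrow> nat \<Rightarrow> real \<Rightarrow> real mat \<Rightarrow> real mat" where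
  "mat_trunc p r t Z = (if spectral_norm Z \<le> t then Z else 0\<^sub>m p r)"

lemma mat_trunc_carrier [simp]: "Z \<in> carrier_mat p r \<Longrightarrow> mat_trunc p r t Z \<in> carrier_mat p r"
  by (simp add: mat_trunc_def)

lemma measurable_mat_trunc:
  assumes t: "t \<ge> 0"
  shows "mat_trunc p r t \<in> mat_borel p r \<rightarrow>\<^sub>M mat_borel p r"
proof (rule measurable_into_mat_borel)
  fix i j assume ij: "i < p" "j < r"
  have [measurable]: "(\<lambda>A. A $$ (i, j)) \<in> borel_measurable (mat_borel p r)" by (rule measurable_mat_entry[OF ij])
  have [measurable]: "Measurable.pred (mat_borel p r) (\<lambda>A. spectral_norm A \<le> t)"
    using measurable_spectral_norm_le[OF t, of p r] by (simp add: pred_def)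
  have "(\<lambda>A. if spectral_norm A \<le> t then A $$ (i, j) else 0) \<in> borel_measurable (mat_borel p r)" by measurable
  moreover have "(\<lambda>A. mat_trunc p r t A $$ (i, j)) = (\<lambda>A. if spectral_norm A \<le> t then A $$ (i, j) else 0)"
    using ij by (auto simp: mat_trunc_def fun_eq_iff)
  ultimately show "(\<lambda>A. mat_trunc p r t A $$ (i, j)) \<in> borel_measurable (mat_borel p r)"
    by simp
qed simp

lemma measurable_mat_of_fun: "Matrix.mat p r \<in> PiM ({..<p} \<times> {..<r}) (\<lambda>_. std_normal) \<rightarrow>\<^sub>M mat_borel p r"
proof (rule measurable_into_mat_borel)
  fix i j assume "i < p" "j < r"
  then show "(\<lambda>x. Matrix.mat p r x $$ (i, j)) \<in> borel_measurable (PiM ({..<p} \<times> {..<r}) (\<lambda>_. std_normal))"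
    using measurable_component_singleton[of "(i, j)" "{..<p} \<times> {..<r}" "\<lambda>_. std_normal"] by simp
qed simp

lemma measurable_det:
  fixes E :: "'a \<Rightarrow> nat \<Rightarrow> nat \<Rightarrow> real"
  assumes e: "\<And>i i'. i < p \<Longrightarrow> i' < p \<Longrightarrow> (\<lambda>x. E x i i') \<in> borel_measurable M"
  shows "(\<lambda>x. Determinant.det (Matrix.mat p p (\<lambda>(i, i'). E x i i'))) \<in> borel_measurable M"
proof -
  have perm: "\<pi> i < p" if "\<pi> permutes {0..<p}" "i \<in> {0..<p}" for \<pi> i
    using permutes_in_image[OF that(1), of i] that(2) by simp
  have "(\<lambda>x. \<Sum>\<pi>\<in>{\<pi>. \<pi> permutes {0..<p}}. (signof \<pi> :: real) * (\<Prod>i = 0..<p. E x i (\<pi> i))) \<in> borel_measurable M"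
  proof (rule borel_measurable_sum)
    fix \<pi> assume \<pi>: "\<pi> \<in> {\<pi>. \<pi> permutes {0..<p}}"
    have "(\<lambda>x. \<Prod>i = 0..<p. E x i (\<pi> i)) \<in> borel_measurable M"
    proof (rule borel_measurable_prod)
      fix i assume i: "i \<in> {0..<p}"
      have "\<pi> i < p" using perm[of \<pi> i] i \<pi> by blast
      moreover have "i < p" using i by simp
      ultimately show "(\<lambda>x. E x i (\<pi> i)) \<in> borel_measurable M" by (intro e)
    qed
    then show "(\<lambda>x. signof \<pi> * (\<Prod>i = 0..<p. E x i (\<pi> i))) \<in> borel_measurable M"
      by (rule borel_measurable_times[OF borel_measurable_const])
  qed
  moreover have "Determinant.det (Matrix.mat p p (\<lambda>(i, i'). E x i i')) =
      (\<Sum>\<pi>\<in>{\<pi>. \<pi> permutes {0..<p}}. (signof \<pi> :: real) * (\<Prod>i = 0..<p. E x i (\<pi> i)))" for x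
  proof (subst det_def'[of _ p], simp, rule sum.cong[OF refl])
    fix \<pi> assume \<pi>: "\<pi> \<in> {\<pi>. \<pi> permutes {0..<p}}"
    have "(\<Prod>i = 0..<p. Matrix.mat p p (\<lambda>(i, i'). E x i i') $$ (i, \<pi> i)) = (\<Prod>i = 0..<p. E x i (\<pi> i))"
    proof (rule prod.cong[OF refl])
      fix i assume i: "i \<in> {0..<p}"
      have "\<pi> i < p" using perm[of \<pi> i] i \<pi> by blast
      then show "Matrix.mat p p (\<lambda>(i, i'). E x i i') $$ (i, \<pi> i) = E x i (\<pi> i)" using i by simp
    qed
    then show "signof \<pi> * (\<Prod>i = 0..<p. Matrix.mat p p (\<lambda>(i, i'). E x i i') $$ (i, \<pi> i)) =
       signof \<pi> * (\<Prod>i = 0..<p. E x i (\<pi> i))" by (rule arg_cong)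
  qed
  ultimately show ?thesis by simp
qed

lemma measurable_det_precm:
  assumes D: "\<And>i j. i < p \<Longrightarrow> j < r \<Longrightarrow> (\<lambda>x. D x j i) \<in> borel_measurable M"
  shows "(\<lambda>x. Determinant.det (precm p r (D x))) \<in> borel_measurable M"
  unfolding precm_def
proof (rule measurable_det)
  fix i i' assume "i < p" "i' < p"
  then show "(\<lambda>x. (if i = i' then 1 else 0) - (\<Sum>j<r. D x j i * D x j i')) \<in> borel_measurable M"
    using D by (intro borel_measurable_diff borel_measurable_const borel_measurable_sum borel_measurable_times) auto
qed

text \<open>Measurability is wanted on all matrices, including those for which I - c A A^T is
  singular and \<open>mat_inv\<close> is unspecified. There the inverse is \<open>the None\<close>
  for every A, so the density is constant in A; elsewhere it is an explicit expression in the
  entries and the determinant.\<close>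

lemma measurable_iid_density_spiked:
  assumes c: "c \<ge> 0"
  shows "(\<lambda>A. iid_density n p (spiked_cov p c A) x) \<in> borel_measurable (mat_borel p r)"
proof -
  let ?D = "mat_fam c"
  let ?B = "\<lambda>A. precm p r (?D A)"
  let ?E = "\<lambda>A. \<Prod>i<n. exp (- (dotp p (x i) (x i) - qform p r (?D A) (x i)) / 2) / sqrt ((2 * pi) ^ p / Determinant.det (?B A))"
  let ?K = "\<Prod>i<n. mvn_density p (the None) (x i)"
  have ent: "(\<lambda>A. ?D A j i) \<in> borel_measurable (mat_borel p r)" if "i < p" "j < r" for i j
    unfolding mat_fam_def by (intro borel_measurable_times measurable_mat_entry borel_measurable_const that)
  have [measurable]: "(\<lambda>A. Determinant.det (?B A)) \<in> borel_measurable (mat_borel p r)"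
    by (rule measurable_det_precm) (rule ent)
  have [measurable]: "(\<lambda>A. qform p r (?D A) z) \<in> borel_measurable (mat_borel p r)" for z
    unfolding qform_def dotp_def
    by (intro borel_measurable_sum borel_measurable_power borel_measurable_times borel_measurable_const ent) auto
  have H1: "(\<lambda>A. if Determinant.det (?B A) = 0 then ?K else ?E A) \<in> borel_measurable (mat_borel p r)"
    by measurable
  have H2: "iid_density n p (spiked_cov p c A) x = (if Determinant.det (?B A) = 0 then ?K else ?E A)"
    if "A \<in> space (mat_borel p r)" for A
  proof -
    have sc: "spiked_cov p c A = mat_inv (?B A)"
      unfolding spiked_cov_def using one_minus_gram_eq_precm[of A p r c] that c by simp
    show ?thesis
    proof (cases "Determinant.det (?B A) = 0")
      case True
      have "mat_inverse (?B A) = None"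
      proof (cases "mat_inverse (?B A)")
        case (Some C)
        then have "?B A * C = 1\<^sub>m p" "C \<in> carrier_mat p p" using mat_inverse(2)[OF precm_carrier] by auto
        then have "Determinant.det (?B A) * Determinant.det C = 1"
          using det_mult[OF precm_carrier, of C p r "?D A"] by simp
        then show ?thesis using True by simp
      qed simp
      then show ?thesis using True unfolding iid_density_def sc mat_inv_def by simp
    next
      case False
      then show ?thesis unfolding iid_density_def sc mvn_density_precm[OF False] by simp
    qed
  qed
  show ?thesis by (rule iffD2[OF measurable_cong H1]) (rule H2)
qed

section \<open>Mixtures of likelihood ratios\<close>

abbreviation nulls :: "nat \<Rightarrow> nat \<Rightarrow> (nat \<Rightarrow> nat \<Rightarrow> real) measure" where
  "nulls n p \<equiv> PiM {..<n} (\<lambda>_. gauss p)"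

lemma prob_space_nulls: "prob_space (nulls n p)"
  by (rule prob_space_PiM) (rule prob_space_gauss)

lemma nulls_prod:
  assumes "f \<in> borel_measurable (gauss p)"
  shows "(\<integral>\<^sup>+x. (\<Prod>i<n. f (x i)) \<partial>nulls n p) = (\<integral>\<^sup>+z. f z \<partial>gauss p) ^ n"
proof -
  interpret product_sigma_finite "\<lambda>_::nat. gauss p"
    unfolding product_sigma_finite_def using sigma_finite_gauss by auto
  show ?thesis using assms by (subst product_nn_integral_prod) auto
qed

definition gm :: "nat \<Rightarrow> nat \<Rightarrow> (nat \<Rightarrow> nat \<Rightarrow> real) \<Rightarrow> real" where
  "gm p r D = enn2real (gmom p r D)"

definition fnorm2 :: "nat \<Rightarrow> nat \<Rightarrow> (nat \<Rightarrow> nat \<Rightarrow> real) \<Rightarrow> real" where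
  "fnorm2 p r D = (\<Sum>j<r. dotp p (D j) (D j))"

lemma fnorm2_nonneg [simp]: "fnorm2 p r D \<ge> 0"
  by (simp add: fnorm2_def sum_nonneg)

lemma gm_ge_1:
  assumes "op_bounded p r D \<zeta>" "0 \<le> \<zeta>" "\<zeta> < 1 / 2"
  shows "gmom p r D = ennreal (gm p r D)" "1 \<le> gm p r D"
proof -
  note b = gmom_bounds[OF assms(1,3,2)]
  have "gmom p r D < \<infinity>" by (rule le_less_trans[OF b(2)]) simp
  then show e: "gmom p r D = ennreal (gm p r D)" unfolding gm_def by simp
  have "ennreal 1 \<le> ennreal (exp ((\<Sum>j<r. dotp p (D j) (D j)) / 2))" by (intro ennreal_leI) (simp add: sum_nonneg)
  also have "\<dots> \<le> gmom p r D" by (rule b(1))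
  finally show "1 \<le> gm p r D" unfolding e by (simp add: gm_def)
qed

lemma lr_prod_eq: "lr_prod n p r D x = (\<Prod>i<n. exp (qform p r D (x i) / 2) / gm p r D)"
  by (simp add: lr_prod_def gm_def prod_dividef)

lemma gm_nonneg [simp]: "gm p r D \<ge> 0"
  by (simp add: gm_def)

lemma lr_prod_nonneg [simp]: "lr_prod n p r D x \<ge> 0"
  unfolding lr_prod_eq by (intro prod_nonneg) simp

lemma qform_measurable_gauss: "(\<lambda>z. qform p r D z) \<in> borel_measurable (gauss p)"
  using measurable_qform[OF measurable_ident_sets[OF refl], of p r D] by simp

lemma dotp_self_measurable_gauss: "(\<lambda>z. dotp p z z) \<in> borel_measurable (gauss p)"
  using measurable_dotp_self[OF measurable_ident_sets[OF refl] measurable_ident_sets[OF refl], of p] by simp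

lemma nn_integral_lr_prod:
  assumes "op_bounded p r D \<zeta>" "0 \<le> \<zeta>" "\<zeta> < 1 / 2"
  shows "(\<integral>\<^sup>+x. ennreal (lr_prod n p r D x) \<partial>nulls n p) = 1"
proof -
  note [measurable] = qform_measurable_gauss
  note g = gm_ge_1[OF assms]
  have "(\<integral>\<^sup>+x. ennreal (lr_prod n p r D x) \<partial>nulls n p) = (\<integral>\<^sup>+z. ennreal (exp (qform p r D z / 2) / gm p r D) \<partial>gauss p) ^ n"
    unfolding lr_prod_eq by (subst nulls_prod[symmetric]) (measurable, simp add: prod_ennreal)
  also have "(\<integral>\<^sup>+z. ennreal (exp (qform p r D z / 2) / gm p r D) \<partial>gauss p) = gmom p r D * ennreal (1 / gm p r D)"
    unfolding gmom_def by (subst nn_integral_multc[symmetric]) (measurable, simp add: ennreal_mult'[symmetric])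
  also have "\<dots> = 1" unfolding g(1) using g(2) by (simp add: ennreal_mult'[symmetric])
  finally show ?thesis by simp
qed

text \<open>The bounds for one observation are raised to the power n; the two normalising constants
  cancel exactly and only the cross term remains.\<close>

lemma nn_integral_lr_prod_cross:
  fixes n :: nat
  assumes A: "op_bounded p r A \<eta>" and B: "op_bounded p r' B \<eta>" and \<eta>: "0 \<le> \<eta>" "\<eta> \<le> 1 / 16"
  defines "X \<equiv> (\<integral>\<^sup>+x. ennreal (lr_prod n p r A x * lr_prod n p r' B x) \<partial>nulls n p)"
  shows "ennreal (exp (real n * frob_cross p r r' A B / 2)) \<le> X"
    and "X \<le> ennreal (exp (real n * frob_cross p r r' A B / (1 - 4 * \<eta>) / 2))"
proof -
  note [measurable] = qform_measurable_gauss
  have \<eta>2: "\<eta> < 1 / 2" using \<eta> by simp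
  note gA = gm_ge_1[OF A \<eta>(1) \<eta>2] and gB = gm_ge_1[OF B \<eta>(1) \<eta>2]
  let ?g = "gm p r A * gm p r' B"
  have g: "?g > 0" using gA(2) gB(2) by simp
  let ?Y = "(\<integral>\<^sup>+x. ennreal (exp (qform p r A x / 2 + qform p r' B x / 2)) \<partial>gauss p)"
  have "X = (\<integral>\<^sup>+z. ennreal (exp (qform p r A z / 2 + qform p r' B z / 2) * (1 / ?g)) \<partial>gauss p) ^ n"
    unfolding X_def lr_prod_eq prod.distrib[symmetric]
    by (subst nulls_prod[symmetric]) (measurable, simp add: prod_ennreal exp_add)
  also have "(\<integral>\<^sup>+z. ennreal (exp (qform p r A z / 2 + qform p r' B z / 2) * (1 / ?g)) \<partial>gauss p) = ?Y * ennreal (1 / ?g)"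
    by (subst nn_integral_multc[symmetric]) (measurable, simp only: ennreal_mult'[OF exp_ge_zero])
  finally have X: "X = (?Y * ennreal (1 / ?g)) ^ n" .
  have can: "gmom p r A * gmom p r' B * ennreal (exp t) * ennreal (1 / ?g) = ennreal (exp t)" for t
    unfolding gA(1) gB(1) using g gA(2) gB(2) by (simp add: ennreal_mult'[symmetric])
  have pw: "ennreal (exp t) ^ n = ennreal (exp (real n * t))" for t
    by (simp add: ennreal_power exp_of_nat_mult)
  note b = gauss_cross_bounds[OF A B \<eta>]
  have "ennreal (exp (frob_cross p r r' A B / 2)) \<le> ?Y * ennreal (1 / ?g)"
    by (subst can[of "frob_cross p r r' A B / 2", symmetric]) (intro mult_right_mono b, auto)
  then have "ennreal (exp (frob_cross p r r' A B / 2)) ^ n \<le> X" unfolding X by (intro power_mono) auto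
  then show "ennreal (exp (real n * frob_cross p r r' A B / 2)) \<le> X" unfolding pw by simp
  have "?Y * ennreal (1 / ?g) \<le> ennreal (exp (frob_cross p r r' A B / (1 - 4 * \<eta>) / 2))"
    by (subst can[of "frob_cross p r r' A B / (1 - 4 * \<eta>) / 2", symmetric]) (intro mult_right_mono b, auto)
  then have "X \<le> ennreal (exp (frob_cross p r r' A B / (1 - 4 * \<eta>) / 2)) ^ n" unfolding X by (intro power_mono) auto
  then show "X \<le> ennreal (exp (real n * frob_cross p r r' A B / (1 - 4 * \<eta>) / 2))" unfolding pw by simp
qed

text \<open>The scaling substitution with a^2 = 1 - 2 l, applied to the constant function 1.\<close>

lemma nn_integral_gauss_exp_sq_norm:
  assumes "l < 1 / 2"
  shows "(\<integral>\<^sup>+z. ennreal (exp (l * dotp p z z)) \<partial>gauss p) = ennreal (1 / sqrt (1 - 2 * l) ^ p)"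
proof -
  note [measurable] = dotp_self_measurable_gauss
  let ?a = "sqrt (1 - 2 * l)"
  have a: "?a > 0" "?a\<^sup>2 = 1 - 2 * l" using assms by auto
  have "1 = (\<integral>\<^sup>+z. 1 \<partial>gauss p)" using prob_space.emeasure_space_1[OF prob_space_gauss[of p]] by simp
  also have "\<dots> = (\<integral>\<^sup>+z. ennreal (?a ^ p * exp (- (?a\<^sup>2 - 1) * dotp p z z / 2)) * 1 \<partial>gauss p)"
    by (rule nn_integral_gauss_scale[OF a(1)]) simp
  also have "\<dots> = ennreal (?a ^ p) * (\<integral>\<^sup>+z. ennreal (exp (l * dotp p z z)) \<partial>gauss p)"
    unfolding a(2) using a(1) by (subst nn_integral_cmult[symmetric]) (measurable, simp add: ennreal_mult')
  finally have *: "1 = ennreal (?a ^ p) * (\<integral>\<^sup>+z. ennreal (exp (l * dotp p z z)) \<partial>gauss p)" .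
  have "ennreal (1 / ?a ^ p) = ennreal (1 / ?a ^ p) * (ennreal (?a ^ p) * (\<integral>\<^sup>+z. ennreal (exp (l * dotp p z z)) \<partial>gauss p))"
    unfolding *[symmetric] by simp
  also have "\<dots> = (ennreal (1 / ?a ^ p) * ennreal (?a ^ p)) * (\<integral>\<^sup>+z. ennreal (exp (l * dotp p z z)) \<partial>gauss p)"
    by (simp add: mult.assoc)
  also have "ennreal (1 / ?a ^ p) * ennreal (?a ^ p) = 1" using a(1) by (simp add: ennreal_mult'[symmetric])
  finally show ?thesis by simp
qed

text \<open>The form is split as t q + (1 - t) q, that is, into 2 r columns; the second half then
  counts as appended columns and is bounded below by its norms.\<close>

lemma gmom_shrink:
  assumes op: "op_bounded p r D \<zeta>" "\<zeta> < 1 / 2" "0 \<le> \<zeta>" and t: "0 \<le> t" "t \<le> 1"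
  shows "gmom p r (\<lambda>j i. sqrt t * D j i) * ennreal (exp ((1 - t) * fnorm2 p r D / 2)) \<le> gmom p r D"
proof -
  define S where "S j = (if j < r then (\<lambda>i. sqrt t * D j i) else (\<lambda>i. sqrt (1 - t) * D (j - r) i))" for j
  have q: "qform p (r + r) S z = qform p r D z" for z
  proof -
    have "qform p (r + r) S z = (\<Sum>j<r. (dotp p (S j) z)\<^sup>2) + (\<Sum>j<r. (dotp p (S (r + j)) z)\<^sup>2)"
      unfolding qform_def using sum.atLeastLessThan_concat[of 0 r "r + r" "\<lambda>j. (dotp p (S j) z)\<^sup>2"]
        sum.shift_bounds_nat_ivl[of "\<lambda>j. (dotp p (S j) z)\<^sup>2" 0 r r] by (simp add: lessThan_atLeast0 add.commute)
    also have "\<dots> = (\<Sum>j<r. t * (dotp p (D j) z)\<^sup>2 + (1 - t) * (dotp p (D j) z)\<^sup>2)"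
      using t by (simp add: S_def dotp_scale_left power_mult_distrib sum.distrib)
    finally show ?thesis by (simp add: qform_def algebra_simps)
  qed
  have "op_bounded p (r + r) S \<zeta>" using op(1) unfolding op_bounded_def q .
  from gmom_add_bounds(1)[OF this op(2,3)]
  have "gmom p r S * ennreal (exp ((\<Sum>j<r. dotp p (S (r + j)) (S (r + j))) / 2)) \<le> gmom p (r + r) S" .
  moreover have "gmom p (r + r) S = gmom p r D" by (rule gmom_cong) (rule q)
  moreover have "gmom p r S = gmom p r (\<lambda>j i. sqrt t * D j i)" by (rule gmom_cong) (simp add: qform_def S_def)
  moreover have "(\<Sum>j<r. dotp p (S (r + j)) (S (r + j))) = (1 - t) * fnorm2 p r D"
    using t by (simp add: S_def dotp_scale_left dotp_scale_right fnorm2_def sum_distrib_left mult.assoc[symmetric])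
  ultimately show ?thesis by simp
qed

text \<open>One half of a Chernoff bound for the total squared norm of the data. The first factor is
  the value under the null law; the second is the extra decay caused by the larger variance of the
  alternative.\<close>

lemma nn_integral_lr_prod_damped:
  assumes op: "op_bounded p r D \<zeta>" "0 \<le> \<zeta>" "\<zeta> < 1 / 2" and l: "0 \<le> l"
  shows "(\<integral>\<^sup>+x. ennreal (lr_prod n p r D x * exp (- l * (\<Sum>i<n. dotp p (x i) (x i)))) \<partial>nulls n p)
    \<le> ennreal ((1 / sqrt (1 + 2 * l) ^ p) ^ n * exp (- real n * (l / (1 + 2 * l)) * fnorm2 p r D))"
proof -
  note [measurable] = qform_measurable_gauss dotp_self_measurable_gauss
  note g = gm_ge_1[OF op]
  \<comment> \<open>Rescaling by a absorbs the damping into the Gaussian weight and shrinks the form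
    by t = 1 / a^2, which leads to \<open>gmom_shrink\<close>.\<close>
  let ?a = "sqrt (1 + 2 * l)" and ?t = "1 / (1 + 2 * l)"
  have a: "?a > 0" "?a\<^sup>2 = 1 + 2 * l" using l by auto
  have t: "0 \<le> ?t" "?t \<le> 1" using l by auto
  define D' where "D' j i = sqrt ?t * D j i" for j i
  have qa: "qform p r D' (\<lambda>i\<in>{..<p}. ?a * z i) = qform p r D z" for z
  proof -
    have "qform p r D' (\<lambda>i\<in>{..<p}. ?a * z i) = qform p r D' (\<lambda>i. ?a * z i)" by (simp add: qform_def dotp_restrict)
    also have "\<dots> = ?a\<^sup>2 * (sqrt ?t)\<^sup>2 * qform p r D z" unfolding qform_scale_arg D'_def qform_scale by simp
    also have "?a\<^sup>2 * (sqrt ?t)\<^sup>2 = 1" using l by simp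
    finally show ?thesis unfolding mult_1_left .
  qed
  define I where "I = (\<integral>\<^sup>+z. ennreal (exp (qform p r D z / 2) * exp (- l * dotp p z z)) \<partial>gauss p)"
  have "gmom p r D' = (\<integral>\<^sup>+z. ennreal (?a ^ p * exp (- (?a\<^sup>2 - 1) * dotp p z z / 2)) * ennreal (exp (qform p r D z / 2)) \<partial>gauss p)"
    unfolding gmom_def by (subst nn_integral_gauss_scale[OF a(1)]) (measurable, simp add: qa)
  also have "\<dots> = ennreal (?a ^ p) * I"
    unfolding a(2) I_def using a(1) by (subst nn_integral_cmult[symmetric])
      (measurable, simp add: ennreal_mult'[symmetric] mult_ac)
  finally have "ennreal (1 / ?a ^ p) * gmom p r D' = ennreal (1 / ?a ^ p) * ennreal (?a ^ p) * I" by (simp add: mult.assoc)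
  also have "ennreal (1 / ?a ^ p) * ennreal (?a ^ p) = 1" using a(1) by (simp add: ennreal_mult'[symmetric])
  finally have I: "I = ennreal (1 / ?a ^ p) * gmom p r D'" by simp
  let ?e = "(1 - ?t) * fnorm2 p r D / 2"
  have e: "?e = (l / (1 + 2 * l)) * fnorm2 p r D" using l by (simp add: field_simps)
  have "gmom p r D' = gmom p r D' * ennreal (exp ?e) * ennreal (exp (- ?e))"
    by (simp add: mult.assoc ennreal_mult'[symmetric] exp_add[symmetric])
  also have "\<dots> \<le> gmom p r D * ennreal (exp (- ?e))"
    unfolding D'_def by (intro mult_right_mono gmom_shrink[OF op(1,3,2) t]) auto
  finally have "I * ennreal (1 / gm p r D) \<le> ennreal (1 / ?a ^ p) * (gmom p r D * ennreal (exp (- ?e))) * ennreal (1 / gm p r D)"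
    unfolding I by (intro mult_right_mono mult_left_mono) auto
  also have "\<dots> = ennreal (1 / ?a ^ p * exp (- ?e))"
    unfolding g(1) using g(2) a(1) by (simp add: ennreal_mult'[symmetric] mult_ac)
  finally have J: "I * ennreal (1 / gm p r D) \<le> ennreal (1 / ?a ^ p * exp (- ?e))" .
  have "(\<integral>\<^sup>+x. ennreal (lr_prod n p r D x * exp (- l * (\<Sum>i<n. dotp p (x i) (x i)))) \<partial>nulls n p) =
    (\<integral>\<^sup>+z. ennreal (exp (qform p r D z / 2) * exp (- l * dotp p z z) * (1 / gm p r D)) \<partial>gauss p) ^ n"
    unfolding lr_prod_eq sum_distrib_left exp_sum[OF finite_lessThan] prod.distrib[symmetric]
    by (subst nulls_prod[symmetric]) (measurable, simp add: prod_ennreal)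
  also have "(\<integral>\<^sup>+z. ennreal (exp (qform p r D z / 2) * exp (- l * dotp p z z) * (1 / gm p r D)) \<partial>gauss p) = I * ennreal (1 / gm p r D)"
    unfolding I_def by (subst nn_integral_multc[symmetric]) (measurable, simp only: ennreal_mult'[OF mult_nonneg_nonneg[OF exp_ge_zero exp_ge_zero]])
  also have "(I * ennreal (1 / gm p r D)) ^ n \<le> ennreal (1 / ?a ^ p * exp (- ?e)) ^ n" using J by (intro power_mono) auto
  also have "\<dots> = ennreal ((1 / ?a ^ p) ^ n * exp (- real n * (l / (1 + 2 * l)) * fnorm2 p r D))"
  proof -
    have "exp (- real n * (l / (1 + 2 * l)) * fnorm2 p r D) = exp (- ?e) ^ n"
      unfolding e exp_of_nat_mult[symmetric] by (simp add: mult_ac)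
    moreover have "0 \<le> 1 / ?a ^ p * exp (- ?e)" using a(1) by simp
    ultimately show ?thesis by (simp only: ennreal_power power_mult_distrib)
  qed
  finally show ?thesis .
qed

text \<open>Only a finite measure is required, so that the restrictions of a law to an event and to
  its complement are covered too.\<close>

definition fam_ok :: "'w measure \<Rightarrow> nat \<Rightarrow> nat \<Rightarrow> ('w \<Rightarrow> nat \<Rightarrow> nat \<Rightarrow> real) \<Rightarrow> real \<Rightarrow> bool" where
  "fam_ok M p r D \<eta> \<longleftrightarrow> finite_measure M \<and> (\<forall>i<p. \<forall>j<r. (\<lambda>w. D w j i) \<in> borel_measurable M) \<and>
     (\<forall>w\<in>space M. op_bounded p r (D w) \<eta>)"

definition mixlr :: "nat \<Rightarrow> nat \<Rightarrow> nat \<Rightarrow> 'w measure \<Rightarrow> ('w \<Rightarrow> nat \<Rightarrow> nat \<Rightarrow> real) \<Rightarrow> (nat \<Rightarrow> nat \<Rightarrow> real) \<Rightarrow> real" where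
  "mixlr n p r M D x = (\<integral>w. lr_prod n p r (D w) x \<partial>M)"

lemma measurable_qform_joint:
  assumes D: "\<And>i j. i < p \<Longrightarrow> j < r \<Longrightarrow> (\<lambda>w. D w j i) \<in> borel_measurable M"
    and g: "g \<in> N \<rightarrow>\<^sub>M M" and f: "f \<in> N \<rightarrow>\<^sub>M gauss p"
  shows "(\<lambda>t. qform p r (D (g t)) (f t)) \<in> borel_measurable N"
  unfolding qform_def using measurable_compose[OF g D]
  by (intro borel_measurable_sum borel_measurable_power measurable_dotp_fun[OF _ f]) auto

lemma measurable_gm:
  assumes D: "\<And>i j. i < p \<Longrightarrow> j < r \<Longrightarrow> (\<lambda>w. D w j i) \<in> borel_measurable M"
  shows "(\<lambda>w. gm p r (D w)) \<in> borel_measurable M"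
proof -
  interpret sigma_finite_measure "gauss p" by (rule sigma_finite_gauss)
  have [measurable]: "(\<lambda>x. qform p r (D (fst x)) (snd x)) \<in> borel_measurable (M \<Otimes>\<^sub>M gauss p)"
    by (rule measurable_qform_joint[OF D measurable_fst measurable_snd])
  have "(\<lambda>w. \<integral>\<^sup>+z. ennreal (exp (qform p r (D w) z / 2)) \<partial>gauss p) \<in> borel_measurable M"
    by (rule borel_measurable_nn_integral) (unfold case_prod_unfold, measurable)
  then show ?thesis unfolding gm_def gmom_def by measurable
qed

lemma measurable_lr_prod_joint:
  assumes D: "\<And>i j. i < p \<Longrightarrow> j < r \<Longrightarrow> (\<lambda>w. D w j i) \<in> borel_measurable M"
    and g: "g \<in> N \<rightarrow>\<^sub>M M" and f: "f \<in> N \<rightarrow>\<^sub>M nulls n p"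
  shows "(\<lambda>t. lr_prod n p r (D (g t)) (f t)) \<in> borel_measurable N"
  unfolding lr_prod_eq
proof (rule borel_measurable_prod)
  fix i assume i: "i \<in> {..<n}"
  have "(\<lambda>t. f t i) \<in> N \<rightarrow>\<^sub>M gauss p"
    using measurable_compose[OF f measurable_component_singleton[OF i]] .
  from measurable_qform_joint[OF D g this]
  have [measurable]: "(\<lambda>t. qform p r (D (g t)) (f t i)) \<in> borel_measurable N" .
  have [measurable]: "(\<lambda>t. gm p r (D (g t))) \<in> borel_measurable N"
    by (rule measurable_compose[OF g measurable_gm[OF D]])
  show "(\<lambda>t. exp (qform p r (D (g t)) (f t i) / 2) / gm p r (D (g t))) \<in> borel_measurable N" by measurable
qed

lemma fam_okD:
  assumes "fam_ok M p r D \<eta>"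
  shows "finite_measure M" "\<And>i j. i < p \<Longrightarrow> j < r \<Longrightarrow> (\<lambda>w. D w j i) \<in> borel_measurable M"
    "\<And>w. w \<in> space M \<Longrightarrow> op_bounded p r (D w) \<eta>" "sigma_finite_measure M"
  using assms finite_measure.axioms(1) by (auto simp: fam_ok_def)

lemma measurable_mixlr:
  assumes "fam_ok M p r D \<eta>"
  shows "mixlr n p r M D \<in> borel_measurable (nulls n p)"
proof -
  interpret sigma_finite_measure M by (rule fam_okD(4)[OF assms])
  show ?thesis
    unfolding mixlr_def
    by (rule borel_measurable_lebesgue_integral)
       (unfold case_prod_unfold, rule measurable_lr_prod_joint[OF fam_okD(2)[OF assms] measurable_snd measurable_fst])
qed

lemma mixlr_nonneg [simp]: "mixlr n p r M D x \<ge> 0"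
  unfolding mixlr_def by (intro integral_nonneg_AE) simp

text \<open>For fixed data the ratio is bounded in the drawn matrix, since \<open>gm\<close> is at
  least 1 and the form is at most \<eta> |x|^2. Hence the Bochner integral in \<open>mixlr\<close>
  is a genuine one and not the default value 0.\<close>

lemma ennreal_mixlr:
  assumes ok: "fam_ok M p r D \<eta>" and \<eta>: "0 \<le> \<eta>" "\<eta> < 1 / 2" and x: "x \<in> space (nulls n p)"
  shows "ennreal (mixlr n p r M D x) = (\<integral>\<^sup>+w. ennreal (lr_prod n p r (D w) x) \<partial>M)"
proof -
  interpret finite_measure M by (rule fam_okD(1)[OF ok])
  have m: "(\<lambda>w. lr_prod n p r (D w) x) \<in> borel_measurable M"
    using measurable_lr_prod_joint[OF fam_okD(2)[OF ok] measurable_ident_sets[OF refl] measurable_const[OF x]] by simp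
  have b: "lr_prod n p r (D w) x \<le> (\<Prod>i<n. exp (\<eta> * dotp p (x i) (x i) / 2))" if "w \<in> space M" for w
    unfolding lr_prod_eq
  proof (intro prod_mono conjI)
    fix i
    have op: "op_bounded p r (D w) \<eta>" by (rule fam_okD(3)[OF ok that])
    note g = gm_ge_1[OF op \<eta>]
    have "exp (qform p r (D w) (x i) / 2) / gm p r (D w) \<le> exp (qform p r (D w) (x i) / 2) / 1"
      using g(2) by (intro divide_left_mono) auto
    also have "\<dots> \<le> exp (\<eta> * dotp p (x i) (x i) / 2)" using op by (simp add: op_bounded_def)
    finally show "exp (qform p r (D w) (x i) / 2) / gm p r (D w) \<le> exp (\<eta> * dotp p (x i) (x i) / 2)" .
  qed simp
  have "integrable M (\<lambda>w. lr_prod n p r (D w) x)"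
    using b m by (intro integrable_const_bound[where B = "\<Prod>i<n. exp (\<eta> * dotp p (x i) (x i) / 2)"]) auto
  then show ?thesis unfolding mixlr_def by (subst nn_integral_eq_integral) auto
qed

text \<open>Tonelli with a free weight h: the same exchange gives the mean, the damped mean and the
  product of two mixtures.\<close>

lemma nn_integral_mixlr_weighted:
  assumes ok: "fam_ok M p r D \<eta>" and \<eta>: "0 \<le> \<eta>" "\<eta> < 1 / 2"
    and h: "h \<in> borel_measurable (nulls n p)" "\<And>x. h x \<ge> 0"
  shows "(\<integral>\<^sup>+x. ennreal (mixlr n p r M D x * h x) \<partial>nulls n p) =
    (\<integral>\<^sup>+w. (\<integral>\<^sup>+x. ennreal (lr_prod n p r (D w) x * h x) \<partial>nulls n p) \<partial>M)"
proof -
  note [measurable] = h(1)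
  have [measurable]: "(\<lambda>y. lr_prod n p r (D (snd y)) (fst y)) \<in> borel_measurable (nulls n p \<Otimes>\<^sub>M M)"
    by (rule measurable_lr_prod_joint[OF fam_okD(2)[OF ok] measurable_snd measurable_fst])
  have "(\<integral>\<^sup>+x. ennreal (mixlr n p r M D x * h x) \<partial>nulls n p) =
    (\<integral>\<^sup>+x. (\<integral>\<^sup>+w. ennreal (lr_prod n p r (D w) x * h x) \<partial>M) \<partial>nulls n p)"
  proof (rule nn_integral_cong)
    fix x assume x: "x \<in> space (nulls n p)"
    have m: "(\<lambda>w. lr_prod n p r (D w) x) \<in> borel_measurable M"
      using measurable_lr_prod_joint[OF fam_okD(2)[OF ok] measurable_ident_sets[OF refl] measurable_const[OF x]] by simp
    have "ennreal (mixlr n p r M D x * h x) = (\<integral>\<^sup>+w. ennreal (lr_prod n p r (D w) x) \<partial>M) * ennreal (h x)"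
      using h(2) by (simp add: ennreal_mult ennreal_mixlr[OF ok \<eta> x, symmetric])
    also have "\<dots> = (\<integral>\<^sup>+w. ennreal (lr_prod n p r (D w) x * h x) \<partial>M)"
      using m h(2) by (subst nn_integral_multc[symmetric]) (auto simp: ennreal_mult)
    finally show "ennreal (mixlr n p r M D x * h x) = (\<integral>\<^sup>+w. ennreal (lr_prod n p r (D w) x * h x) \<partial>M)" .
  qed
  also have "\<dots> = (\<integral>\<^sup>+w. (\<integral>\<^sup>+x. ennreal (lr_prod n p r (D w) x * h x) \<partial>nulls n p) \<partial>M)"
  proof (rule nn_integral_swap[OF prob_space_imp_sigma_finite[OF prob_space_nulls] fam_okD(4)[OF ok]])
    show "(\<lambda>(x, w). ennreal (lr_prod n p r (D w) x * h x)) \<in> borel_measurable (nulls n p \<Otimes>\<^sub>M M)"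
      unfolding case_prod_unfold by measurable
  qed
  finally show ?thesis .
qed

lemma nn_integral_mixlr:
  assumes ok: "fam_ok M p r D \<eta>" and \<eta>: "0 \<le> \<eta>" "\<eta> < 1 / 2"
  shows "(\<integral>\<^sup>+x. ennreal (mixlr n p r M D x) \<partial>nulls n p) = emeasure M (space M)"
proof -
  have "(\<integral>\<^sup>+x. ennreal (mixlr n p r M D x) \<partial>nulls n p) = (\<integral>\<^sup>+w. (\<integral>\<^sup>+x. ennreal (lr_prod n p r (D w) x) \<partial>nulls n p) \<partial>M)"
    using nn_integral_mixlr_weighted[OF ok \<eta>, of "\<lambda>_. 1"] by simp
  also have "\<dots> = (\<integral>\<^sup>+w. 1 \<partial>M)"
    by (intro nn_integral_cong nn_integral_lr_prod[OF fam_okD(3)[OF ok] \<eta>])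
  finally show ?thesis by simp
qed

lemma nn_integral_mixlr_damped:
  assumes ok: "fam_ok M p r D \<eta>" and \<eta>: "0 \<le> \<eta>" "\<eta> < 1 / 2" and l: "0 \<le> l"
  shows "(\<integral>\<^sup>+x. ennreal (mixlr n p r M D x * exp (- l * (\<Sum>i<n. dotp p (x i) (x i)))) \<partial>nulls n p)
    \<le> (\<integral>\<^sup>+w. ennreal ((1 / sqrt (1 + 2 * l) ^ p) ^ n * exp (- real n * (l / (1 + 2 * l)) * fnorm2 p r (D w))) \<partial>M)"
proof -
  have "(\<lambda>x. dotp p (x i) (x i)) \<in> borel_measurable (nulls n p)" if "i < n" for i
    using measurable_compose[OF measurable_component_singleton[of i "{..<n}" "\<lambda>_. gauss p"] dotp_self_measurable_gauss] that by simp
  then have [measurable]: "(\<lambda>x. \<Sum>i<n. dotp p (x i) (x i)) \<in> borel_measurable (nulls n p)" by auto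
  have h: "(\<lambda>x. exp (- l * (\<Sum>i<n. dotp p (x i) (x i)))) \<in> borel_measurable (nulls n p)" by measurable
  show ?thesis
    unfolding nn_integral_mixlr_weighted[OF ok \<eta>, of "\<lambda>x. exp (- l * (\<Sum>i<n. dotp p (x i) (x i)))", OF h exp_ge_zero]
    by (intro nn_integral_mono nn_integral_lr_prod_damped[OF fam_okD(3)[OF ok] \<eta> l])
qed

lemma nn_integral_mixlr_cross:
  fixes n :: nat
  assumes M: "fam_ok M p r A \<eta>" and N: "fam_ok N p r' B \<eta>" and \<eta>: "0 \<le> \<eta>" "\<eta> \<le> 1 / 16"
  defines "X \<equiv> (\<integral>\<^sup>+x. ennreal (mixlr n p r M A x * mixlr n p r' N B x) \<partial>nulls n p)"
  shows "(\<integral>\<^sup>+w. (\<integral>\<^sup>+v. ennreal (exp (real n * frob_cross p r r' (A w) (B v) / 2)) \<partial>N) \<partial>M) \<le> X"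
    and "X \<le> (\<integral>\<^sup>+w. (\<integral>\<^sup>+v. ennreal (exp (real n * frob_cross p r r' (A w) (B v) / (1 - 4 * \<eta>) / 2)) \<partial>N) \<partial>M)"
proof -
  have \<eta>2: "\<eta> < 1 / 2" using \<eta> by simp
  have lm: "lr_prod n p r (A w) \<in> borel_measurable (nulls n p)" if "w \<in> space M" for w
    using measurable_lr_prod_joint[OF fam_okD(2)[OF M] measurable_const[OF that] measurable_ident_sets[OF refl]] by simp
  have "X = (\<integral>\<^sup>+w. (\<integral>\<^sup>+x. ennreal (lr_prod n p r (A w) x * mixlr n p r' N B x) \<partial>nulls n p) \<partial>M)"
    unfolding X_def by (rule nn_integral_mixlr_weighted[OF M \<eta>(1) \<eta>2 measurable_mixlr[OF N]]) simp
  also have "\<dots> = (\<integral>\<^sup>+w. (\<integral>\<^sup>+v. (\<integral>\<^sup>+x. ennreal (lr_prod n p r (A w) x * lr_prod n p r' (B v) x) \<partial>nulls n p) \<partial>N) \<partial>M)"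
  proof (rule nn_integral_cong)
    fix w assume "w \<in> space M"
    from nn_integral_mixlr_weighted[OF N \<eta>(1) \<eta>2 lm[OF this]]
    show "(\<integral>\<^sup>+x. ennreal (lr_prod n p r (A w) x * mixlr n p r' N B x) \<partial>nulls n p) =
       (\<integral>\<^sup>+v. (\<integral>\<^sup>+x. ennreal (lr_prod n p r (A w) x * lr_prod n p r' (B v) x) \<partial>nulls n p) \<partial>N)"
      by (simp add: mult.commute)
  qed
  finally have X: "X = \<dots>" .
  note b = nn_integral_lr_prod_cross[OF fam_okD(3)[OF M] fam_okD(3)[OF N] \<eta>]
  show "(\<integral>\<^sup>+w. (\<integral>\<^sup>+v. ennreal (exp (real n * frob_cross p r r' (A w) (B v) / 2)) \<partial>N) \<partial>M) \<le> X"
    unfolding X by (intro nn_integral_mono b)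
  show "X \<le> (\<integral>\<^sup>+w. (\<integral>\<^sup>+v. ennreal (exp (real n * frob_cross p r r' (A w) (B v) / (1 - 4 * \<eta>) / 2)) \<partial>N) \<partial>M)"
    unfolding X by (intro nn_integral_mono b)
qed

lemma fam_ok_restrict:
  assumes "fam_ok M p r D \<eta>" "G \<in> sets M" "\<And>w. w \<in> G \<Longrightarrow> op_bounded p r (D w) \<eta>'"
  shows "fam_ok (restrict_space M G) p r D \<eta>'"
  using assms unfolding fam_ok_def
  by (auto intro!: finite_measure_restrict_space measurable_restrict_space1 simp: space_restrict_space)

text \<open>Splits a mixture along an event of the drawn matrix; used to separate the well
  conditioned draws of the proxy model from the rest.\<close>

lemma mixlr_split:
  assumes ok: "fam_ok M p r D \<eta>" and \<eta>: "0 \<le> \<eta>" "\<eta> < 1 / 2" and G: "G \<in> sets M" and x: "x \<in> space (nulls n p)"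
  shows "mixlr n p r M D x = mixlr n p r (restrict_space M G) D x + mixlr n p r (restrict_space M (space M - G)) D x"
proof -
  let ?f = "\<lambda>w. ennreal (lr_prod n p r (D w) x)"
  have m: "(\<lambda>w. lr_prod n p r (D w) x) \<in> borel_measurable M"
    using measurable_lr_prod_joint[OF fam_okD(2)[OF ok] measurable_ident_sets[OF refl] measurable_const[OF x]] by simp
  have ok': "fam_ok (restrict_space M H) p r D \<eta>" if "H \<in> sets M" for H
    by (rule fam_ok_restrict[OF ok that]) (use sets.sets_into_space[OF that] fam_okD(3)[OF ok] in auto)
  have Gc: "space M - G \<in> sets M" using G by auto
  have "ennreal (mixlr n p r M D x) = (\<integral>\<^sup>+w. ?f w \<partial>M)" by (rule ennreal_mixlr[OF ok \<eta> x])
  also have "\<dots> = (\<integral>\<^sup>+w. ?f w * indicator G w + ?f w * indicator (space M - G) w \<partial>M)"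
    by (intro nn_integral_cong) (auto split: split_indicator)
  also have "\<dots> = (\<integral>\<^sup>+w. ?f w * indicator G w \<partial>M) + (\<integral>\<^sup>+w. ?f w * indicator (space M - G) w \<partial>M)"
    using m G Gc by (intro nn_integral_add) auto
  also have "\<dots> = ennreal (mixlr n p r (restrict_space M G) D x) + ennreal (mixlr n p r (restrict_space M (space M - G)) D x)"
    using G Gc by (simp add: nn_integral_restrict_space ennreal_mixlr[OF ok'[OF G] \<eta> x] ennreal_mixlr[OF ok'[OF Gc] \<eta> x])
  also have "\<dots> = ennreal (mixlr n p r (restrict_space M G) D x + mixlr n p r (restrict_space M (space M - G)) D x)"
    by simp
  finally show ?thesis by (subst (asm) ennreal_inj) auto
qed

section \<open>Gaussian matrices\<close>

abbreviation gz :: "nat \<Rightarrow> nat \<Rightarrow> (nat \<times> nat \<Rightarrow> real) measure" where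
  "gz p r \<equiv> PiM ({..<p} \<times> {..<r}) (\<lambda>_. std_normal)"

definition zfam :: "(nat \<times> nat \<Rightarrow> real) \<Rightarrow> nat \<Rightarrow> nat \<Rightarrow> real" where
  "zfam z j i = z (i, j)"

lemma prob_space_gz: "prob_space (gz p r)"
  by (rule prob_space_gauss_ix)

lemma measurable_zfam: "i < p \<Longrightarrow> j < r \<Longrightarrow> (\<lambda>z. zfam z j i) \<in> borel_measurable (gz p r)"
  unfolding zfam_def using measurable_component_singleton[of "(i, j)" "{..<p} \<times> {..<r}" "\<lambda>_. std_normal"] by simp

text \<open>A matrix of independent normals has independent Gaussian columns. The measure
  \<open>nulls r p\<close> reappears here as the law of r columns in dimension p.\<close>

lemma nn_integral_gz_columns:
  assumes f: "f \<in> borel_measurable (gz p r)"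
  shows "(\<integral>\<^sup>+z. f z \<partial>gz p r) = (\<integral>\<^sup>+y. f (\<lambda>ij\<in>{..<p} \<times> {..<r}. y (snd ij) (fst ij)) \<partial>nulls r p)"
proof -
  let ?IJ = "{..<p} \<times> {..<r}"
  let ?T = "\<lambda>y. \<lambda>ij\<in>?IJ. y (snd ij) (fst ij)"
  interpret G: product_sigma_finite "\<lambda>_::nat. gauss p"
    unfolding product_sigma_finite_def using sigma_finite_gauss by auto
  have T: "?T \<in> nulls r p \<rightarrow>\<^sub>M gz p r"
  proof (rule measurable_restrict)
    fix ij assume "ij \<in> ?IJ"
    then have ij: "snd ij \<in> {..<r}" "fst ij \<in> {..<p}" by auto
    have "(\<lambda>y. y (snd ij)) \<in> nulls r p \<rightarrow>\<^sub>M gauss p" by (rule measurable_component_singleton[OF ij(1)])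
    moreover have "(\<lambda>y. y (fst ij)) \<in> gauss p \<rightarrow>\<^sub>M std_normal" by (rule measurable_component_singleton[OF ij(2)])
    ultimately show "(\<lambda>y. y (snd ij) (fst ij)) \<in> nulls r p \<rightarrow>\<^sub>M std_normal" by (rule measurable_compose)
  qed
  have "distr (nulls r p) (gz p r) ?T = gz p r"
  proof (rule std_normal_sf.PiM_eqI)
    fix A assume A: "\<And>i. i \<in> ?IJ \<Longrightarrow> A i \<in> sets std_normal"
    have box: "PiE ?IJ A \<in> sets (gz p r)" using A by (intro sets_PiM_I_finite) auto
    have boxj: "PiE {..<p} (\<lambda>i. A (i, j)) \<in> sets (gauss p)" if "j < r" for j
      using A that by (intro sets_PiM_I_finite) auto
    have "?T -` PiE ?IJ A \<inter> space (nulls r p) = PiE {..<r} (\<lambda>j. PiE {..<p} (\<lambda>i. A (i, j)))"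
      by (auto simp: space_PiM PiE_def Pi_def extensional_def)
    then have "emeasure (distr (nulls r p) (gz p r) ?T) (PiE ?IJ A) = emeasure (nulls r p) (PiE {..<r} (\<lambda>j. PiE {..<p} (\<lambda>i. A (i, j))))"
      by (subst emeasure_distr[OF T box]) simp
    also have "\<dots> = (\<Prod>j<r. emeasure (gauss p) (PiE {..<p} (\<lambda>i. A (i, j))))"
      using boxj by (subst G.emeasure_PiM) auto
    also have "\<dots> = (\<Prod>j<r. \<Prod>i<p. emeasure std_normal (A (i, j)))"
      using A by (intro prod.cong refl, subst std_normal_sf.emeasure_PiM) auto
    also have "\<dots> = (\<Prod>i<p. \<Prod>j<r. emeasure std_normal (A (i, j)))" by (rule prod.swap)
    also have "\<dots> = (\<Prod>ij\<in>?IJ. emeasure std_normal (A ij))" by (simp add: prod.cartesian_product)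
    finally show "emeasure (distr (nulls r p) (gz p r) ?T) (PiE ?IJ A) = (\<Prod>ij\<in>?IJ. emeasure std_normal (A ij))" .
  qed auto
  then have "(\<integral>\<^sup>+z. f z \<partial>gz p r) = (\<integral>\<^sup>+z. f z \<partial>distr (nulls r p) (gz p r) ?T)" by simp
  also have "\<dots> = (\<integral>\<^sup>+y. f (?T y) \<partial>nulls r p)" by (rule nn_integral_distr[OF T]) (use f in simp)
  finally show ?thesis .
qed

lemma frob_cross_eq_qform: "frob_cross p r l A B = (\<Sum>j<r. qform p l B (A j))"
  by (simp add: frob_cross_def qform_def dotp_commute)

lemma zfam_columns: "j < r \<Longrightarrow> i < p \<Longrightarrow> zfam (\<lambda>ij\<in>{..<p} \<times> {..<r}. y (snd ij) (fst ij)) j i = y j i"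
  by (simp add: zfam_def)

lemma dotp_zfam_columns:
  "j < r \<Longrightarrow> dotp p u (zfam (\<lambda>ij\<in>{..<p} \<times> {..<r}. y (snd ij) (fst ij)) j) = dotp p u (y j)"
  by (rule dotp_cong) (auto simp: zfam_columns)

lemma qform_zfam_columns:
  "j < r \<Longrightarrow> qform p l B (zfam (\<lambda>ij\<in>{..<p} \<times> {..<r}. y (snd ij) (fst ij)) j) = qform p l B (y j)"
  by (simp add: qform_def dotp_zfam_columns)

lemma measurable_dotp_zfam:
  assumes "j < r" shows "(\<lambda>z. dotp p u (zfam z j)) \<in> borel_measurable (gz p r)"
  unfolding dotp_def using measurable_zfam[OF _ assms]
  by (intro borel_measurable_sum borel_measurable_times borel_measurable_const) auto

lemma measurable_qform_zfam:
  assumes "j < r" shows "(\<lambda>z. qform p l B (zfam z j)) \<in> borel_measurable (gz p r)"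
  unfolding qform_def by (intro borel_measurable_sum borel_measurable_power measurable_dotp_zfam assms)

lemma measurable_frob_cross_zfam: "(\<lambda>z. frob_cross p r l (zfam z) B) \<in> borel_measurable (gz p r)"
  unfolding frob_cross_eq_qform by (intro borel_measurable_sum measurable_qform_zfam) auto

text \<open>For fixed B the statistic is a sum of the form of B over the independent columns of the
  Gaussian matrix, so the integral is exactly the r-th power of \<open>gmom\<close> for sqrt s
  B.\<close>

lemma gauss_frob_bounds:
  fixes r :: nat
  assumes op: "op_bounded p l B \<eta>" and s: "0 \<le> s" and \<zeta>: "0 \<le> \<eta>" "s * \<eta> \<le> \<zeta>" "\<zeta> < 1 / 2"
  defines "X \<equiv> (\<integral>\<^sup>+z. ennreal (exp (s * frob_cross p r l (zfam z) B / 2)) \<partial>gz p r)"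
  shows "ennreal (exp (real r * s * fnorm2 p l B / 2)) \<le> X"
    and "X \<le> ennreal (exp (real r * s * fnorm2 p l B / (1 - 2 * \<zeta>) / 2))"
proof -
  note [measurable] = measurable_frob_cross_zfam qform_measurable_gauss
  define B' where "B' j i = sqrt s * B j i" for j i
  have z0: "0 \<le> \<zeta>" using \<zeta>(1,2) s by (meson mult_nonneg_nonneg order_trans)
  have op': "op_bounded p l B' \<zeta>"
  proof -
    have "op_bounded p l B' (s * \<eta>)" using op_bounded_scale[OF op, of "sqrt s"] s unfolding B'_def by simp
    then show ?thesis using \<zeta>(2) unfolding op_bounded_def
      by (meson dotp_self_nonneg mult_right_mono order_trans)
  qed
  have q: "qform p l B' z = s * qform p l B z" for z
    unfolding B'_def qform_scale using s by simp
  have fn: "(\<Sum>j<l. dotp p (B' j) (B' j)) = s * fnorm2 p l B"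
    unfolding B'_def dotp_scale_left dotp_scale_right fnorm2_def sum_distrib_left using s by (simp add: mult.assoc[symmetric])
  have "X = (\<integral>\<^sup>+y. (\<Prod>j<r. ennreal (exp (qform p l B' (y j) / 2))) \<partial>nulls r p)"
    unfolding X_def
    by (subst nn_integral_gz_columns)
       (measurable, simp add: frob_cross_eq_qform qform_zfam_columns q prod_ennreal exp_sum[symmetric] sum_distrib_left sum_divide_distrib)
  also have "\<dots> = gmom p l B' ^ r"
  proof -
    have "(\<lambda>z. ennreal (exp (qform p l B' z / 2))) \<in> borel_measurable (gauss p)"
      using qform_measurable_gauss[of p l B'] by simp
    from nulls_prod[OF this, of r] show ?thesis unfolding gmom_def .
  qed
  finally have X: "X = gmom p l B' ^ r" .
  note b = gmom_bounds[OF op' \<zeta>(3) z0, unfolded fn]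
  have pw: "ennreal (exp t) ^ r = ennreal (exp (real r * t))" for t
    by (simp add: ennreal_power exp_of_nat_mult)
  have "ennreal (exp (s * fnorm2 p l B / 2)) ^ r \<le> X" unfolding X by (intro power_mono b) auto
  then show "ennreal (exp (real r * s * fnorm2 p l B / 2)) \<le> X" unfolding pw by (simp add: mult.assoc)
  have "X \<le> ennreal (exp (s * fnorm2 p l B / (1 - 2 * \<zeta>) / 2)) ^ r" unfolding X by (intro power_mono b) auto
  then show "X \<le> ennreal (exp (real r * s * fnorm2 p l B / (1 - 2 * \<zeta>) / 2))" unfolding pw by (simp add: mult.assoc)
qed

text \<open>The columns of the identity. Taking B = \<open>idf\<close> turns the cross statistic
  into the squared Frobenius norm, so that \<open>gauss_frob_bounds\<close> also yields its
  exponential moments.\<close>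

definition idf :: "nat \<Rightarrow> nat \<Rightarrow> real" where
  "idf j i = (if i = j then 1 else 0)"

lemma dotp_idf: "j < p \<Longrightarrow> dotp p (idf j) z = z j"
  by (simp add: dotp_def idf_def if_distrib[of "\<lambda>x. x * _"] sum.delta cong: if_cong)

lemma qform_idf: "qform p p idf z = dotp p z z"
proof -
  have "qform p p idf z = (\<Sum>j<p. (z j)\<^sup>2)" unfolding qform_def by (intro sum.cong refl) (simp add: dotp_idf)
  then show ?thesis by (simp add: dotp_def power2_eq_square)
qed

lemma fnorm2_idf: "fnorm2 p p idf = real p"
proof -
  have "fnorm2 p p idf = (\<Sum>j<p. 1)" unfolding fnorm2_def by (intro sum.cong refl) (simp add: dotp_idf, simp add: idf_def)
  then show ?thesis by simp
qed

lemma op_bounded_idf: "op_bounded p p idf 1"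
  by (simp add: op_bounded_def qform_idf)

lemma frob_cross_idf: "frob_cross p r p A idf = fnorm2 p r A"
  by (simp add: frob_cross_eq_qform qform_idf fnorm2_def)

lemma measurable_fnorm2_zfam: "(\<lambda>z. fnorm2 p r (zfam z)) \<in> borel_measurable (gz p r)"
  using measurable_frob_cross_zfam[of p r p idf] unfolding frob_cross_idf .

lemma gz_exp_neg_fnorm2:
  assumes u: "0 \<le> u"
  shows "(\<integral>\<^sup>+z. ennreal (exp (- u * fnorm2 p r (zfam z) / 2)) \<partial>gz p r) = ennreal ((1 / sqrt (1 + u) ^ p) ^ r)"
proof -
  note [measurable] = measurable_fnorm2_zfam dotp_self_measurable_gauss
  have f: "fnorm2 p r (zfam (\<lambda>ij\<in>{..<p} \<times> {..<r}. y (snd ij) (fst ij))) = (\<Sum>j<r. dotp p (y j) (y j))" for y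
    by (simp add: fnorm2_def qform_idf[symmetric] qform_zfam_columns)
  have e: "exp (- u * (\<Sum>j<r. dotp p (y j) (y j)) / 2) = (\<Prod>j<r. exp (- u / 2 * dotp p (y j) (y j)))" for y
    by (simp add: exp_sum[symmetric] sum_distrib_left sum_negf sum_divide_distrib)
  have "(\<integral>\<^sup>+z. ennreal (exp (- u * fnorm2 p r (zfam z) / 2)) \<partial>gz p r) =
     (\<integral>\<^sup>+y. (\<Prod>j<r. ennreal (exp (- u / 2 * dotp p (y j) (y j)))) \<partial>nulls r p)"
    by (subst nn_integral_gz_columns) (measurable, simp only: f e prod_ennreal[OF exp_ge_zero])
  also have "\<dots> = (\<integral>\<^sup>+z. ennreal (exp (- u / 2 * dotp p z z)) \<partial>gauss p) ^ r"
    by (rule nulls_prod) measurable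
  also have "\<dots> = ennreal ((1 / sqrt (1 + u) ^ p) ^ r)"
    using nn_integral_gauss_exp_sq_norm[of "- u / 2" p] u by (simp add: ennreal_power)
  finally show ?thesis .
qed

text \<open>The squared operator norm of A is the operator norm of A^T A, which is at most its
  Frobenius norm; \<open>frob_cross p r r A A\<close> is the square of the latter.\<close>

lemma op_bounded_of_gram:
  assumes F: "frob_cross p r r A A \<le> c\<^sup>2" and c: "0 \<le> c"
  shows "op_bounded p r A c"
proof -
  have "op_bounded r p (\<lambda>i j. A j i) c"
    unfolding op_bounded_def
  proof
    fix g
    define w where "w = (\<lambda>i. \<Sum>j<r. A j i * g j)"
    define C where "C j k = dotp p (A j) (A k)" for j k
    have q: "qform r p (\<lambda>i j. A j i) g = dotp p w w" unfolding w_def by (rule qform_transpose)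
    have Aw: "dotp p (A j) w = dotp r (C j) g" for j
    proof -
      have "dotp p (A j) w = dotp p w (A j)" by (rule dotp_commute)
      also have "\<dots> = (\<Sum>k<r. g k * dotp p (A k) (A j))" unfolding w_def by (rule dotp_lincomb)
      also have "\<dots> = dotp r (C j) g" unfolding C_def dotp_def[of r]
        by (intro sum.cong refl) (simp add: dotp_commute[of p "A j"] mult.commute)
      finally show ?thesis .
    qed
    have "dotp p w w = dotp r g (\<lambda>j. dotp p (A j) w)"
      by (subst (1) w_def, subst dotp_lincomb) (simp add: dotp_def)
    then have w: "(dotp p w w)\<^sup>2 \<le> dotp r g g * qform r r C g"
      using dotp_Cauchy_Schwarz[of r g "\<lambda>j. dotp p (A j) w"] unfolding Aw by (simp add: qform_eq) (simp add: dotp_def)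
    have "qform r r C g \<le> frob_cross p r r A A * dotp r g g"
      using qform_le_frobenius[of r r C g] unfolding frob_cross_def C_def dotp_def[of r] power2_eq_square .
    also have "\<dots> \<le> c\<^sup>2 * dotp r g g" using F by (rule mult_right_mono) simp
    finally have "dotp r g g * qform r r C g \<le> dotp r g g * (c\<^sup>2 * dotp r g g)" by (rule mult_left_mono) simp
    with w have "(dotp p w w)\<^sup>2 \<le> dotp r g g * (c\<^sup>2 * dotp r g g)" by linarith
    also have "\<dots> = (c * dotp r g g)\<^sup>2" by (simp add: power2_eq_square)
    finally have "(dotp p w w)\<^sup>2 \<le> (c * dotp r g g)\<^sup>2" .
    then show "qform r p (\<lambda>i j. A j i) g \<le> c * dotp r g g"
      unfolding q by (rule power2_le_imp_le) (use c in simp)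
  qed
  from op_bounded_transpose[OF this c] show ?thesis by simp
qed

section \<open>Polynomial moments of Gaussian columns, read off from exponential ones\<close>

lemma exp_sum_bounds:
  fixes y :: real
  shows "y\<^sup>2 \<le> 2 * (exp y + exp (- y))" "y ^ 4 \<le> 64 * (exp y + exp (- y))"
proof -
  have a: "exp \<bar>y\<bar> \<le> exp y + exp (- y)" by (cases "0 \<le> y") auto
  have q: "x\<^sup>2 / 2 \<le> exp x" if "0 \<le> x" for x :: real
    using exp_lower_Taylor_quadratic[OF that] that by simp
  show "y\<^sup>2 \<le> 2 * (exp y + exp (- y))" using q[of "\<bar>y\<bar>"] a by simp
  \<comment> \<open>The quadratic bound at half the argument, squared; this gives the constant
    64.\<close>
  have "((\<bar>y\<bar> / 2)\<^sup>2 / 2)\<^sup>2 \<le> (exp (\<bar>y\<bar> / 2))\<^sup>2" by (intro power_mono q) auto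
  also have "\<dots> = exp \<bar>y\<bar>" by (simp add: power2_eq_square flip: exp_add)
  also have "((\<bar>y\<bar> / 2)\<^sup>2 / 2)\<^sup>2 = y ^ 4 / 64" by (simp add: power_divide power_mult[symmetric] flip: power_abs)
  finally show "y ^ 4 \<le> 64 * (exp y + exp (- y))" using a by simp
qed

lemma gauss_exp_sum:
  assumes "dotp p u u = 1"
  shows "(\<integral>\<^sup>+z. ennreal (exp (dotp p u z) + exp (- dotp p u z)) \<partial>gauss p) \<le> 4"
proof -
  note [measurable] = measurable_dotp[OF measurable_ident_sets[OF refl], of p u]
  have m: "(\<lambda>z. dotp p u z) \<in> borel_measurable (gauss p)" by simp
  have "(\<integral>\<^sup>+z. ennreal (exp (dotp p u z) + exp (- dotp p u z)) \<partial>gauss p) =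
     (\<integral>\<^sup>+z. ennreal (exp (dotp p u z)) + ennreal (exp (- dotp p u z)) \<partial>gauss p)"
    by (intro nn_integral_cong) (simp add: ennreal_plus)
  also have "\<dots> = (\<integral>\<^sup>+z. ennreal (exp (dotp p u z)) \<partial>gauss p) + (\<integral>\<^sup>+z. ennreal (exp (- dotp p u z)) \<partial>gauss p)"
    using m by (intro nn_integral_add) measurable
  also have "(\<integral>\<^sup>+z. ennreal (exp (dotp p u z)) \<partial>gauss p) = ennreal (exp (1 / 2))"
    unfolding nn_integral_gauss_exp_linear assms ..
  also have "(\<integral>\<^sup>+z. ennreal (exp (- dotp p u z)) \<partial>gauss p) = ennreal (exp (1 / 2))"
  proof -
    have n: "- dotp p u z = dotp p (\<lambda>i. (- 1) * u i) z" for z unfolding dotp_scale_left by simp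
    have "dotp p (\<lambda>i. (- 1) * u i) (\<lambda>i. (- 1) * u i) = 1" unfolding dotp_scale_left dotp_scale_right using assms by simp
    then show ?thesis unfolding n nn_integral_gauss_exp_linear by simp
  qed
  also have "ennreal (exp (1 / 2)) + ennreal (exp (1 / 2)) = ennreal (exp (1 / 2) + exp (1 / 2))"
    by (rule ennreal_plus[symmetric]) auto
  also have "\<dots> \<le> ennreal 4"
  proof (rule ennreal_leI)
    have "exp (1 / 2 :: real) \<le> 2" using exp_bound[of "1 / 2 :: real"] by (simp add: power2_eq_square)
    then show "exp (1 / 2) + exp (1 / 2 :: real) \<le> 4" by simp
  qed
  finally show ?thesis by simp
qed

text \<open>After normalising u the square is at most 2 (exp + exp), whose mean is at most 2 * 4.
  Only the order of growth matters later, so the constant is left crude.\<close>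

lemma gauss_second_moment: "(\<integral>\<^sup>+z. ennreal ((dotp p u z)\<^sup>2) \<partial>gauss p) \<le> ennreal (8 * dotp p u u)"
proof (cases "dotp p u u = 0")
  case True
  then have "dotp p u z = 0" for z using dotp_Cauchy_Schwarz[of p u z] by simp
  then show ?thesis using True by simp
next
  case False
  then have n: "dotp p u u > 0" using dotp_self_nonneg[of p u] by linarith
  let ?s = "sqrt (dotp p u u)"
  define v where "v i = (1 / ?s) * u i" for i
  have v: "dotp p v v = 1" unfolding v_def dotp_scale_left dotp_scale_right using n by (simp add: field_simps)
  have uz: "(dotp p u z)\<^sup>2 = dotp p u u * (dotp p v z)\<^sup>2" for z
    unfolding v_def dotp_scale_left using n by (simp add: power_divide)
  note [measurable] = measurable_dotp[OF measurable_ident_sets[OF refl], of p v]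
  have m: "(\<lambda>z. dotp p v z) \<in> borel_measurable (gauss p)" by simp
  have "(\<integral>\<^sup>+z. ennreal ((dotp p u z)\<^sup>2) \<partial>gauss p) \<le>
     (\<integral>\<^sup>+z. ennreal (2 * dotp p u u) * ennreal (exp (dotp p v z) + exp (- dotp p v z)) \<partial>gauss p)"
  proof (intro nn_integral_mono)
    fix z
    have "dotp p u u * (dotp p v z)\<^sup>2 \<le> dotp p u u * (2 * (exp (dotp p v z) + exp (- dotp p v z)))"
      by (intro mult_left_mono exp_sum_bounds) simp
    then have "ennreal ((dotp p u z)\<^sup>2) \<le> ennreal (2 * dotp p u u * (exp (dotp p v z) + exp (- dotp p v z)))"
      unfolding uz by (intro ennreal_leI) (simp add: algebra_simps)
    also have "\<dots> = ennreal (2 * dotp p u u) * ennreal (exp (dotp p v z) + exp (- dotp p v z))"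
      by (rule ennreal_mult') simp
    finally show "ennreal ((dotp p u z)\<^sup>2) \<le> ennreal (2 * dotp p u u) * ennreal (exp (dotp p v z) + exp (- dotp p v z))" .
  qed
  also have "\<dots> = ennreal (2 * dotp p u u) * (\<integral>\<^sup>+z. ennreal (exp (dotp p v z) + exp (- dotp p v z)) \<partial>gauss p)"
    using m by (intro nn_integral_cmult) measurable
  also have "\<dots> \<le> ennreal (2 * dotp p u u) * 4" by (intro mult_left_mono gauss_exp_sum v) simp
  also have "\<dots> = ennreal (2 * dotp p u u * 4)" using n by (subst ennreal_mult) auto
  finally show ?thesis by (simp add: mult.commute)
qed

lemma gauss_norm2_moment: "(\<integral>\<^sup>+z. ennreal (dotp p z z) \<partial>gauss p) \<le> ennreal (8 * real p)"
proof -
  note m = measurable_dotp[OF measurable_ident_sets[OF refl], of p]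
  have "(\<integral>\<^sup>+z. ennreal (dotp p z z) \<partial>gauss p) = (\<Sum>j<p. \<integral>\<^sup>+z. ennreal ((dotp p (idf j) z)\<^sup>2) \<partial>gauss p)"
    unfolding qform_idf[symmetric] qform_def using m
    by (subst nn_integral_sum[symmetric]) (auto simp: sum_ennreal)
  also have "\<dots> \<le> (\<Sum>j<p. ennreal (8 * 1))"
  proof (intro sum_mono)
    fix j assume "j \<in> {..<p}"
    then have "dotp p (idf j) (idf j) = 1" by (simp add: dotp_idf) (simp add: idf_def)
    then show "(\<integral>\<^sup>+z. ennreal ((dotp p (idf j) z)\<^sup>2) \<partial>gauss p) \<le> ennreal (8 * 1)"
      using gauss_second_moment[of p "idf j"] by simp
  qed
  also have "\<dots> = ennreal (8 * real p)" by (subst sum_ennreal) (auto simp: mult.commute)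
  finally show ?thesis .
qed

text \<open>Cauchy-Schwarz over the p coordinates reduces to fourth moments of one coordinate; 256 =
  64 * 4.\<close>

lemma gauss_norm4_moment: "(\<integral>\<^sup>+z. ennreal ((dotp p z z)\<^sup>2) \<partial>gauss p) \<le> ennreal (256 * (real p)\<^sup>2)"
proof -
  note m = measurable_dotp[OF measurable_ident_sets[OF refl], of p]
  have le: "(dotp p z z)\<^sup>2 \<le> (\<Sum>j<p. real p * 64 * (exp (dotp p (idf j) z) + exp (- dotp p (idf j) z)))" for z
  proof -
    have "(dotp p z z)\<^sup>2 = (\<Sum>j<p. 1 * (z j)\<^sup>2)\<^sup>2" by (simp add: dotp_def power2_eq_square)
    also have "\<dots> \<le> (\<Sum>j<p. 1\<^sup>2) * (\<Sum>j<p. ((z j)\<^sup>2)\<^sup>2)" by (rule Cauchy_Schwarz_ineq_sum)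
    also have "\<dots> = (\<Sum>j<p. real p * (z j) ^ 4)" by (simp add: sum_distrib_left power_mult[symmetric])
    also have "\<dots> \<le> (\<Sum>j<p. real p * (64 * (exp (dotp p (idf j) z) + exp (- dotp p (idf j) z))))"
    proof (intro sum_mono mult_left_mono)
      fix j assume "j \<in> {..<p}"
      then show "(z j) ^ 4 \<le> 64 * (exp (dotp p (idf j) z) + exp (- dotp p (idf j) z))"
        using exp_sum_bounds(2)[of "z j"] by (simp only: dotp_idf lessThan_iff)
    qed simp
    finally show ?thesis by (simp add: mult.assoc)
  qed
  have "(\<integral>\<^sup>+z. ennreal ((dotp p z z)\<^sup>2) \<partial>gauss p) \<le>
     (\<integral>\<^sup>+z. (\<Sum>j<p. ennreal (real p * 64) * ennreal (exp (dotp p (idf j) z) + exp (- dotp p (idf j) z))) \<partial>gauss p)"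
  proof (intro nn_integral_mono)
    fix z
    have "ennreal ((dotp p z z)\<^sup>2) \<le> ennreal (\<Sum>j<p. real p * 64 * (exp (dotp p (idf j) z) + exp (- dotp p (idf j) z)))"
      by (rule ennreal_leI[OF le])
    also have "\<dots> = (\<Sum>j<p. ennreal (real p * 64 * (exp (dotp p (idf j) z) + exp (- dotp p (idf j) z))))"
      by (rule sum_ennreal[symmetric]) auto
    finally show "ennreal ((dotp p z z)\<^sup>2) \<le> (\<Sum>j<p. ennreal (real p * 64) * ennreal (exp (dotp p (idf j) z) + exp (- dotp p (idf j) z)))"
      by (simp add: ennreal_mult')
  qed
  also have "\<dots> = (\<Sum>j<p. ennreal (real p * 64) * (\<integral>\<^sup>+z. ennreal (exp (dotp p (idf j) z) + exp (- dotp p (idf j) z)) \<partial>gauss p))"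
    using m by (subst nn_integral_sum) (auto intro!: sum.cong nn_integral_cmult)
  also have "\<dots> \<le> (\<Sum>j<p. ennreal (real p * 64) * 4)"
  proof (intro sum_mono mult_left_mono)
    fix j assume "j \<in> {..<p}"
    then have "dotp p (idf j) (idf j) = 1" by (simp add: dotp_idf) (simp add: idf_def)
    then show "(\<integral>\<^sup>+z. ennreal (exp (dotp p (idf j) z) + exp (- dotp p (idf j) z)) \<partial>gauss p) \<le> 4"
      by (rule gauss_exp_sum)
  qed simp
  also have "ennreal (real p * 64) * 4 = ennreal (real p * 256)"
  proof -
    have "ennreal (real p * 64) * 4 = ennreal (real p * 64) * ennreal 4" by simp
    also have "\<dots> = ennreal (real p * 64 * 4)" by (rule ennreal_mult[symmetric]) auto
    finally show ?thesis by simp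
  qed
  also have "(\<Sum>j<p. ennreal (real p * 256)) = ennreal (256 * (real p)\<^sup>2)"
    by (subst sum_ennreal) (auto simp: power2_eq_square)
  finally show ?thesis .
qed

lemma nulls_component:
  assumes "f \<in> borel_measurable (gauss p)" "j \<in> I" "finite I"
  shows "(\<integral>\<^sup>+y. f (y j) \<partial>PiM I (\<lambda>_. gauss p)) = (\<integral>\<^sup>+z. f z \<partial>gauss p)"
proof -
  have d: "distr (PiM I (\<lambda>_. gauss p)) (gauss p) (\<lambda>y. y j) = gauss p"
    by (rule distr_PiM_component) (use assms prob_space_gauss in auto)
  have "(\<integral>\<^sup>+z. f z \<partial>gauss p) = (\<integral>\<^sup>+z. f z \<partial>distr (PiM I (\<lambda>_. gauss p)) (gauss p) (\<lambda>y. y j))" unfolding d ..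
  also have "\<dots> = (\<integral>\<^sup>+y. f (y j) \<partial>PiM I (\<lambda>_. gauss p))"
    using assms by (intro nn_integral_distr) auto
  finally show ?thesis by simp
qed

lemma measurable_dotp_nulls:
  assumes "j \<in> I" "k \<in> I"
  shows "(\<lambda>y. dotp p (y j) (y k)) \<in> borel_measurable (PiM I (\<lambda>_. gauss p))"
  by (intro measurable_dotp_self measurable_component_singleton assms)

text \<open>Column j is integrated out first, conditionally on the others; this leaves 8 |y_k|^2 and
  then 8 * 8 p. Independence is what makes the order p instead of p^2.\<close>

lemma nulls_cross_moment:
  assumes jk: "j < r" "k < r" "j \<noteq> k"
  shows "(\<integral>\<^sup>+y. ennreal ((dotp p (y j) (y k))\<^sup>2) \<partial>nulls r p) \<le> ennreal (64 * real p)"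
proof -
  interpret G: product_sigma_finite "\<lambda>_::nat. gauss p"
    unfolding product_sigma_finite_def using sigma_finite_gauss by auto
  let ?I = "{..<r} - {j}"
  have I: "insert j ?I = {..<r}" using jk by auto
  have m: "(\<lambda>y. ennreal ((dotp p (y j) (y k))\<^sup>2)) \<in> borel_measurable (PiM (insert j ?I) (\<lambda>_. gauss p))"
    unfolding I using measurable_dotp_nulls[of j "{..<r}" k p] jk by simp
  have "(\<integral>\<^sup>+y. ennreal ((dotp p (y j) (y k))\<^sup>2) \<partial>nulls r p) =
     (\<integral>\<^sup>+y. (\<integral>\<^sup>+z. ennreal ((dotp p z (y k))\<^sup>2) \<partial>gauss p) \<partial>PiM ?I (\<lambda>_. gauss p))"
    using G.product_nn_integral_insert[OF _ _ m] jk unfolding I by simp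
  also have "\<dots> \<le> (\<integral>\<^sup>+y. ennreal (8 * dotp p (y k) (y k)) \<partial>PiM ?I (\<lambda>_. gauss p))"
  proof (intro nn_integral_mono)
    fix y :: "nat \<Rightarrow> nat \<Rightarrow> real"
    show "(\<integral>\<^sup>+z. ennreal ((dotp p z (y k))\<^sup>2) \<partial>gauss p) \<le> ennreal (8 * dotp p (y k) (y k))"
    proof -
      have eq: "(\<lambda>z. ennreal ((dotp p z (y k))\<^sup>2)) = (\<lambda>z. ennreal ((dotp p (y k) z)\<^sup>2))"
        by (intro ext) (subst dotp_commute, rule refl)
      show ?thesis unfolding eq by (rule gauss_second_moment)
    qed
  qed
  also have "\<dots> = (\<integral>\<^sup>+z. ennreal (8 * dotp p z z) \<partial>gauss p)"
    using dotp_self_measurable_gauss[of p] jk by (intro nulls_component[of "\<lambda>z. ennreal (8 * dotp p z z)"]) auto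
  also have "\<dots> = ennreal 8 * (\<integral>\<^sup>+z. ennreal (dotp p z z) \<partial>gauss p)"
    using dotp_self_measurable_gauss[of p] by (subst nn_integral_cmult[symmetric]) (auto simp: ennreal_mult')
  also have "\<dots> \<le> ennreal 8 * ennreal (8 * real p)" by (intro mult_left_mono gauss_norm2_moment) simp
  also have "\<dots> = ennreal (64 * real p)" by (subst ennreal_mult[symmetric]) auto
  finally show ?thesis .
qed

text \<open>The r diagonal entries contribute 256 p^2 each. The r^2 terms 64 p are together at most
  64 r p^2 because r \<le> p, and 256 + 64 = 320.\<close>

lemma gz_gram_moment:
  assumes rp: "r \<le> p"
  shows "(\<integral>\<^sup>+z. ennreal (frob_cross p r r (zfam z) (zfam z)) \<partial>gz p r) \<le> ennreal (320 * real r * (real p)\<^sup>2)"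
proof -
  have mz: "(\<lambda>z. frob_cross p r r (zfam z) (zfam z)) \<in> borel_measurable (gz p r)"
    unfolding frob_cross_def dotp_def using measurable_zfam[of _ p _ r]
    by (intro borel_measurable_sum borel_measurable_power borel_measurable_times) auto
  have f: "frob_cross p r r (zfam (\<lambda>ij\<in>{..<p} \<times> {..<r}. y (snd ij) (fst ij))) (zfam (\<lambda>ij\<in>{..<p} \<times> {..<r}. y (snd ij) (fst ij)))
     = (\<Sum>j<r. \<Sum>k<r. (dotp p (y j) (y k))\<^sup>2)" for y
    unfolding frob_cross_def
    by (intro sum.cong refl arg_cong[where f = "\<lambda>x. x\<^sup>2"] dotp_cong) (auto simp: zfam_columns)
  have "(\<integral>\<^sup>+z. ennreal (frob_cross p r r (zfam z) (zfam z)) \<partial>gz p r) =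
    (\<integral>\<^sup>+y. (\<Sum>j<r. \<Sum>k<r. ennreal ((dotp p (y j) (y k))\<^sup>2)) \<partial>nulls r p)"
    by (subst nn_integral_gz_columns) (use mz in \<open>simp_all add: f sum_ennreal sum_nonneg\<close>)
  also have "\<dots> = (\<Sum>j<r. \<Sum>k<r. \<integral>\<^sup>+y. ennreal ((dotp p (y j) (y k))\<^sup>2) \<partial>nulls r p)"
  proof -
    have m: "(\<lambda>y. ennreal ((dotp p (y j) (y k))\<^sup>2)) \<in> borel_measurable (nulls r p)" if "j \<in> {..<r}" "k \<in> {..<r}" for j k
      using measurable_dotp_nulls[OF that, of p] by simp
    show ?thesis
      by (subst nn_integral_sum, use m in \<open>auto intro!: borel_measurable_sum simp del: sum_ennreal\<close>)
         (intro sum.cong refl nn_integral_sum, use m in auto)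
  qed
  also have "\<dots> \<le> (\<Sum>j<r. \<Sum>k<r. ennreal (64 * real p + (if j = k then 256 * (real p)\<^sup>2 else 0)))"
  proof (intro sum_mono)
    fix j k assume jk: "j \<in> {..<r}" "k \<in> {..<r}"
    show "(\<integral>\<^sup>+y. ennreal ((dotp p (y j) (y k))\<^sup>2) \<partial>nulls r p) \<le> ennreal (64 * real p + (if j = k then 256 * (real p)\<^sup>2 else 0))"
    proof (cases "j = k")
      case True
      have "(\<integral>\<^sup>+y. ennreal ((dotp p (y k) (y k))\<^sup>2) \<partial>nulls r p) = (\<integral>\<^sup>+z. ennreal ((dotp p z z)\<^sup>2) \<partial>gauss p)"
        using dotp_self_measurable_gauss[of p] jk by (intro nulls_component[of "\<lambda>z. ennreal ((dotp p z z)\<^sup>2)"]) auto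
      also have "\<dots> \<le> ennreal (256 * (real p)\<^sup>2)" by (rule gauss_norm4_moment)
      also have "\<dots> \<le> ennreal (64 * real p + 256 * (real p)\<^sup>2)" by (rule ennreal_leI) simp
      finally show ?thesis using True by simp
    next
      case False
      then show ?thesis using nulls_cross_moment[of j r k p] jk by simp
    qed
  qed
  also have "\<dots> = ennreal (\<Sum>j<r. \<Sum>k<r. 64 * real p + (if j = k then 256 * (real p)\<^sup>2 else 0))"
    by (simp add: sum_ennreal sum_nonneg del: ennreal_plus)
  also have "(\<Sum>j<r. \<Sum>k<r. 64 * real p + (if j = k then 256 * (real p)\<^sup>2 else 0)) = real r * (real r * (64 * real p)) + real r * (256 * (real p)\<^sup>2)"
    by (simp add: sum.distrib distrib_left)
  also have "ennreal \<dots> \<le> ennreal (320 * real r * (real p)\<^sup>2)"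
  proof (rule ennreal_leI)
    have "real r * (64 * real p) \<le> real p * (64 * real p)" using rp by (intro mult_right_mono) auto
    then have "real r * (real r * (64 * real p)) \<le> real r * (real p * (64 * real p))" by (intro mult_left_mono) auto
    then show "real r * (real r * (64 * real p)) + real r * (256 * (real p)\<^sup>2) \<le> 320 * real r * (real p)\<^sup>2"
      by (simp add: power2_eq_square algebra_simps)
  qed
  finally show ?thesis .
qed

text \<open>The Gram matrix is controlled in Frobenius norm, which bounds the operator norm of \<open>Z\<close>.\<close>

definition good_set :: "nat \<Rightarrow> nat \<Rightarrow> real \<Rightarrow> (nat \<times> nat \<Rightarrow> real) set" where
  "good_set p r c = {z \<in> space (gz p r). frob_cross p r r (zfam z) (zfam z) \<le> c\<^sup>2}"

lemma good_set_sets [measurable]: "good_set p r c \<in> sets (gz p r)"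
proof -
  have [measurable]: "(\<lambda>z. frob_cross p r r (zfam z) (zfam z)) \<in> borel_measurable (gz p r)"
    unfolding frob_cross_def dotp_def using measurable_zfam[of _ p _ r]
    by (intro borel_measurable_sum borel_measurable_power borel_measurable_times) auto
  show ?thesis unfolding good_set_def by measurable
qed

text \<open>Markov's inequality for the squared Frobenius norm of the Gram matrix.\<close>

lemma bad_set_measure:
  assumes rp: "r \<le> p" and c: "c > 0"
  shows "emeasure (gz p r) (space (gz p r) - good_set p r c) \<le> ennreal (320 * real r * (real p)\<^sup>2 / c\<^sup>2)"
proof -
  have [measurable]: "(\<lambda>z. frob_cross p r r (zfam z) (zfam z)) \<in> borel_measurable (gz p r)"
    unfolding frob_cross_def dotp_def using measurable_zfam[of _ p _ r]
    by (intro borel_measurable_sum borel_measurable_power borel_measurable_times) auto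
  have b: "space (gz p r) - good_set p r c \<in> sets (gz p r)" by auto
  have "emeasure (gz p r) (space (gz p r) - good_set p r c) = (\<integral>\<^sup>+z. indicator (space (gz p r) - good_set p r c) z \<partial>gz p r)"
    using b by simp
  also have "\<dots> \<le> (\<integral>\<^sup>+z. ennreal (1 / c\<^sup>2) * ennreal (frob_cross p r r (zfam z) (zfam z)) \<partial>gz p r)"
  proof (intro nn_integral_mono)
    fix z assume z: "z \<in> space (gz p r)"
    show "indicator (space (gz p r) - good_set p r c) z \<le> ennreal (1 / c\<^sup>2) * ennreal (frob_cross p r r (zfam z) (zfam z))"
    proof (cases "z \<in> good_set p r c")
      case False
      then have "c\<^sup>2 \<le> frob_cross p r r (zfam z) (zfam z)" using z by (auto simp: good_set_def)
      then have "1 \<le> 1 / c\<^sup>2 * frob_cross p r r (zfam z) (zfam z)" using c by (simp add: field_simps)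
      then have "ennreal 1 \<le> ennreal (1 / c\<^sup>2 * frob_cross p r r (zfam z) (zfam z))" by (rule ennreal_leI)
      then show ?thesis using z False by (simp only: ennreal_mult' zero_le_divide_1_iff zero_le_power2) simp
    qed simp
  qed
  also have "\<dots> = ennreal (1 / c\<^sup>2) * (\<integral>\<^sup>+z. ennreal (frob_cross p r r (zfam z) (zfam z)) \<partial>gz p r)"
    by (rule nn_integral_cmult) measurable
  also have "\<dots> \<le> ennreal (1 / c\<^sup>2) * ennreal (320 * real r * (real p)\<^sup>2)"
    by (intro mult_left_mono gz_gram_moment rp) simp
  also have "\<dots> = ennreal (320 * real r * (real p)\<^sup>2 / c\<^sup>2)" by (simp add: ennreal_mult'[symmetric])
  finally show ?thesis .
qed

section \<open>Uniform frames\<close>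

definition qf :: "real mat \<Rightarrow> nat \<Rightarrow> nat \<Rightarrow> real" where
  "qf Q j i = Q $$ (i, j)"

lemma mat_mult_entry:
  assumes "A \<in> carrier_mat p n" "B \<in> carrier_mat n r" "i < p" "j < r"
  shows "(A * B) $$ (i, j) = (\<Sum>l<n. A $$ (i, l) * B $$ (l, j))"
  using assms by (simp add: scalar_prod_def lessThan_atLeast0)

lemma stiefel_iff:
  "Q \<in> stiefel p r \<longleftrightarrow> Q \<in> carrier_mat p r \<and> (\<forall>j<r. \<forall>j'<r. dotp p (qf Q j) (qf Q j') = (if j = j' then 1 else 0))"
proof (cases "Q \<in> carrier_mat p r")
  case True
  let ?G = "transpose_mat Q * Q"
  have G: "?G \<in> carrier_mat r r" using True by simp
  have e: "?G $$ (j, j') = dotp p (qf Q j) (qf Q j')" if "j < r" "j' < r" for j j'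
    using that True by (simp add: scalar_prod_def lessThan_atLeast0 dotp_def qf_def)
  have "?G = 1\<^sub>m r \<longleftrightarrow> (\<forall>j<r. \<forall>j'<r. ?G $$ (j, j') = (if j = j' then 1 else 0))"
  proof
    assume R: "\<forall>j<r. \<forall>j'<r. ?G $$ (j, j') = (if j = j' then 1 else 0)"
    show "?G = 1\<^sub>m r" by (rule eq_matI) (use R G in auto)
  qed simp
  then show ?thesis using True e by (simp add: stiefel_def)
qed (simp add: stiefel_def)

lemma stiefel_orth_rows:
  assumes "V \<in> stiefel p p" "i < p" "i' < p"
  shows "(\<Sum>l<p. V $$ (i, l) * V $$ (i', l)) = (if i = i' then 1 else 0)"
proof -
  have V: "V \<in> carrier_mat p p" "transpose_mat V * V = 1\<^sub>m p" using assms(1) by (auto simp: stiefel_def)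
  have "V * transpose_mat V = 1\<^sub>m p"
    by (rule mat_mult_left_right_inverse[OF _ V(1) V(2)]) (use V in auto)
  then have "(V * transpose_mat V) $$ (i, i') = (1\<^sub>m p :: real mat) $$ (i, i')" by simp
  then show ?thesis using V assms by (simp add: scalar_prod_def lessThan_atLeast0)
qed

lemma dotp_orth_mult:
  assumes V: "V \<in> stiefel p p" and A: "A \<in> carrier_mat p r" and B: "B \<in> carrier_mat p r'" and j: "j < r" "j' < r'"
  shows "dotp p (qf (V * A) j) (qf (V * B) j') = dotp p (qf A j) (qf B j')"
proof -
  have Vc: "V \<in> carrier_mat p p" using V by (auto simp: stiefel_def)
  have "dotp p (qf (V * A) j) (qf (V * B) j') = (\<Sum>i<p. (\<Sum>l<p. V $$ (i, l) * A $$ (l, j)) * (\<Sum>l'<p. V $$ (i, l') * B $$ (l', j')))"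
    unfolding dotp_def qf_def using mat_mult_entry[OF Vc A _ j(1)] mat_mult_entry[OF Vc B _ j(2)]
    by (intro sum.cong refl) simp
  also have "\<dots> = (\<Sum>i<p. \<Sum>l<p. \<Sum>l'<p. A $$ (l, j) * B $$ (l', j') * (V $$ (i, l) * V $$ (i, l')))"
    by (simp add: sum_product mult_ac)
  also have "\<dots> = (\<Sum>l<p. \<Sum>i<p. \<Sum>l'<p. A $$ (l, j) * B $$ (l', j') * (V $$ (i, l) * V $$ (i, l')))"
    by (rule sum.swap)
  also have "\<dots> = (\<Sum>l<p. \<Sum>l'<p. \<Sum>i<p. A $$ (l, j) * B $$ (l', j') * (V $$ (i, l) * V $$ (i, l')))"
    by (rule sum.cong[OF refl], rule sum.swap)
  also have "\<dots> = (\<Sum>l<p. \<Sum>l'<p. A $$ (l, j) * B $$ (l', j') * dotp p (qf V l) (qf V l'))"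
    by (simp add: dotp_def qf_def sum_distrib_left)
  also have "\<dots> = (\<Sum>l<p. \<Sum>l'<p. if l = l' then A $$ (l, j) * B $$ (l', j') else 0)"
    using V unfolding stiefel_iff by (intro sum.cong refl) simp
  also have "\<dots> = dotp p (qf A j) (qf B j')" by (simp add: dotp_def qf_def)
  finally show ?thesis .
qed

lemma stiefel_mult:
  assumes "V \<in> stiefel p p" "Q \<in> stiefel p r"
  shows "V * Q \<in> stiefel p r"
proof -
  have c: "V \<in> carrier_mat p p" "Q \<in> carrier_mat p r" using assms by (auto simp: stiefel_def)
  show ?thesis
    unfolding stiefel_iff
  proof (intro conjI allI impI)
    fix j j' assume "j < r" "j' < r"
    then show "dotp p (qf (V * Q) j) (qf (V * Q) j') = (if j = j' then 1 else 0)"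
      using dotp_orth_mult[OF assms(1) c(2) c(2)] assms(2) unfolding stiefel_iff by simp
  qed (use c in auto)
qed

lemma frob_cross_orth_mult:
  assumes "V \<in> stiefel p p" "A \<in> carrier_mat p r" "B \<in> carrier_mat p r'"
  shows "frob_cross p r r' (qf (V * A)) (qf (V * B)) = frob_cross p r r' (qf A) (qf B)"
  unfolding frob_cross_def using dotp_orth_mult[OF assms] by (intro sum.cong refl) simp

section \<open>Triangular form by reflections\<close>

definition householder :: "nat \<Rightarrow> (nat \<Rightarrow> real) \<Rightarrow> real mat" where
  "householder p u = Matrix.mat p p (\<lambda>(i, j). (if i = j then 1 else 0) - 2 / dotp p u u * (u i * u j))"

lemma householder_stiefel:
  assumes "dotp p u u \<noteq> 0"
  shows "householder p u \<in> stiefel p p"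
  unfolding stiefel_iff
proof (intro conjI allI impI)
  fix j j' assume j: "j < p" "j' < p"
  let ?n = "dotp p u u"
  have "dotp p (qf (householder p u) j) (qf (householder p u) j') =
    (\<Sum>i<p. ((if i = j then 1 else 0) - 2 / ?n * (u i * u j)) * ((if i = j' then 1 else 0) - 2 / ?n * (u i * u j')))"
    using j by (simp add: dotp_def[of p "qf _ _"] qf_def householder_def)
  also have "\<dots> = (\<Sum>i<p. (if i = j then (if i = j' then 1 else 0) - 2 / ?n * (u i * u j') else 0)
      - (if i = j' then 2 / ?n * (u i * u j) else 0) + 4 / ?n\<^sup>2 * u j * u j' * (u i * u i))"
    by (intro sum.cong refl) (auto simp: algebra_simps power2_eq_square)
  also have "\<dots> = (if j = j' then 1 else 0) - 2 / ?n * (u j * u j') - 2 / ?n * (u j' * u j) + 4 / ?n\<^sup>2 * u j * u j' * ?n"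
    using j by (simp add: sum.distrib sum_subtractf dotp_def[of p u u] sum_distrib_left)
  also have "\<dots> = (if j = j' then 1 else 0)" using assms by (simp add: power2_eq_square field_simps)
  finally show "dotp p (qf (householder p u) j) (qf (householder p u) j') = (if j = j' then 1 else 0)" .
qed (simp add: householder_def)

lemma one_mat_stiefel: "1\<^sub>m p \<in> stiefel p p"
  by (simp add: stiefel_def)

text \<open>The QR decomposition, one reflection per column. Only the vanishing below the diagonal
  is recorded.\<close>

lemma exists_orth_triangular:
  assumes Z: "Z \<in> carrier_mat p r" and k: "k \<le> r" "k \<le> p"
  shows "\<exists>V\<in>stiefel p p. \<forall>j<k. \<forall>i. j < i \<and> i < p \<longrightarrow> (V * Z) $$ (i, j) = 0"
  using k
proof (induction k)
  case 0
  then show ?case using one_mat_stiefel by auto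
next
  case (Suc k)
  then obtain V where V: "V \<in> stiefel p p" "\<And>i j. j < k \<Longrightarrow> j < i \<Longrightarrow> i < p \<Longrightarrow> (V * Z) $$ (i, j) = 0" by auto
  have k: "k < r" "k < p" using Suc.prems by auto
  have VZ: "V * Z \<in> carrier_mat p r" using V(1) Z by (auto simp: stiefel_def)
  define w where "w i = (V * Z) $$ (i, k)" for i
  \<comment> \<open>The part of column k from row k downwards, of norm s. Reflecting along u = t - s
    e_k sends it to s e_k. Since u vanishes in the first k rows it is orthogonal to the earlier
    columns, which stay unchanged.\<close>
  define t where "t i = (if i < k then 0 else w i)" for i
  define s where "s = sqrt (dotp p t t)"
  define u where "u i = t i - (if i = k then s else 0)" for i
  have s2: "s\<^sup>2 = dotp p t t" by (simp add: s_def)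
  have d: "dotp p v u = dotp p v t - s * v k" for v
  proof -
    have "dotp p v u = (\<Sum>i<p. v i * t i - (if i = k then s * v k else 0))"
      unfolding dotp_def u_def by (intro sum.cong refl) (simp add: algebra_simps)
    also have "\<dots> = dotp p v t - s * v k" using k by (simp add: sum_subtractf dotp_def)
    finally show ?thesis .
  qed
  have ut: "dotp p u t = s\<^sup>2 - s * t k" using d[of t] s2 by (simp add: dotp_commute[of p u t])
  have uu: "dotp p u u = 2 * (s\<^sup>2 - s * t k)"
    using d[of u] ut by (simp add: u_def power2_eq_square algebra_simps)
  show ?case
  proof (cases "dotp p u u = 0")
    \<comment> \<open>If u = 0 the tail is already a multiple of e_k, so the old V works.\<close>
    case True
    then have u0: "u i = 0" if "i < p" for i using dotp_self_eq_0 that by blast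
    have "(V * Z) $$ (i, j) = 0" if "j < Suc k" "j < i" "i < p" for i j
    proof (cases "j = k")
      case True
      then show ?thesis using u0[OF that(3)] that by (simp add: u_def t_def w_def)
    next
      case False
      then show ?thesis using V(2) that by simp
    qed
    then show ?thesis using V(1) by blast
  next
    case False
    let ?H = "householder p u"
    have Hs: "?H \<in> stiefel p p" by (rule householder_stiefel[OF False])
    then have Hc: "?H \<in> carrier_mat p p" by (simp add: stiefel_def)
    have ent: "(?H * (V * Z)) $$ (i, j) = (V * Z) $$ (i, j) - 2 / dotp p u u * dotp p u (\<lambda>l. (V * Z) $$ (l, j)) * u i"
      if "i < p" "j < r" for i j
    proof -
      have "(?H * (V * Z)) $$ (i, j) = (\<Sum>l<p. ((if i = l then 1 else 0) - 2 / dotp p u u * (u i * u l)) * (V * Z) $$ (l, j))"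
        using that by (subst mat_mult_entry[OF Hc VZ that]) (simp add: householder_def)
      also have "\<dots> = (\<Sum>l<p. (if i = l then (V * Z) $$ (l, j) else 0) - 2 / dotp p u u * u i * (u l * (V * Z) $$ (l, j)))"
        by (intro sum.cong refl) (simp add: algebra_simps)
      also have "\<dots> = (V * Z) $$ (i, j) - 2 / dotp p u u * u i * dotp p u (\<lambda>l. (V * Z) $$ (l, j))"
        using that by (simp only: sum_subtractf sum_distrib_left[symmetric] dotp_def[of p u "\<lambda>l. (V * Z) $$ (l, j)"]) simp
      finally show ?thesis by (simp add: mult_ac)
    qed
    have "(?H * V * Z) $$ (i, j) = 0" if ij: "j < Suc k" "j < i" "i < p" for i j
    proof -
      have jr: "j < r" using ij k by simp
      have as: "?H * V * Z = ?H * (V * Z)" using Hc V(1) Z by (intro assoc_mult_mat[of _ p p _ p _ r]) (auto simp: stiefel_def)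
      show ?thesis
      proof (cases "j = k")
        case True
        have "dotp p u (\<lambda>l. (V * Z) $$ (l, k)) = dotp p u t"
          unfolding dotp_def by (intro sum.cong refl) (auto simp: u_def t_def w_def)
        then have "2 / dotp p u u * dotp p u (\<lambda>l. (V * Z) $$ (l, k)) = 1"
          using False unfolding ut uu by simp
        then show ?thesis unfolding as using ent[OF ij(3) jr] ij True by (simp add: u_def t_def w_def)
      next
        case jk: False
        have "dotp p u (\<lambda>l. (V * Z) $$ (l, j)) = (\<Sum>l<p. 0)"
          unfolding dotp_def
        proof (intro sum.cong refl)
          fix l assume "l \<in> {..<p}"
          then show "u l * (V * Z) $$ (l, j) = 0" using V(2)[of j l] jk ij by (cases "l < k") (auto simp: u_def t_def)
        qed
        then show ?thesis unfolding as using ent[OF ij(3) jr] V(2)[of j i] jk ij by simp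
      qed
    qed
    moreover have "?H * V \<in> stiefel p p" by (rule stiefel_mult[OF Hs V(1)])
    ultimately show ?thesis by blast
  qed
qed

text \<open>The entries of Q Q^T. In these terms the cross statistic is the trace of A A^T B B^T,
  which is linear in B B^T; Jensen's inequality relies on this form.\<close>

definition rowdot :: "nat \<Rightarrow> real mat \<Rightarrow> nat \<Rightarrow> nat \<Rightarrow> real" where
  "rowdot r Q i i' = (\<Sum>j<r. Q $$ (i, j) * Q $$ (i', j))"

lemma frob_cross_rowdot:
  "frob_cross p r r' (qf A) (qf B) = (\<Sum>i<p. \<Sum>i'<p. rowdot r A i i' * rowdot r' B i i')"
proof -
  have "frob_cross p r r' (qf A) (qf B) = (\<Sum>j<r. \<Sum>j'<r'. \<Sum>i<p. \<Sum>i'<p. (A $$ (i, j) * A $$ (i', j)) * (B $$ (i, j') * B $$ (i', j')))"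
    by (simp add: frob_cross_def dotp_def qf_def power2_eq_square sum_product mult_ac)
  also have "\<dots> = (\<Sum>j<r. \<Sum>i<p. \<Sum>j'<r'. \<Sum>i'<p. (A $$ (i, j) * A $$ (i', j)) * (B $$ (i, j') * B $$ (i', j')))"
    by (rule sum.cong[OF refl], rule sum.swap)
  also have "\<dots> = (\<Sum>i<p. \<Sum>j<r. \<Sum>j'<r'. \<Sum>i'<p. (A $$ (i, j) * A $$ (i', j)) * (B $$ (i, j') * B $$ (i', j')))"
    by (rule sum.swap)
  also have "\<dots> = (\<Sum>i<p. \<Sum>j<r. \<Sum>i'<p. \<Sum>j'<r'. (A $$ (i, j) * A $$ (i', j)) * (B $$ (i, j') * B $$ (i', j')))"
    by (rule sum.cong[OF refl], rule sum.cong[OF refl], rule sum.swap)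
  also have "\<dots> = (\<Sum>i<p. \<Sum>i'<p. \<Sum>j<r. \<Sum>j'<r'. (A $$ (i, j) * A $$ (i', j)) * (B $$ (i, j') * B $$ (i', j')))"
    by (rule sum.cong[OF refl], rule sum.swap)
  finally show ?thesis by (simp add: rowdot_def sum_product)
qed

lemma fnorm2_rowdot: "fnorm2 p r (qf A) = (\<Sum>i<p. rowdot r A i i)"
  unfolding fnorm2_def dotp_def qf_def rowdot_def by (rule sum.swap)

lemma fnorm2_orth_mult:
  assumes "V \<in> stiefel p p" "A \<in> carrier_mat p r"
  shows "fnorm2 p r (qf (V * A)) = fnorm2 p r (qf A)"
  unfolding fnorm2_def using dotp_orth_mult[OF assms(1) assms(2) assms(2)] by (intro sum.cong refl) simp

lemma fnorm2_stiefel: "Q \<in> stiefel p r \<Longrightarrow> fnorm2 p r (qf Q) = real r"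
  unfolding fnorm2_def by (simp add: stiefel_iff)

lemma rowdot_self_nonneg [simp]: "rowdot r Q i i \<ge> 0"
  unfolding rowdot_def by (intro sum_nonneg) simp

lemma rowdot_self_le:
  assumes "Q \<in> stiefel p r" "i < p"
  shows "rowdot r Q i i \<le> real r"
proof -
  have "rowdot r Q i i \<le> (\<Sum>i<p. rowdot r Q i i)" using assms(2) by (intro member_le_sum) auto
  then show ?thesis using fnorm2_stiefel[OF assms(1)] unfolding fnorm2_rowdot by simp
qed

lemma abs_rowdot_le:
  assumes "Q \<in> stiefel p r" "i < p" "i' < p"
  shows "\<bar>rowdot r Q i i'\<bar> \<le> real r"
proof -
  have "(rowdot r Q i i')\<^sup>2 \<le> rowdot r Q i i * rowdot r Q i' i'"
    using Cauchy_Schwarz_ineq_sum[of "\<lambda>j. Q $$ (i, j)" "\<lambda>j. Q $$ (i', j)" "{..<r}"]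
    by (simp add: rowdot_def power2_eq_square)
  also have "\<dots> \<le> real r * real r" using rowdot_self_le[OF assms(1)] assms(2,3) by (intro mult_mono) auto
  finally have "(rowdot r Q i i')\<^sup>2 \<le> (real r)\<^sup>2" by (simp add: power2_eq_square)
  then show ?thesis by (simp add: abs_le_square_iff[symmetric])
qed

definition signed_perm :: "nat \<Rightarrow> (nat \<Rightarrow> nat) \<Rightarrow> (nat \<Rightarrow> real) \<Rightarrow> real mat" where
  "signed_perm p \<sigma> e = Matrix.mat p p (\<lambda>(i, j). if j = \<sigma> i then e i else 0)"

lemma signed_perm_mult_entry:
  assumes s: "\<sigma> permutes {..<p}" and Q: "Q \<in> carrier_mat p r" and i: "i < p" "j < r"
  shows "(signed_perm p \<sigma> e * Q) $$ (i, j) = e i * Q $$ (\<sigma> i, j)"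
proof -
  have si: "\<sigma> i < p" using permutes_in_image[OF s, of i] i by simp
  have "(signed_perm p \<sigma> e * Q) $$ (i, j) = (\<Sum>l<p. (if l = \<sigma> i then e i else 0) * Q $$ (l, j))"
    by (subst mat_mult_entry[OF _ Q i]) (use i in \<open>simp_all add: signed_perm_def\<close>)
  also have "\<dots> = (\<Sum>l<p. if l = \<sigma> i then e i * Q $$ (l, j) else 0)" by (intro sum.cong refl) simp
  also have "\<dots> = e i * Q $$ (\<sigma> i, j)" using si by simp
  finally show ?thesis .
qed

lemma signed_perm_stiefel:
  assumes s: "\<sigma> permutes {..<p}" and e: "\<And>i. e i * e i = 1"
  shows "signed_perm p \<sigma> e \<in> stiefel p p"
  unfolding stiefel_iff
proof (intro conjI allI impI)
  fix j j' assume j: "j < p" "j' < p"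
  have "dotp p (qf (signed_perm p \<sigma> e) j) (qf (signed_perm p \<sigma> e) j') = (\<Sum>i<p. if j = \<sigma> i then (if j = j' then 1 else 0) else 0)"
    unfolding dotp_def qf_def signed_perm_def using j e by (intro sum.cong refl) auto
  also have "\<dots> = (\<Sum>i<p. if i = j then (if j = j' then 1 else 0) else 0)"
    using sum.permute[OF s, of "\<lambda>i. if i = j then (if j = j' then 1 else 0) else (0::real)"]
    by (simp add: comp_def eq_commute[of j])
  also have "\<dots> = (if j = j' then 1 else 0)" using j by simp
  finally show "dotp p (qf (signed_perm p \<sigma> e) j) (qf (signed_perm p \<sigma> e) j') = (if j = j' then 1 else 0)" .
qed (simp add: signed_perm_def)

lemma rowdot_signed_perm:
  assumes s: "\<sigma> permutes {..<p}" and Q: "Q \<in> carrier_mat p r" and i: "i < p" "i' < p"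
  shows "rowdot r (signed_perm p \<sigma> e * Q) i i' = e i * e i' * rowdot r Q (\<sigma> i) (\<sigma> i')"
  unfolding rowdot_def sum_distrib_left using signed_perm_mult_entry[OF s Q] i
  by (intro sum.cong refl) simp

section \<open>Symmetries of the uniform law and the moment of two frames\<close>

locale uniform_stiefel =
  fixes p r :: nat and U :: "real mat measure"
  assumes U: "uniform_on_stiefel p r U" and rp: "r \<le> p"
begin

lemma prob_U: "prob_space U" and space_U: "space U = stiefel p r"
  and sets_U: "sets U = sets (restrict_space (mat_borel p r) (stiefel p r))"
  and inv_U: "V \<in> stiefel p p \<Longrightarrow> distr U U (\<lambda>Q. V * Q) = U"
  using U by (auto simp: uniform_on_stiefel_def)

sublocale U: prob_space U by (rule prob_U)

lemma measurable_entry: "i < p \<Longrightarrow> j < r \<Longrightarrow> (\<lambda>Q. Q $$ (i, j)) \<in> borel_measurable U"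
  using measurable_restrict_space1[OF measurable_mat_entry, of i p j r "stiefel p r"]
  by (subst measurable_cong_sets[OF sets_U refl])

lemma measurable_qf: "i < p \<Longrightarrow> j < r \<Longrightarrow> (\<lambda>Q. qf Q j i) \<in> borel_measurable U"
  unfolding qf_def by (rule measurable_entry)

lemma measurable_rowdot: "i < p \<Longrightarrow> i' < p \<Longrightarrow> (\<lambda>Q. rowdot r Q i i') \<in> borel_measurable U"
  unfolding rowdot_def by (intro borel_measurable_sum borel_measurable_times measurable_entry) auto

lemma measurable_orth:
  assumes V: "V \<in> stiefel p p"
  shows "(\<lambda>Q. V * Q) \<in> U \<rightarrow>\<^sub>M U"
proof -
  have Vc: "V \<in> carrier_mat p p" using V by (simp add: stiefel_def)
  have "(\<lambda>Q. V * Q) \<in> U \<rightarrow>\<^sub>M mat_borel p r"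
  proof (rule measurable_into_mat_borel)
    fix i j assume ij: "i < p" "j < r"
    have "(\<lambda>Q. \<Sum>l<p. V $$ (i, l) * Q $$ (l, j)) \<in> borel_measurable U"
      using measurable_entry ij by (intro borel_measurable_sum borel_measurable_times) auto
    then show "(\<lambda>Q. (V * Q) $$ (i, j)) \<in> borel_measurable U"
      by (rule iffD2[OF measurable_cong, rotated])
         (rule mat_mult_entry[OF Vc _ ij], simp add: space_U stiefel_def)
  next
    fix Q assume "Q \<in> space U"
    then show "V * Q \<in> carrier_mat p r" using Vc by (auto simp: space_U stiefel_def)
  qed
  then have "(\<lambda>Q. V * Q) \<in> U \<rightarrow>\<^sub>M restrict_space (mat_borel p r) (stiefel p r)"
    by (intro measurable_restrict_space2) (auto simp: space_U intro: stiefel_mult[OF V])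
  then show ?thesis by (subst measurable_cong_sets[OF refl sets_U])
qed

lemma integral_orth:
  fixes f :: "real mat \<Rightarrow> real"
  assumes V: "V \<in> stiefel p p" and f: "f \<in> borel_measurable U"
  shows "(\<integral>Q. f (V * Q) \<partial>U) = (\<integral>Q. f Q \<partial>U)"
  using integral_distr[OF measurable_orth[OF V] f] unfolding inv_U[OF V] by simp

lemma nn_integral_orth:
  assumes V: "V \<in> stiefel p p" and f: "f \<in> borel_measurable U"
  shows "(\<integral>\<^sup>+Q. f (V * Q) \<partial>U) = (\<integral>\<^sup>+Q. f Q \<partial>U)"
  using nn_integral_distr[OF measurable_orth[OF V], of f] f unfolding inv_U[OF V] by simp

text \<open>The squared Frobenius norm of the top r by r block, or equivalently the cross statistic
  of Q with the frame of the first r coordinate vectors.\<close>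

definition tops :: "real mat \<Rightarrow> real" where
  "tops Q = (\<Sum>i<r. rowdot r Q i i)"

lemma tops_nonneg [simp]: "tops Q \<ge> 0"
  unfolding tops_def by (intro sum_nonneg) simp

lemma tops_le: "Q \<in> stiefel p r \<Longrightarrow> tops Q \<le> real r"
  using fnorm2_stiefel[of Q p r] rp unfolding fnorm2_rowdot tops_def
  by (metis sum_mono2[of "{..<p}" "{..<r}" "\<lambda>i. rowdot r Q i i"] finite_lessThan lessThan_subset_iff rowdot_self_nonneg)

lemma measurable_tops: "tops \<in> borel_measurable U"
  unfolding tops_def using rp by (intro borel_measurable_sum measurable_rowdot) auto

lemma integrable_weighted:
  assumes "i < p" "i' < p"
  shows "integrable U (\<lambda>Q. exp (b * tops Q) * rowdot r Q i i')"
proof (rule U.integrable_const_bound[where B = "exp (\<bar>b\<bar> * real r) * real r"])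
  show "AE Q in U. norm (exp (b * tops Q) * rowdot r Q i i') \<le> exp (\<bar>b\<bar> * real r) * real r"
  proof (rule AE_I2)
    fix Q assume "Q \<in> space U"
    then have Q: "Q \<in> stiefel p r" by (simp add: space_U)
    have "b * tops Q \<le> \<bar>b\<bar> * real r"
      using tops_le[OF Q] by (intro order_trans[OF mult_right_mono[OF abs_ge_self] mult_left_mono]) auto
    then show "norm (exp (b * tops Q) * rowdot r Q i i') \<le> exp (\<bar>b\<bar> * real r) * real r"
      using abs_rowdot_le[OF Q assms] by (auto simp: abs_mult intro!: mult_mono)
  qed
  note [measurable] = measurable_tops measurable_rowdot[OF assms]
  show "(\<lambda>Q. exp (b * tops Q) * rowdot r Q i i') \<in> borel_measurable U" by measurable
qed

lemma measurable_weighted: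
  assumes "i < p" "i' < p"
  shows "(\<lambda>Q. exp (b * tops Q) * rowdot r Q i i') \<in> borel_measurable U"
  by (rule borel_measurable_integrable[OF integrable_weighted[OF assms]])

text \<open>Flipping the sign of row i preserves the law and \<open>tops\<close> but negates the
  entry (i, i') of Q Q^T.\<close>

lemma weighted_offdiag:
  assumes i: "i < p" "i' < p" "i \<noteq> i'"
  shows "(\<integral>Q. exp (b * tops Q) * rowdot r Q i i' \<partial>U) = 0"
proof -
  define e where "e l = (if l = i then - 1 else 1 :: real)" for l
  let ?V = "signed_perm p id e"
  have V: "?V \<in> stiefel p p" by (rule signed_perm_stiefel) (auto simp: permutes_id e_def)
  have rd: "rowdot r (?V * Q) a a' = e a * e a' * rowdot r Q a a'" if "Q \<in> space U" "a < p" "a' < p" for Q a a'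
    using rowdot_signed_perm[OF permutes_id, of Q p r a a' e] that by (simp add: space_U stiefel_def)
  have "(\<integral>Q. exp (b * tops Q) * rowdot r Q i i' \<partial>U) = (\<integral>Q. exp (b * tops (?V * Q)) * rowdot r (?V * Q) i i' \<partial>U)"
    by (rule integral_orth[OF V measurable_weighted[OF i(1,2)], symmetric])
  also have "\<dots> = (\<integral>Q. - (exp (b * tops Q) * rowdot r Q i i') \<partial>U)"
  proof (rule Bochner_Integration.integral_cong[OF refl])
    fix Q assume Q: "Q \<in> space U"
    have "tops (?V * Q) = tops Q"
      unfolding tops_def using rd[OF Q] rp by (intro sum.cong refl) (auto simp: e_def)
    then show "exp (b * tops (?V * Q)) * rowdot r (?V * Q) i i' = - (exp (b * tops Q) * rowdot r Q i i')"
      using rd[OF Q i(1,2)] i(3) by (simp add: e_def)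
  qed
  also have "\<dots> = - (\<integral>Q. exp (b * tops Q) * rowdot r Q i i' \<partial>U)" by simp
  finally show ?thesis by simp
qed

text \<open>Rows 0 and i are exchanged. Both indices lie below r, so \<open>tops\<close> is
  invariant under the exchange.\<close>

lemma weighted_diag:
  assumes i: "i < r"
  shows "(\<integral>Q. exp (b * tops Q) * rowdot r Q i i \<partial>U) = (\<integral>Q. exp (b * tops Q) * rowdot r Q 0 0 \<partial>U)"
proof -
  let ?s = "Transposition.transpose 0 i"
  let ?V = "signed_perm p ?s (\<lambda>_. 1)"
  have sr: "?s permutes {..<r}" and sp: "?s permutes {..<p}"
    using i rp by (auto intro!: permutes_swap_id)
  have V: "?V \<in> stiefel p p" by (rule signed_perm_stiefel[OF sp]) simp
  have rd: "rowdot r (?V * Q) a a = rowdot r Q (?s a) (?s a)" if "Q \<in> space U" "a < p" for Q a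
    using rowdot_signed_perm[OF sp, of Q r a a "\<lambda>_. 1"] that by (simp add: space_U stiefel_def)
  have ip: "i < p" "0 < p" using i rp by auto
  have "(\<integral>Q. exp (b * tops Q) * rowdot r Q i i \<partial>U) = (\<integral>Q. exp (b * tops (?V * Q)) * rowdot r (?V * Q) i i \<partial>U)"
    by (rule integral_orth[OF V measurable_weighted[OF ip(1) ip(1)], symmetric])
  also have "\<dots> = (\<integral>Q. exp (b * tops Q) * rowdot r Q 0 0 \<partial>U)"
  proof (rule Bochner_Integration.integral_cong[OF refl])
    fix Q assume Q: "Q \<in> space U"
    have "tops (?V * Q) = (\<Sum>a<r. rowdot r Q (?s a) (?s a))"
      unfolding tops_def using rd[OF Q] rp by (intro sum.cong refl) auto
    also have "\<dots> = tops Q"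
      unfolding tops_def using sum.permute[OF sr, of "\<lambda>a. rowdot r Q a a"] by (simp add: comp_def)
    finally show "exp (b * tops (?V * Q)) * rowdot r (?V * Q) i i = exp (b * tops Q) * rowdot r Q 0 0"
      using rd[OF Q ip(1)] by simp
  qed
  finally show ?thesis .
qed

text \<open>The tangent line of \<open>exp\<close> at \<open>b tops Q\<close> is used: its linear part has mean zero
  because sign flips kill the off-diagonal terms and row swaps equalise the diagonal ones.\<close>

lemma triangular_lower_bound:
  assumes A: "A \<in> carrier_mat p r" and up: "\<And>i j. r \<le> i \<Longrightarrow> i < p \<Longrightarrow> j < r \<Longrightarrow> A $$ (i, j) = 0"
  shows "(\<integral>\<^sup>+Q. ennreal (exp (c * fnorm2 p r (qf A) / real r * tops Q)) \<partial>U) \<le>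
    (\<integral>\<^sup>+Q. ennreal (exp (c * frob_cross p r r (qf A) (qf Q))) \<partial>U)"
proof -
  let ?b = "c * fnorm2 p r (qf A) / real r"
  let ?W = "\<lambda>Q. exp (?b * tops Q)"
  let ?F = "\<lambda>Q. \<Sum>i<p. \<Sum>i'<p. rowdot r A i i' * rowdot r Q i i'"
  let ?e = "\<integral>Q. ?W Q * rowdot r Q 0 0 \<partial>U"
  have FW: "?W Q * ?F Q = (\<Sum>i<p. \<Sum>i'<p. rowdot r A i i' * (?W Q * rowdot r Q i i'))" for Q
    unfolding sum_distrib_left by (rule sum.cong[OF refl], rule sum.cong[OF refl]) (rule mult.left_commute)
  have SW: "?W Q * tops Q = (\<Sum>i<r. ?W Q * rowdot r Q i i)" for Q
    by (simp add: tops_def sum_distrib_left)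
  have intF: "integrable U (\<lambda>Q. ?W Q * ?F Q)"
    unfolding FW by (intro Bochner_Integration.integrable_sum integrable_mult_right integrable_weighted) auto
  have intS: "integrable U (\<lambda>Q. ?W Q * tops Q)"
    unfolding SW using rp by (intro Bochner_Integration.integrable_sum integrable_weighted) auto
  have z: "rowdot r A i i' = 0" if "r \<le> i" "i < p" for i i'
    unfolding rowdot_def using up that by simp
  have "(\<integral>Q. ?W Q * ?F Q \<partial>U) = (\<Sum>i<p. \<Sum>i'<p. rowdot r A i i' * (\<integral>Q. ?W Q * rowdot r Q i i' \<partial>U))"
    unfolding FW
    by (subst Bochner_Integration.integral_sum, intro Bochner_Integration.integrable_sum integrable_mult_right integrable_weighted, simp, simp,
        intro sum.cong refl, subst Bochner_Integration.integral_sum, intro integrable_mult_right integrable_weighted, simp, simp,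
        intro sum.cong refl) simp
  also have "\<dots> = (\<Sum>i<p. \<Sum>i'<p. if i' = i then rowdot r A i i * ?e else 0)"
  proof (intro sum.cong refl)
    fix i i' assume ii: "i \<in> {..<p}" "i' \<in> {..<p}"
    show "rowdot r A i i' * (\<integral>Q. ?W Q * rowdot r Q i i' \<partial>U) = (if i' = i then rowdot r A i i * ?e else 0)"
    proof (cases "i' = i")
      case True
      show ?thesis
      proof (cases "i < r")
        case True
        then show ?thesis using weighted_diag[OF True, of ?b] \<open>i' = i\<close> by simp
      next
        case False
        then show ?thesis using z[of i] ii \<open>i' = i\<close> by simp
      qed
    next
      case False
      then show ?thesis using weighted_offdiag[of i i' ?b] ii by simp
    qed
  qed
  also have "\<dots> = fnorm2 p r (qf A) * ?e" by (simp add: fnorm2_rowdot sum_distrib_right)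
  finally have EF: "(\<integral>Q. ?W Q * ?F Q \<partial>U) = fnorm2 p r (qf A) * ?e" .
  have "(\<integral>Q. ?W Q * tops Q \<partial>U) = (\<Sum>i<r. \<integral>Q. ?W Q * rowdot r Q i i \<partial>U)"
    unfolding SW using rp by (intro Bochner_Integration.integral_sum integrable_weighted) auto
  also have "\<dots> = (\<Sum>i<r. ?e)" by (intro sum.cong refl weighted_diag) simp
  finally have ES: "(\<integral>Q. ?W Q * tops Q \<partial>U) = real r * ?e" by simp
  \<comment> \<open>For r = 0 the quotient defining b is 0 by convention, and \<open>fnorm2\<close>
    vanishes as well.\<close>
  have "?b * (real r * ?e) = c * (fnorm2 p r (qf A) * ?e)"
  proof (cases "r = 0")
    case True
    then show ?thesis by (simp add: fnorm2_def)
  qed simp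
  then have zero: "c * (\<integral>Q. ?W Q * ?F Q \<partial>U) - ?b * (\<integral>Q. ?W Q * tops Q \<partial>U) = 0" unfolding EF ES by simp
  have mS: "(\<lambda>Q. ?W Q) \<in> borel_measurable U" using measurable_tops by measurable
  have mF: "(\<lambda>Q. ?F Q) \<in> borel_measurable U"
    by (intro borel_measurable_sum borel_measurable_times borel_measurable_const measurable_rowdot) auto
  have intW: "integrable U ?W"
  proof (rule U.integrable_const_bound[where B = "exp (\<bar>?b\<bar> * real r)"])
    show "AE Q in U. norm (?W Q) \<le> exp (\<bar>?b\<bar> * real r)"
    proof (rule AE_I2)
      fix Q assume "Q \<in> space U"
      then have "tops Q \<le> real r" by (simp add: space_U tops_le)
      then have "?b * tops Q \<le> \<bar>?b\<bar> * real r"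
        by (intro order_trans[OF mult_right_mono[OF abs_ge_self] mult_left_mono]) auto
      then show "norm (?W Q) \<le> exp (\<bar>?b\<bar> * real r)" by simp
    qed
  qed (rule mS)
  have intE: "integrable U (\<lambda>Q. exp (c * ?F Q))"
  proof (rule U.integrable_const_bound[where B = "exp (\<bar>c\<bar> * (\<Sum>i<p. \<Sum>i'<p. \<bar>rowdot r A i i'\<bar> * real r))"])
    show "AE Q in U. norm (exp (c * ?F Q)) \<le> exp (\<bar>c\<bar> * (\<Sum>i<p. \<Sum>i'<p. \<bar>rowdot r A i i'\<bar> * real r))"
    proof (rule AE_I2)
      fix Q assume "Q \<in> space U"
      then have Q: "Q \<in> stiefel p r" by (simp add: space_U)
      have "\<bar>?F Q\<bar> \<le> (\<Sum>i<p. \<Sum>i'<p. \<bar>rowdot r A i i'\<bar> * real r)"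
        by (intro order_trans[OF sum_abs] sum_mono) (auto simp: abs_mult intro!: mult_left_mono abs_rowdot_le[OF Q])
      then have "\<bar>c\<bar> * \<bar>?F Q\<bar> \<le> \<bar>c\<bar> * (\<Sum>i<p. \<Sum>i'<p. \<bar>rowdot r A i i'\<bar> * real r)"
        by (rule mult_left_mono) simp
      moreover have "c * ?F Q \<le> \<bar>c\<bar> * \<bar>?F Q\<bar>" unfolding abs_mult[symmetric] by (rule abs_ge_self)
      ultimately show "norm (exp (c * ?F Q)) \<le> exp (\<bar>c\<bar> * (\<Sum>i<p. \<Sum>i'<p. \<bar>rowdot r A i i'\<bar> * real r))" by simp
    qed
  qed (use mF in measurable)
  \<comment> \<open>A term of mean zero is added, and 1 + y \<le> exp y is applied pointwise at the
    difference of the two exponents.\<close>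
  have "(\<integral>Q. ?W Q \<partial>U) = (\<integral>Q. ?W Q + (c * (?W Q * ?F Q) - ?b * (?W Q * tops Q)) \<partial>U)"
    using zero intW intF intS by simp
  also have "\<dots> \<le> (\<integral>Q. exp (c * ?F Q) \<partial>U)"
  proof (rule integral_mono)
    show "integrable U (\<lambda>Q. ?W Q + (c * (?W Q * ?F Q) - ?b * (?W Q * tops Q)))"
      using intW intF intS by simp
    fix Q
    have "?W Q + (c * (?W Q * ?F Q) - ?b * (?W Q * tops Q)) = ?W Q * (1 + (c * ?F Q - ?b * tops Q))"
      by (simp add: algebra_simps)
    also have "\<dots> \<le> ?W Q * exp (c * ?F Q - ?b * tops Q)" by (intro mult_left_mono exp_ge_add_one_self) simp
    also have "\<dots> = exp (c * ?F Q)" by (simp flip: exp_add)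
    finally show "?W Q + (c * (?W Q * ?F Q) - ?b * (?W Q * tops Q)) \<le> exp (c * ?F Q)" .
  qed (rule intE)
  finally have "ennreal (\<integral>Q. ?W Q \<partial>U) \<le> ennreal (\<integral>Q. exp (c * ?F Q) \<partial>U)" by (rule ennreal_leI)
  then show ?thesis
    unfolding frob_cross_rowdot
    using nn_integral_eq_integral[OF intW] nn_integral_eq_integral[OF intE] by simp
qed

lemma measurable_frob_cross_qf: "(\<lambda>Q. frob_cross p r r B (qf Q)) \<in> borel_measurable U"
  unfolding frob_cross_def dotp_def
  by (intro borel_measurable_sum borel_measurable_power borel_measurable_times borel_measurable_const measurable_qf) auto

text \<open>Multiplying A and Q by the same orthogonal matrix changes neither statistic nor the law
  of Q, so A may be taken triangular. Its nonzero rows are then among the first r.\<close>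

lemma cross_lower_bound:
  assumes A: "A \<in> carrier_mat p r"
  shows "(\<integral>\<^sup>+Q. ennreal (exp (c * fnorm2 p r (qf A) / real r * tops Q)) \<partial>U) \<le>
    (\<integral>\<^sup>+Q. ennreal (exp (c * frob_cross p r r (qf A) (qf Q))) \<partial>U)"
proof -
  obtain V where V: "V \<in> stiefel p p" "\<And>i j. j < r \<Longrightarrow> j < i \<Longrightarrow> i < p \<Longrightarrow> (V * A) $$ (i, j) = 0"
    using exists_orth_triangular[OF A, of r] rp by auto
  have VA: "V * A \<in> carrier_mat p r" using V(1) A by (auto simp: stiefel_def)
  have "(\<integral>\<^sup>+Q. ennreal (exp (c * fnorm2 p r (qf (V * A)) / real r * tops Q)) \<partial>U) \<le>
    (\<integral>\<^sup>+Q. ennreal (exp (c * frob_cross p r r (qf (V * A)) (qf Q))) \<partial>U)"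
    by (rule triangular_lower_bound[OF VA]) (use V(2) in auto)
  also have "\<dots> = (\<integral>\<^sup>+Q. ennreal (exp (c * frob_cross p r r (qf (V * A)) (qf (V * Q)))) \<partial>U)"
    using measurable_frob_cross_qf[of "qf (V * A)"] by (intro nn_integral_orth[OF V(1), symmetric]) measurable
  also have "\<dots> = (\<integral>\<^sup>+Q. ennreal (exp (c * frob_cross p r r (qf A) (qf Q))) \<partial>U)"
    by (intro nn_integral_cong) (simp add: space_U stiefel_def frob_cross_orth_mult[OF V(1) A])
  finally show ?thesis unfolding fnorm2_orth_mult[OF V(1) A] .
qed

text \<open>The triangular form of a frame has an orthogonal top block and zeros below it, so its A
  A^T is the projection onto the first r coordinates. The cross statistic then equals
  \<open>tops\<close> exactly, for every Q.\<close>

lemma cross_stiefel_eq: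
  assumes A: "A \<in> stiefel p r"
  shows "(\<integral>\<^sup>+Q. ennreal (exp (c * frob_cross p r r (qf A) (qf Q))) \<partial>U) = (\<integral>\<^sup>+Q. ennreal (exp (c * tops Q)) \<partial>U)"
proof -
  have Ac: "A \<in> carrier_mat p r" using A by (simp add: stiefel_def)
  obtain V where V: "V \<in> stiefel p p" "\<And>i j. j < r \<Longrightarrow> j < i \<Longrightarrow> i < p \<Longrightarrow> (V * A) $$ (i, j) = 0"
    using exists_orth_triangular[OF Ac, of r] rp by auto
  have VA: "V * A \<in> stiefel p r" by (rule stiefel_mult[OF V(1) A])
  have z: "rowdot r (V * A) i i' = 0" if "r \<le> i" "i < p" for i i'
    unfolding rowdot_def using V(2) that by simp
  have z': "rowdot r (V * A) i i' = 0" if "r \<le> i'" "i' < p" for i i'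
    unfolding rowdot_def using V(2) that by simp
  \<comment> \<open>The columns of this block are orthonormal because the rows cut off are zero;
    being square, it has orthonormal rows too.\<close>
  let ?T = "Matrix.mat r r (\<lambda>(i, j). (V * A) $$ (i, j))"
  have T: "?T \<in> stiefel r r"
    unfolding stiefel_iff
  proof (intro conjI allI impI)
    fix j j' assume j: "j < r" "j' < r"
    have "dotp p (qf (V * A) j) (qf (V * A) j') = (\<Sum>i<p. qf (V * A) j i * qf (V * A) j' i)" by (simp add: dotp_def)
    also have "\<dots> = (\<Sum>i<r. qf (V * A) j i * qf (V * A) j' i)"
      using rp V(2) j by (intro sum.mono_neutral_right) (auto simp: qf_def)
    also have "\<dots> = dotp r (qf ?T j) (qf ?T j')" using j by (simp add: dotp_def qf_def)
    finally show "dotp r (qf ?T j) (qf ?T j') = (if j = j' then 1 else 0)"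
      using VA j unfolding stiefel_iff by simp
  qed simp
  have rd: "rowdot r (V * A) i i' = (if i = i' then 1 else 0)" if "i < r" "i' < r" for i i'
    using stiefel_orth_rows[OF T that] that by (simp add: rowdot_def)
  have F: "frob_cross p r r (qf (V * A)) (qf Q) = tops Q" for Q
  proof -
    have "frob_cross p r r (qf (V * A)) (qf Q) = (\<Sum>i<p. \<Sum>i'<p. if i' = i then (if i < r then rowdot r Q i i else 0) else 0)"
      unfolding frob_cross_rowdot
    proof (intro sum.cong refl)
      fix i i' assume "i \<in> {..<p}" "i' \<in> {..<p}"
      then show "rowdot r (V * A) i i' * rowdot r Q i i' = (if i' = i then (if i < r then rowdot r Q i i else 0) else 0)"
        using z[of i i'] z'[of i' i] rd[of i i'] by (cases "i < r"; cases "i' < r") auto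
    qed
    also have "\<dots> = (\<Sum>i<p. if i < r then rowdot r Q i i else 0)" by simp
    also have "\<dots> = tops Q" unfolding tops_def using rp
      by (intro sum.mono_neutral_cong_right) auto
    finally show ?thesis .
  qed
  have "(\<integral>\<^sup>+Q. ennreal (exp (c * frob_cross p r r (qf A) (qf Q))) \<partial>U) =
    (\<integral>\<^sup>+Q. ennreal (exp (c * frob_cross p r r (qf (V * A)) (qf (V * Q)))) \<partial>U)"
    by (intro nn_integral_cong) (simp add: space_U stiefel_def frob_cross_orth_mult[OF V(1) Ac])
  also have "\<dots> = (\<integral>\<^sup>+Q. ennreal (exp (c * frob_cross p r r (qf (V * A)) (qf Q))) \<partial>U)"
    using measurable_frob_cross_qf[of "qf (V * A)"] by (intro nn_integral_orth[OF V(1)]) measurable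
  finally show ?thesis unfolding F .
qed

lemma op_bounded_stiefel:
  assumes "Q \<in> stiefel p r"
  shows "op_bounded p r (qf Q) 1"
proof -
  have "op_bounded r p (\<lambda>i j. qf Q j i) 1"
    unfolding op_bounded_def
  proof
    fix g
    have "qform r p (\<lambda>i j. qf Q j i) g = (\<Sum>j<r. g j * dotp p (qf Q j) (\<lambda>i. \<Sum>j'<r. qf Q j' i * g j'))"
      unfolding qform_transpose dotp_lincomb ..
    also have "\<dots> = (\<Sum>j<r. g j * g j)"
    proof (intro sum.cong refl)
      fix j assume j: "j \<in> {..<r}"
      have "dotp p (qf Q j) (\<lambda>i. \<Sum>j'<r. qf Q j' i * g j') = (\<Sum>j'<r. g j' * dotp p (qf Q j') (qf Q j))"
        by (subst dotp_commute) (rule dotp_lincomb)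
      also have "\<dots> = (\<Sum>j'<r. if j' = j then g j' else 0)"
        using assms j unfolding stiefel_iff by (intro sum.cong refl) simp
      finally show "g j * dotp p (qf Q j) (\<lambda>i. \<Sum>j'<r. qf Q j' i * g j') = g j * g j" using j by simp
    qed
    finally show "qform r p (\<lambda>i j. qf Q j i) g \<le> 1 * dotp r g g" by (simp add: dotp_def)
  qed
  from op_bounded_transpose[OF this] show ?thesis by simp
qed

text \<open>A fixed frame is replaced by a Gaussian matrix at the price of an inequality in the
  right direction. The factor S / p normalises it: the columns of Z / sqrt p have unit mean square
  norm.\<close>

lemma cross_upper_bound:
  assumes S: "0 \<le> S" "S / real p \<le> \<zeta>" "\<zeta> < 1 / 2" and A: "A \<in> stiefel p r"
  shows "(\<integral>\<^sup>+Q. ennreal (exp (S * frob_cross p r r (qf A) (qf Q) / 2)) \<partial>U) \<le>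
    ennreal (exp (S * (real r)\<^sup>2 / real p / (1 - 2 * \<zeta>) / 2))"
proof (cases "r = 0")
  case True
  then show ?thesis using U.emeasure_space_1 by (simp add: frob_cross_def)
next
  case False
  then have r: "r > 0" "p > 0" using rp by auto
  let ?s = "S / real p"
  have s0: "0 \<le> ?s" using S(1) by simp
  note [measurable] = measurable_tops measurable_fnorm2_zfam
  have ztail: "qf (Matrix.mat p r z) j i = zfam z j i" if "i < p" "j < r" for z i j
    using that by (simp add: qf_def zfam_def)
  have fz: "fnorm2 p r (qf (Matrix.mat p r z)) = fnorm2 p r (zfam z)" for z
    unfolding fnorm2_def by (intro sum.cong refl dotp_cong) (simp_all add: ztail)
  have cz: "frob_cross p r r (qf (Matrix.mat p r z)) B = frob_cross p r r (zfam z) B" for z B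
    unfolding frob_cross_def by (intro sum.cong refl arg_cong[where f = "\<lambda>x. x\<^sup>2"] dotp_cong) (simp_all add: ztail)
  have joint [measurable]: "(\<lambda>x. frob_cross p r r (zfam (snd x)) (qf (fst x))) \<in> borel_measurable (U \<Otimes>\<^sub>M gz p r)"
    unfolding frob_cross_def dotp_def
    by (intro borel_measurable_sum borel_measurable_power borel_measurable_times
        measurable_compose[OF measurable_snd measurable_zfam] measurable_compose[OF measurable_fst measurable_qf]) auto
  have sf: "sigma_finite_measure U" "sigma_finite_measure (gz p r)"
    using prob_space_imp_sigma_finite prob_U prob_space_gz by auto
  have "(\<integral>\<^sup>+Q. ennreal (exp (S * frob_cross p r r (qf A) (qf Q) / 2)) \<partial>U) = (\<integral>\<^sup>+Q. ennreal (exp (S / 2 * tops Q)) \<partial>U)"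
    using cross_stiefel_eq[OF A, of "S / 2"] by simp
  \<comment> \<open>The mean of |Z|^2 is p r, so the exponent is replaced by a random one with the
    same mean. The lower bound of \<open>gauss_frob_bounds\<close> at the identity plays the role of
    Jensen's inequality.\<close>
  also have "\<dots> \<le> (\<integral>\<^sup>+Q. (\<integral>\<^sup>+z. ennreal (exp (?s / 2 * fnorm2 p r (zfam z) / real r * tops Q)) \<partial>gz p r) \<partial>U)"
  proof (rule nn_integral_mono)
    fix Q assume "Q \<in> space U"
    then have t: "tops Q \<le> real r" by (simp add: space_U tops_le)
    let ?t = "?s * (tops Q / real r)"
    have t1: "?t \<le> ?s * 1" using t r s0 by (intro mult_left_mono) auto
    have "ennreal (exp (real r * ?t * fnorm2 p p idf / 2)) \<le> (\<integral>\<^sup>+z. ennreal (exp (?t * frob_cross p r p (zfam z) idf / 2)) \<partial>gz p r)"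
      by (rule gauss_frob_bounds(1)[OF op_bounded_idf]) (use s0 t1 S r in auto)
    moreover have "real r * ?t * fnorm2 p p idf / 2 = S / 2 * tops Q" using r by (simp add: fnorm2_idf)
    moreover have "?t * frob_cross p r p (zfam z) idf / 2 = ?s / 2 * fnorm2 p r (zfam z) / real r * tops Q" for z
      by (simp add: frob_cross_idf mult_ac)
    ultimately show "ennreal (exp (S / 2 * tops Q)) \<le> (\<integral>\<^sup>+z. ennreal (exp (?s / 2 * fnorm2 p r (zfam z) / real r * tops Q)) \<partial>gz p r)"
      by (simp only:)
  qed
  also have "\<dots> = (\<integral>\<^sup>+z. (\<integral>\<^sup>+Q. ennreal (exp (?s / 2 * fnorm2 p r (zfam z) / real r * tops Q)) \<partial>U) \<partial>gz p r)"
  proof (rule nn_integral_swap[OF sf])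
    show "(\<lambda>(Q, z). ennreal (exp (?s / 2 * fnorm2 p r (zfam z) / real r * tops Q))) \<in> borel_measurable (U \<Otimes>\<^sub>M gz p r)"
      unfolding case_prod_unfold by measurable
  qed
  \<comment> \<open>Conditionally on Z, the Frobenius norm is traded for the true cross statistic by
    \<open>cross_lower_bound\<close>.\<close>
  also have "\<dots> \<le> (\<integral>\<^sup>+z. (\<integral>\<^sup>+Q. ennreal (exp (?s / 2 * frob_cross p r r (zfam z) (qf Q))) \<partial>U) \<partial>gz p r)"
  proof (rule nn_integral_mono)
    fix z :: "nat \<times> nat \<Rightarrow> real"
    show "(\<integral>\<^sup>+Q. ennreal (exp (?s / 2 * fnorm2 p r (zfam z) / real r * tops Q)) \<partial>U) \<le>
      (\<integral>\<^sup>+Q. ennreal (exp (?s / 2 * frob_cross p r r (zfam z) (qf Q))) \<partial>U)"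
      using cross_lower_bound[of "Matrix.mat p r z" "?s / 2"] unfolding fz cz by simp
  qed
  also have "\<dots> = (\<integral>\<^sup>+Q. (\<integral>\<^sup>+z. ennreal (exp (?s / 2 * frob_cross p r r (zfam z) (qf Q))) \<partial>gz p r) \<partial>U)"
  proof (rule nn_integral_swap[OF sf, symmetric])
    show "(\<lambda>(Q, z). ennreal (exp (?s / 2 * frob_cross p r r (zfam z) (qf Q)))) \<in> borel_measurable (U \<Otimes>\<^sub>M gz p r)"
      unfolding case_prod_unfold by measurable
  qed
  \<comment> \<open>With Q fixed and Z integrated the columns are independent, and |Q|^2 = r gives
    the final exponent.\<close>
  also have "\<dots> \<le> (\<integral>\<^sup>+Q. ennreal (exp (real r * ?s * real r / (1 - 2 * \<zeta>) / 2)) \<partial>U)"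
  proof (rule nn_integral_mono)
    fix Q assume "Q \<in> space U"
    then have Q: "Q \<in> stiefel p r" by (simp add: space_U)
    have "(\<integral>\<^sup>+z. ennreal (exp (?s * frob_cross p r r (zfam z) (qf Q) / 2)) \<partial>gz p r) \<le>
      ennreal (exp (real r * ?s * fnorm2 p r (qf Q) / (1 - 2 * \<zeta>) / 2))"
      by (rule gauss_frob_bounds(2)[OF op_bounded_stiefel[OF Q]]) (use s0 S in auto)
    then show "(\<integral>\<^sup>+z. ennreal (exp (?s / 2 * frob_cross p r r (zfam z) (qf Q))) \<partial>gz p r) \<le>
      ennreal (exp (real r * ?s * real r / (1 - 2 * \<zeta>) / 2))"
      unfolding fnorm2_stiefel[OF Q] by simp
  qed
  also have "\<dots> = ennreal (exp (S * (real r)\<^sup>2 / real p / (1 - 2 * \<zeta>) / 2))"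
    using U.emeasure_space_1 by (simp add: power2_eq_square mult_ac)
  finally show ?thesis .
qed

end

section \<open>Reduction of the two models to mixtures\<close>

lemma frob_cross_scale:
  "frob_cross p r l (\<lambda>j i. a * A j i) (\<lambda>j i. b * B j i) = a\<^sup>2 * b\<^sup>2 * frob_cross p r l A B"
  by (simp add: frob_cross_def dotp_scale_left dotp_scale_right power_mult_distrib sum_distrib_left mult.assoc)

lemma frob_cross_cong:
  assumes "\<And>i j. i < p \<Longrightarrow> j < r \<Longrightarrow> A j i = A' j i" "\<And>i j. i < p \<Longrightarrow> j < l \<Longrightarrow> B j i = B' j i"
  shows "frob_cross p r l A B = frob_cross p r l A' B'"
  unfolding frob_cross_def using assms by (intro sum.cong refl arg_cong[where f = "\<lambda>x. x\<^sup>2"] dotp_cong) auto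

lemma fnorm2_scale: "fnorm2 p r (\<lambda>j i. a * A j i) = a\<^sup>2 * fnorm2 p r A"
  by (simp add: fnorm2_def dotp_scale_left dotp_scale_right power2_eq_square sum_distrib_left mult.assoc)

lemma fnorm2_cong: "(\<And>i j. i < p \<Longrightarrow> j < r \<Longrightarrow> A j i = A' j i) \<Longrightarrow> fnorm2 p r A = fnorm2 p r A'"
  unfolding fnorm2_def by (intro sum.cong refl dotp_cong) auto

lemma op_bounded_cong: "(\<And>i j. i < p \<Longrightarrow> j < r \<Longrightarrow> A j i = A' j i) \<Longrightarrow> op_bounded p r A \<eta> \<longleftrightarrow> op_bounded p r A' \<eta>"
proof -
  assume a: "\<And>i j. i < p \<Longrightarrow> j < r \<Longrightarrow> A j i = A' j i"
  have "qform p r A z = qform p r A' z" for z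
    unfolding qform_def using a by (intro sum.cong refl arg_cong[where f = "\<lambda>x. x\<^sup>2"] dotp_cong) auto
  then show ?thesis by (simp add: op_bounded_def)
qed

lemma op_bounded_mono: "op_bounded m k D \<eta> \<Longrightarrow> \<eta> \<le> \<eta>' \<Longrightarrow> op_bounded m k D \<eta>'"
  unfolding op_bounded_def by (meson dotp_self_nonneg mult_right_mono order_trans)

lemma mat_fam_eq: "mat_fam c A = (\<lambda>j i. sqrt c * qf A j i)"
  by (simp add: mat_fam_def qf_def fun_eq_iff)

lemma op_bounded_mat_fam: "op_bounded p r (qf A) \<eta> \<Longrightarrow> c \<ge> 0 \<Longrightarrow> op_bounded p r (mat_fam c A) (c * \<eta>)"
  unfolding mat_fam_eq using op_bounded_scale[of p r "qf A" \<eta> "sqrt c"] by simp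

lemma mixture_LR_eq_mixlr:
  assumes c: "c \<ge> 0" and \<eta>: "\<eta> < 1"
    and car: "\<And>A. A \<in> space M \<Longrightarrow> A \<in> carrier_mat p r \<and> op_bounded p r (mat_fam c A) \<eta>"
  shows "mixture_LR n p c M x = mixlr n p r M (mat_fam c) x"
proof -
  have "mixture_LR n p c M x = (\<integral>A. iid_density n p (spiked_cov p c A) x / iid_density n p (1\<^sub>m p) x \<partial>M)"
    unfolding mixture_LR_def by simp
  also have "\<dots> = mixlr n p r M (mat_fam c) x"
    unfolding mixlr_def by (intro Bochner_Integration.integral_cong refl iid_density_ratio[OF _ c _ \<eta>]) (use car in auto)
  finally show ?thesis .
qed

definition tfam :: "nat \<Rightarrow> nat \<Rightarrow> real \<Rightarrow> real \<Rightarrow> (nat \<times> nat \<Rightarrow> real) \<Rightarrow> nat \<Rightarrow> nat \<Rightarrow> real" where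
  "tfam p r c t z = mat_fam c (mat_trunc p r t (Matrix.mat p r z))"

lemma op_bounded_mat_trunc:
  assumes Z: "Z \<in> carrier_mat p r" and t: "t \<ge> 0"
  shows "op_bounded p r (qf (mat_trunc p r t Z)) (t\<^sup>2)"
proof (cases "spectral_norm Z \<le> t")
  case True
  then have "op_bounded r p (mat_rows Z) (t\<^sup>2)" using spectral_norm_le_iff[OF Z t] by simp
  from op_bounded_transpose[OF this] have "op_bounded p r (\<lambda>i j. mat_rows Z j i) (t\<^sup>2)" by simp
  moreover have "(\<lambda>i j. mat_rows Z j i) = qf Z" by (simp add: mat_rows_def qf_def fun_eq_iff)
  ultimately show ?thesis using True by (simp add: mat_trunc_def)
next
  case False
  have "qform p r (qf (0\<^sub>m p r)) z = 0" for z
    unfolding qform_def dotp_def qf_def by (intro sum.neutral ballI) simp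
  then show ?thesis using False by (simp add: mat_trunc_def op_bounded_def)
qed

lemma measurable_tfam:
  assumes "t \<ge> 0" "i < p" "j < r"
  shows "(\<lambda>z. tfam p r c t z j i) \<in> borel_measurable (gz p r)"
proof -
  have "(\<lambda>z. mat_trunc p r t (Matrix.mat p r z) $$ (i, j)) \<in> borel_measurable (gz p r)"
    by (rule measurable_compose[OF measurable_compose[OF measurable_mat_of_fun measurable_mat_trunc[OF assms(1)]] measurable_mat_entry[OF assms(2,3)]])
  then show ?thesis unfolding tfam_def mat_fam_def by (intro borel_measurable_times borel_measurable_const)
qed

lemma fam_ok_tfam:
  assumes "t \<ge> 0" "c \<ge> 0"
  shows "fam_ok (gz p r) p r (tfam p r c t) (c * t\<^sup>2)"
  unfolding fam_ok_def
  using assms prob_space.axioms(1)[OF prob_space_gz] measurable_tfam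
  by (auto simp: tfam_def intro!: op_bounded_mat_fam op_bounded_mat_trunc)

text \<open>The mixture over the truncated law is pulled back to the Gaussian entries, so that
  truncated and untruncated matrices live on one probability space and can be compared
  pointwise.\<close>

lemma mixture_LR_truncated:
  assumes t: "t \<ge> 0" and c: "c \<ge> 0" and ct: "c * t\<^sup>2 < 1"
  shows "mixture_LR n p c (truncated_gaussian_mat p r t) x = mixlr n p r (gz p r) (tfam p r c t) x"
proof -
  let ?h = "\<lambda>A. iid_density n p (spiked_cov p c A) x"
  have h: "?h \<in> borel_measurable (mat_borel p r)" by (rule measurable_iid_density_spiked[OF c])
  have tm: "mat_trunc p r t \<in> gaussian_mat p r \<rightarrow>\<^sub>M mat_borel p r"
    using measurable_mat_trunc[OF t, of p r] by (simp add: gaussian_mat_def)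
  have hg: "(\<lambda>A. ?h (mat_trunc p r t A)) \<in> borel_measurable (mat_borel p r)"
    by (rule measurable_compose[OF measurable_mat_trunc[OF t] h])
  have tr: "truncated_gaussian_mat p r t = distr (gaussian_mat p r) (mat_borel p r) (mat_trunc p r t)"
    unfolding truncated_gaussian_mat_def mat_trunc_def[abs_def] ..
  have "(\<integral>A. ?h A \<partial>truncated_gaussian_mat p r t) = (\<integral>A. ?h (mat_trunc p r t A) \<partial>gaussian_mat p r)"
    unfolding tr by (rule integral_distr[OF tm h])
  also have "\<dots> = (\<integral>z. ?h (mat_trunc p r t (Matrix.mat p r z)) \<partial>gz p r)"
    unfolding gaussian_mat_def by (rule integral_distr[OF measurable_mat_of_fun hg])
  finally have "mixture_LR n p c (truncated_gaussian_mat p r t) x =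
    (\<integral>z. ?h (mat_trunc p r t (Matrix.mat p r z)) / iid_density n p (1\<^sub>m p) x \<partial>gz p r)"
    unfolding mixture_LR_def by simp
  also have "\<dots> = mixlr n p r (gz p r) (tfam p r c t) x"
    unfolding mixlr_def tfam_def
    by (intro Bochner_Integration.integral_cong refl iid_density_ratio[OF _ c op_bounded_mat_fam[OF op_bounded_mat_trunc[OF _ t] c] ct]) auto
  finally show ?thesis .
qed

text \<open>On the good event the Gram bound gives |Z|^2 \<le> \<eta> / c \<le> t^2, so the
  truncation leaves Z unchanged.\<close>

lemma tfam_good:
  assumes c: "c > 0" and t: "t \<ge> 0" "\<eta> \<le> c * t\<^sup>2" and \<eta>: "\<eta> \<ge> 0" and z: "z \<in> good_set p r (\<eta> / c)"
  shows "op_bounded p r (tfam p r c t z) \<eta>"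
    and "\<And>i j. i < p \<Longrightarrow> j < r \<Longrightarrow> tfam p r c t z j i = sqrt c * zfam z j i"
    and "op_bounded p r (zfam z) (\<eta> / c)"
proof -
  have e0: "\<eta> / c \<ge> 0" using c \<eta> by simp
  show o: "op_bounded p r (zfam z) (\<eta> / c)"
    by (rule op_bounded_of_gram) (use z e0 in \<open>auto simp: good_set_def\<close>)
  let ?Z = "Matrix.mat p r z"
  have qz: "i < p \<Longrightarrow> j < r \<Longrightarrow> qf ?Z j i = zfam z j i" for i j by (simp add: qf_def zfam_def)
  have oq: "op_bounded p r (qf ?Z) (\<eta> / c)" using o op_bounded_cong[of p r "qf ?Z" "zfam z" "\<eta> / c"] qz by simp
  have "\<eta> / c \<le> t\<^sup>2" using t(2) c by (simp add: field_simps)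
  with oq have "op_bounded p r (qf ?Z) (t\<^sup>2)" by (rule op_bounded_mono)
  from op_bounded_transpose[OF this] have "op_bounded r p (\<lambda>i j. qf ?Z j i) (t\<^sup>2)" by simp
  moreover have "(\<lambda>i j. qf ?Z j i) = mat_rows ?Z" by (simp add: mat_rows_def qf_def fun_eq_iff)
  ultimately have "spectral_norm ?Z \<le> t" using spectral_norm_le_iff[of ?Z p r t] t(1) by simp
  then have tf: "tfam p r c t z = mat_fam c ?Z" by (simp add: tfam_def mat_trunc_def)
  show "op_bounded p r (tfam p r c t z) \<eta>" unfolding tf using op_bounded_mat_fam[OF oq, of c] c by simp
  show "\<And>i j. i < p \<Longrightarrow> j < r \<Longrightarrow> tfam p r c t z j i = sqrt c * zfam z j i"
    unfolding tf mat_fam_eq using qz by simp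
qed

text \<open>The L1 norm of f - g is at most its L2 norm, here through nonnegativity of the variance.
  The form suits the moments at hand: upper bounds for the squares, a lower bound for the
  product.\<close>

lemma L1_le_sqrt_second_moments:
  fixes f g :: "'a \<Rightarrow> real"
  assumes P: "prob_space P" and f: "f \<in> borel_measurable P" "\<And>x. f x \<ge> 0" and g: "g \<in> borel_measurable P" "\<And>x. g x \<ge> 0"
    and u: "(\<integral>\<^sup>+x. ennreal (f x * f x) \<partial>P) \<le> ennreal u" and v: "(\<integral>\<^sup>+x. ennreal (g x * g x) \<partial>P) \<le> ennreal v"
    and w: "ennreal w \<le> (\<integral>\<^sup>+x. ennreal (f x * g x) \<partial>P)" and uv: "0 \<le> u" "0 \<le> v"
  shows "(\<integral>x. \<bar>f x - g x\<bar> \<partial>P) \<le> sqrt (u + v - 2 * w)"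
proof -
  interpret prob_space P by (rule P)
  note [measurable] = f(1) g(1)
  have iff: "integrable P (\<lambda>x. f x * f x)"
    by (rule integrableI_nonneg) (use u in \<open>auto intro: le_less_trans\<close>)
  have igg: "integrable P (\<lambda>x. g x * g x)"
    by (rule integrableI_nonneg) (use v in \<open>auto intro: le_less_trans\<close>)
  have ifg: "integrable P (\<lambda>x. f x * g x)"
  proof (rule Bochner_Integration.integrable_bound[OF Bochner_Integration.integrable_add[OF iff igg]])
    show "AE x in P. norm (f x * g x) \<le> norm (f x * f x + g x * g x)"
    proof (rule AE_I2)
      fix x
      have "0 \<le> (f x - g x)\<^sup>2" by simp
      then have "2 * (f x * g x) \<le> f x * f x + g x * g x" by (simp add: power2_eq_square algebra_simps)
      moreover have "0 \<le> f x * g x" using f(2) g(2) by simp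
      ultimately show "norm (f x * g x) \<le> norm (f x * f x + g x * g x)" by simp
    qed
  qed measurable
  have "ennreal (\<integral>x. f x * f x \<partial>P) \<le> ennreal u" using u nn_integral_eq_integral[OF iff] by simp
  then have U: "(\<integral>x. f x * f x \<partial>P) \<le> u" using uv by simp
  have "ennreal (\<integral>x. g x * g x \<partial>P) \<le> ennreal v" using v nn_integral_eq_integral[OF igg] by simp
  then have V: "(\<integral>x. g x * g x \<partial>P) \<le> v" using uv by simp
  have "ennreal w \<le> ennreal (\<integral>x. f x * g x \<partial>P)" using w nn_integral_eq_integral[OF ifg] f(2) g(2) by simp
  moreover have "0 \<le> (\<integral>x. f x * g x \<partial>P)" using f(2) g(2) by (intro integral_nonneg_AE) simp
  ultimately have W: "w \<le> (\<integral>x. f x * g x \<partial>P)" by simp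
  let ?h = "\<lambda>x. \<bar>f x - g x\<bar>"
  have sq: "(?h x)\<^sup>2 = f x * f x + g x * g x - 2 * (f x * g x)" for x by (simp add: power2_eq_square algebra_simps)
  have ih2: "integrable P (\<lambda>x. (?h x)\<^sup>2)" unfolding sq using iff igg ifg by simp
  have ih: "integrable P ?h" by (rule square_integrable_imp_integrable[OF _ ih2]) measurable
  have "0 \<le> variance ?h" by (intro integral_nonneg_AE) simp
  also have "variance ?h = expectation (\<lambda>x. (?h x)\<^sup>2) - (expectation ?h)\<^sup>2" by (rule variance_eq[OF ih ih2])
  finally have "(expectation ?h)\<^sup>2 \<le> expectation (\<lambda>x. (?h x)\<^sup>2)" by simp
  also have "\<dots> = (\<integral>x. f x * f x \<partial>P) + (\<integral>x. g x * g x \<partial>P) - 2 * (\<integral>x. f x * g x \<partial>P)"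
    unfolding sq using iff igg ifg by simp
  also have "\<dots> \<le> u + v - 2 * w" using U V W by simp
  finally show ?thesis by (rule real_le_rsqrt)
qed

text \<open>Integrates |f - 1| = f + 1 - 2 min 1 f. A small affinity forces the distance to be near
  its maximum 2.\<close>

lemma integral_abs_minus_one:
  fixes f :: "'a \<Rightarrow> real"
  assumes P: "prob_space P" and f: "f \<in> borel_measurable P" "\<And>x. f x \<ge> 0" and i: "(\<integral>\<^sup>+x. ennreal (f x) \<partial>P) = 1"
    and a: "(\<integral>\<^sup>+x. ennreal (min 1 (f x)) \<partial>P) \<le> ennreal a" "0 \<le> a"
  shows "2 - 2 * a \<le> (\<integral>x. \<bar>f x - 1\<bar> \<partial>P)" "(\<integral>x. \<bar>f x - 1\<bar> \<partial>P) \<le> 2"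
proof -
  interpret prob_space P by (rule P)
  note [measurable] = f(1)
  have if1: "integrable P f" by (rule integrableI_nonneg) (use f i in auto)
  have "ennreal (\<integral>x. f x \<partial>P) = 1" using nn_integral_eq_integral[OF if1] f(2) i by simp
  then have E: "(\<integral>x. f x \<partial>P) = 1" by simp
  have im: "integrable P (\<lambda>x. min 1 (f x))"
    by (rule integrable_const_bound[where B = 1]) (use f(2) in auto)
  have "ennreal (\<integral>x. min 1 (f x) \<partial>P) \<le> ennreal a" using nn_integral_eq_integral[OF im] f(2) a(1) by simp
  then have A: "(\<integral>x. min 1 (f x) \<partial>P) \<le> a" using a(2) by simp
  have "\<bar>f x - 1\<bar> = f x + 1 - 2 * min 1 (f x)" for x by (simp add: min_def abs_if)
  then have "(\<integral>x. \<bar>f x - 1\<bar> \<partial>P) = (\<integral>x. f x + 1 - 2 * min 1 (f x) \<partial>P)" by simp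
  also have "\<dots> = 2 - 2 * (\<integral>x. min 1 (f x) \<partial>P)" using if1 im E prob_space by simp
  finally have *: "(\<integral>x. \<bar>f x - 1\<bar> \<partial>P) = 2 - 2 * (\<integral>x. min 1 (f x) \<partial>P)" .
  show "2 - 2 * a \<le> (\<integral>x. \<bar>f x - 1\<bar> \<partial>P)" unfolding * using A by simp
  have "0 \<le> (\<integral>x. min 1 (f x) \<partial>P)" using f(2) by (intro integral_nonneg_AE) simp
  then show "(\<integral>x. \<bar>f x - 1\<bar> \<partial>P) \<le> 2" unfolding * by simp
qed

text \<open>A Chernoff bound on the total variation affinity: both errors of the test based on \<open>g\<close>
  are balanced by rescaling \<open>g\<close> by \<open>sqrt (b / a)\<close>.\<close>

lemma affinity_le:
  fixes f g :: "'a \<Rightarrow> real"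
  assumes f: "f \<in> borel_measurable P" "\<And>x. f x \<ge> 0" and g: "g \<in> borel_measurable P" "\<And>x. g x > 0"
    and a: "(\<integral>\<^sup>+x. ennreal (g x) \<partial>P) \<le> ennreal a" "0 < a"
    and b: "(\<integral>\<^sup>+x. ennreal (f x * (1 / g x)) \<partial>P) \<le> ennreal b" "0 < b"
  shows "(\<integral>\<^sup>+x. ennreal (min 1 (f x)) \<partial>P) \<le> ennreal (sqrt (a * b))"
proof -
  note [measurable] = f(1) g(1)
  define k where "k = sqrt (b / a)"
  have k: "k > 0" "k * a = sqrt (a * b)" "b / k = sqrt (a * b)"
    using a(2) b(2) by (auto simp: k_def real_sqrt_divide real_sqrt_mult field_simps)
  have pt: "min 1 (f x) \<le> k / 2 * g x + 1 / (2 * k) * (f x * (1 / g x))" for x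
  proof -
    define y where "y = k * g x"
    have y: "y > 0" using k g(2) by (simp add: y_def)
    have "2 \<le> y + 1 / y"
    proof -
      have "0 \<le> (y - 1)\<^sup>2 / y" using y by simp
      also have "(y - 1)\<^sup>2 / y = y + 1 / y - 2" using y by (simp add: power2_eq_square field_simps)
      finally show ?thesis by simp
    qed
    \<comment> \<open>The minimum is bounded by 1 where it multiplies y and by f where it multiplies
      1 / y.\<close>
    then have "min 1 (f x) * 2 \<le> min 1 (f x) * (y + 1 / y)" using f(2) by (intro mult_left_mono) auto
    also have "\<dots> \<le> 1 * y + f x * (1 / y)" unfolding distrib_left using y by (intro add_mono mult_right_mono) auto
    finally show ?thesis using k(1) g(2)[of x] by (simp add: y_def field_simps)
  qed
  have "(\<integral>\<^sup>+x. ennreal (min 1 (f x)) \<partial>P) \<le> (\<integral>\<^sup>+x. ennreal (k / 2) * ennreal (g x) + ennreal (1 / (2 * k)) * ennreal (f x * (1 / g x)) \<partial>P)"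
  proof (intro nn_integral_mono)
    fix x
    have "ennreal (min 1 (f x)) \<le> ennreal (k / 2 * g x + 1 / (2 * k) * (f x * (1 / g x)))" by (rule ennreal_leI[OF pt])
    also have "\<dots> = ennreal (k / 2 * g x) + ennreal (1 / (2 * k) * (f x * (1 / g x)))"
      using k(1) g(2)[of x] f(2)[of x] by (intro ennreal_plus) auto
    also have "\<dots> = ennreal (k / 2) * ennreal (g x) + ennreal (1 / (2 * k)) * ennreal (f x * (1 / g x))"
      using k(1) by (simp only: ennreal_mult' divide_nonneg_nonneg less_imp_le zero_le_numeral zero_le_one mult_nonneg_nonneg)
    finally show "ennreal (min 1 (f x)) \<le> \<dots>" .
  qed
  also have "\<dots> = ennreal (k / 2) * (\<integral>\<^sup>+x. ennreal (g x) \<partial>P) + ennreal (1 / (2 * k)) * (\<integral>\<^sup>+x. ennreal (f x * (1 / g x)) \<partial>P)"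
    by (subst nn_integral_add, measurable, subst nn_integral_cmult, measurable, subst nn_integral_cmult, measurable)
  also have "\<dots> \<le> ennreal (k / 2) * ennreal a + ennreal (1 / (2 * k)) * ennreal b"
    by (intro add_mono mult_left_mono a b) auto
  also have "\<dots> = ennreal (k / 2 * a + 1 / (2 * k) * b)"
    using k(1) a(2) b(2) by (simp add: ennreal_mult'[symmetric] ennreal_plus[symmetric] del: ennreal_plus)
  also have "k / 2 * a + 1 / (2 * k) * b = sqrt (a * b)"
  proof -
    have "k / 2 * a + 1 / (2 * k) * b = (k * a + b / k) / 2" using k(1) by (simp add: field_simps)
    then show ?thesis using k by simp
  qed
  finally show ?thesis .
qed

section \<open>Bounds for fixed sample size\<close>

lemma frob_cross_commute: "frob_cross m k l A B = frob_cross m l k B A"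
  unfolding frob_cross_def by (subst sum.swap) (simp add: dotp_commute)

lemma frob_cross_nonneg [simp]: "frob_cross m k l A B \<ge> 0"
  unfolding frob_cross_def by (intro sum_nonneg) simp

lemma nn_integral_restrict_le:
  assumes "G \<in> sets M" "\<And>x. x \<in> G \<Longrightarrow> f x \<le> g x"
  shows "(\<integral>\<^sup>+x. f x \<partial>restrict_space M G) \<le> (\<integral>\<^sup>+x. g x \<partial>M)"
proof -
  have "(\<integral>\<^sup>+x. f x \<partial>restrict_space M G) = (\<integral>\<^sup>+x. f x * indicator G x \<partial>M)"
    using assms(1) by (intro nn_integral_restrict_space) auto
  also have "\<dots> \<le> (\<integral>\<^sup>+x. g x \<partial>M)"
    using assms(2) by (intro nn_integral_mono) (auto split: split_indicator)
  finally show ?thesis .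
qed

lemma diff_le_of_le_add_ennreal:
  assumes "ennreal a \<le> I + ennreal e" "0 \<le> e"
  shows "ennreal (a - e) \<le> I"
proof (cases I)
  case (real i)
  then have "ennreal a \<le> ennreal (i + e)" using assms by simp
  then have "a \<le> i + e" using real(1) assms(2) by (subst (asm) ennreal_le_iff) simp_all
  then show ?thesis using real by (simp add: ennreal_leI)
qed simp

lemma nulls_exp_sq_norm:
  assumes "l < 1 / 2"
  shows "(\<integral>\<^sup>+x. ennreal (exp (l * (\<Sum>i<n. dotp p (x i) (x i)))) \<partial>nulls n p) = ennreal ((1 / sqrt (1 - 2 * l) ^ p) ^ n)"
proof -
  note [measurable] = dotp_self_measurable_gauss
  have "(\<integral>\<^sup>+x. ennreal (exp (l * (\<Sum>i<n. dotp p (x i) (x i)))) \<partial>nulls n p) =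
    (\<integral>\<^sup>+x. (\<Prod>i<n. ennreal (exp (l * dotp p (x i) (x i)))) \<partial>nulls n p)"
    by (simp add: sum_distrib_left exp_sum prod_ennreal)
  also have "\<dots> = (\<integral>\<^sup>+z. ennreal (exp (l * dotp p z z)) \<partial>gauss p) ^ n"
    by (rule nulls_prod) measurable
  finally show ?thesis using assms by (simp add: nn_integral_gauss_exp_sq_norm ennreal_power)
qed

text \<open>Multiplying the null moments at l and -l cancels the first order: (1 - 2 l) (1 + 2 l) =
  1 - 4 l^2. The cost of the Chernoff bound is therefore quadratic in l, against a linear
  gain.\<close>

lemma damping_product_le:
  assumes l: "0 \<le> l" "l \<le> 1 / 4"
  shows "(1 / sqrt (1 - 2 * l) ^ p) ^ n * (1 / sqrt (1 + 2 * l) ^ p) ^ n \<le> exp (4 * l\<^sup>2 * real p * real n)"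
proof -
  let ?x = "4 * l\<^sup>2"
  have "l\<^sup>2 \<le> (1 / 4)\<^sup>2" using l by (intro power_mono) auto
  then have x: "0 \<le> ?x" "?x \<le> 1 / 2" by (auto simp: power2_eq_square)
  have x1: "1 / 2 < (1 :: real)" by simp
  have "sqrt (1 - 2 * l) * sqrt (1 + 2 * l) = sqrt (1 - ?x)"
    by (simp add: real_sqrt_mult[symmetric] power2_eq_square algebra_simps)
  then have "(1 / sqrt (1 - 2 * l) ^ p) ^ n * (1 / sqrt (1 + 2 * l) ^ p) ^ n = (1 / sqrt (1 - ?x)) ^ (p * n)"
    by (simp add: power_mult power_divide power_mult_distrib[symmetric])
  also have "\<dots> \<le> exp ?x ^ (p * n)"
  proof (rule power_mono)
    have "?x / (1 - ?x) / 2 \<le> ?x"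
    proof -
      have "?x \<le> 2 * ?x * (1 - ?x)" using mult_left_mono[of "1 / 2" "1 - ?x" "2 * ?x"] x by simp
      then show ?thesis using x by (simp add: field_simps)
    qed
    then show "1 / sqrt (1 - ?x) \<le> exp ?x"
      using inverse_sqrt_bounds(2)[OF x(1)] x(2) by (meson exp_le_cancel_iff le_less_trans order_trans x1)
  qed (use x in simp)
  also have "\<dots> = exp (4 * l\<^sup>2 * real p * real n)"
    by (simp add: exp_of_nat_mult[symmetric] mult_ac)
  finally show ?thesis .
qed

lemma inverse_sqrt_one_plus_le:
  assumes "0 \<le> u" "u \<le> (1::real)"
  shows "1 / sqrt (1 + u) \<le> exp (- u / 4)"
proof -
  have "1 - u / 2 \<le> exp (- u / 2)" using exp_ge_add_one_self[of "- u / 2"] by simp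
  then have "(1 + u) * (1 - u / 2) \<le> (1 + u) * exp (- u / 2)" using assms by (intro mult_left_mono) auto
  moreover have "1 \<le> (1 + u) * (1 - u / 2)"
  proof -
    have "u * u \<le> u * 1" using assms by (intro mult_left_mono) auto
    then show ?thesis by (simp add: algebra_simps)
  qed
  ultimately have "1 \<le> (1 + u) * exp (- u / 2)"
    by linarith
  then have "1 / (1 + u) \<le> exp (- u / 2)" using assms by (simp add: field_simps)
  then have "sqrt (1 / (1 + u)) \<le> sqrt (exp (- u / 2))" by (rule real_sqrt_le_mono)
  then show ?thesis by (simp add: sqrt_exp real_sqrt_divide)
qed

context uniform_stiefel
begin

lemma fam_ok_stiefel:
  assumes "d \<ge> 0"
  shows "fam_ok U p r (mat_fam d) d"
  unfolding fam_ok_def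
proof (intro conjI allI impI ballI)
  show "finite_measure U" by (rule U.finite_measure_axioms)
  show "(\<lambda>Q. mat_fam d Q j i) \<in> borel_measurable U" if "i < p" "j < r" for i j
    unfolding mat_fam_def using measurable_entry[OF that] by measurable
  show "op_bounded p r (mat_fam d Q) d" if "Q \<in> space U" for Q
    using op_bounded_mat_fam[OF op_bounded_stiefel, of Q d] that assms by (simp add: space_U)
qed

section \<open>Both models at a fixed sample size, with a common operator bound \<eta>\<close>

context
  fixes n :: nat and d \<eta> :: real
  assumes p0: "0 < p" and d: "0 < d" "d \<le> \<eta>" and \<eta>: "\<eta> \<le> 1 / 64" and np: "n \<le> p"
begin

definition "lr_spiked = mixlr n p r U (mat_fam d)"
definition "cc = d / real p"
text \<open>Chosen in the model so that \<open>cc * tt\<^sup>2\<close> is 1/4: the truncated family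
  stays well away from singularity, but not small enough for the cross bounds.\<close>

definition "tt = 1 / 2 * sqrt (real p / d)"
definition "lr_proxy = mixlr n p r (gz p r) (tfam p r cc tt)"
text \<open>After scaling by sqrt cc, matrices in this set have squared operator norm at most
  \<eta>.\<close>

definition "Z_good = good_set p r (\<eta> / cc)"
definition "Z_bad = space (gz p r) - Z_good"
definition "lr_good = mixlr n p r (restrict_space (gz p r) Z_good) (tfam p r cc tt)"
definition "lr_bad = mixlr n p r (restrict_space (gz p r) Z_bad) (tfam p r cc tt)"
definition "mm = real n * d\<^sup>2 * (real r)\<^sup>2 / real p"
text \<open>A single loss factor: it is the one in the cross bounds and dominates the factor 1 / (1
  - 2 \<eta>) of the other Gaussian estimates.\<close>

definition "kk = 1 / (1 - 4 * \<eta>)"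
text \<open>A bound for the mass of \<open>Z_bad\<close>. The added 1 keeps it positive, so that one
  may divide by its square root.\<close>

definition "pb = 320 * (real r + 1) * d\<^sup>2 / \<eta>\<^sup>2"

lemma basic: "cc > 0" "tt \<ge> 0" "cc * tt\<^sup>2 = 1 / 4" "\<eta> > 0" "\<eta> \<le> cc * tt\<^sup>2" "\<eta> < 1 / 2" "\<eta> \<le> 1 / 16" "1 \<le> kk" "kk \<le> 2" "pb > 0" "mm \<ge> 0"
  "1 / (1 - 2 * \<eta>) \<le> kk"
proof -
  show c: "cc > 0" using d p0 by (simp add: cc_def)
  show "tt \<ge> 0" using d by (simp add: tt_def)
  show ct: "cc * tt\<^sup>2 = 1 / 4" using d p0 by (simp add: cc_def tt_def power_mult_distrib power_divide)
  show e: "\<eta> > 0" using d by simp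
  show "\<eta> \<le> cc * tt\<^sup>2" using ct \<eta> by simp
  show "\<eta> < 1 / 2" "\<eta> \<le> 1 / 16" using \<eta> by auto
  show "1 \<le> kk" using e \<eta> by (simp add: kk_def)
  show "kk \<le> 2" using e \<eta> by (simp add: kk_def field_simps)
  show "pb > 0" using d e by (simp add: pb_def add_nonneg_pos)
  show "mm \<ge> 0" using d by (simp add: mm_def)
  show "1 / (1 - 2 * \<eta>) \<le> kk" unfolding kk_def using e \<eta> by (intro divide_left_mono mult_pos_pos) auto
qed

lemma Z_good_sets: "Z_good \<in> sets (gz p r)" "Z_bad \<in> sets (gz p r)"
  unfolding Z_good_def Z_bad_def by auto

lemma ok_lr_proxy: "fam_ok (gz p r) p r (tfam p r cc tt) (1 / 4)"
  using fam_ok_tfam[of tt cc p r] basic by simp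

lemma tfam_Z_good:
  assumes "z \<in> Z_good"
  shows "op_bounded p r (tfam p r cc tt z) \<eta>" "op_bounded p r (zfam z) (\<eta> / cc)"
    "frob_cross p r l (tfam p r cc tt z) B = cc * frob_cross p r l (zfam z) B"
    "fnorm2 p r (tfam p r cc tt z) = cc * fnorm2 p r (zfam z)"
proof -
  note g = tfam_good[OF basic(1,2,5) less_imp_le[OF basic(4)] assms[unfolded Z_good_def]]
  show "op_bounded p r (tfam p r cc tt z) \<eta>" "op_bounded p r (zfam z) (\<eta> / cc)" by (fact g(1), fact g(3))
  have "frob_cross p r l (tfam p r cc tt z) B = frob_cross p r l (\<lambda>j i. sqrt cc * zfam z j i) (\<lambda>j i. 1 * B j i)"
    by (rule frob_cross_cong) (simp_all add: g(2))
  then show "frob_cross p r l (tfam p r cc tt z) B = cc * frob_cross p r l (zfam z) B"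
    unfolding frob_cross_scale using basic(1) by simp
  have "fnorm2 p r (tfam p r cc tt z) = fnorm2 p r (\<lambda>j i. sqrt cc * zfam z j i)"
    by (rule fnorm2_cong) (simp add: g(2))
  then show "fnorm2 p r (tfam p r cc tt z) = cc * fnorm2 p r (zfam z)"
    unfolding fnorm2_scale using basic(1) by simp
qed

lemma ok_lr_good: "fam_ok (restrict_space (gz p r) Z_good) p r (tfam p r cc tt) \<eta>"
  by (rule fam_ok_restrict[OF ok_lr_proxy Z_good_sets(1) tfam_Z_good(1)])

lemma ok_lr_bad: "fam_ok (restrict_space (gz p r) Z_bad) p r (tfam p r cc tt) (1 / 4)"
  by (rule fam_ok_restrict[OF ok_lr_proxy Z_good_sets(2)]) (use fam_okD(3)[OF ok_lr_proxy] in \<open>auto simp: Z_bad_def\<close>)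

lemma ok_lr_spiked: "fam_ok U p r (mat_fam d) \<eta>"
proof -
  have "fam_ok U p r (mat_fam d) d" using fam_ok_stiefel d by simp
  then show ?thesis using op_bounded_mono[OF _ d(2)] unfolding fam_ok_def by blast
qed

lemma bad_mass: "emeasure (gz p r) Z_bad \<le> ennreal pb"
proof -
  have c: "\<eta> / cc > 0" using basic by simp
  have "emeasure (gz p r) Z_bad \<le> ennreal (320 * real r * (real p)\<^sup>2 / (\<eta> / cc)\<^sup>2)"
    unfolding Z_bad_def Z_good_def by (rule bad_set_measure[OF rp c])
  also have "320 * real r * (real p)\<^sup>2 / (\<eta> / cc)\<^sup>2 = 320 * real r * d\<^sup>2 / \<eta>\<^sup>2"
    using p0 d by (simp add: cc_def power_divide power_mult_distrib)
  also have "ennreal (320 * real r * d\<^sup>2 / \<eta>\<^sup>2) \<le> ennreal pb"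
    unfolding pb_def by (intro ennreal_leI divide_right_mono mult_right_mono) auto
  finally show ?thesis .
qed

lemma nn_lr_bad: "(\<integral>\<^sup>+x. ennreal (lr_bad x) \<partial>nulls n p) \<le> ennreal pb"
proof -
  have "(\<integral>\<^sup>+x. ennreal (lr_bad x) \<partial>nulls n p) = emeasure (restrict_space (gz p r) Z_bad) (space (restrict_space (gz p r) Z_bad))"
    unfolding lr_bad_def by (rule nn_integral_mixlr[OF ok_lr_bad]) auto
  also have "\<dots> = emeasure (gz p r) Z_bad"
    using Z_good_sets(2) sets.sets_into_space[OF Z_good_sets(2)] by (simp add: emeasure_restrict_space space_restrict_space Int_absorb2)
  finally show ?thesis using bad_mass by simp
qed

lemma lr_proxy_split: "x \<in> space (nulls n p) \<Longrightarrow> lr_proxy x = lr_good x + lr_bad x"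
  unfolding lr_proxy_def lr_good_def lr_bad_def Z_bad_def by (rule mixlr_split[OF ok_lr_proxy _ _ Z_good_sets(1)]) auto

lemma nn_lr_spiked: "(\<integral>\<^sup>+x. ennreal (lr_spiked x) \<partial>nulls n p) = 1"
  unfolding lr_spiked_def using nn_integral_mixlr[OF ok_lr_spiked] basic U.emeasure_space_1 by simp

lemma nn_lr_proxy: "(\<integral>\<^sup>+x. ennreal (lr_proxy x) \<partial>nulls n p) = 1"
  unfolding lr_proxy_def using nn_integral_mixlr[OF ok_lr_proxy, of n] prob_space.emeasure_space_1[OF prob_space_gz] by simp

lemma meas: "lr_spiked \<in> borel_measurable (nulls n p)" "lr_proxy \<in> borel_measurable (nulls n p)"
   "lr_good \<in> borel_measurable (nulls n p)" "lr_bad \<in> borel_measurable (nulls n p)"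
  unfolding lr_spiked_def lr_proxy_def lr_good_def lr_bad_def
  by (rule measurable_mixlr[OF ok_lr_spiked] measurable_mixlr[OF ok_lr_proxy] measurable_mixlr[OF ok_lr_good] measurable_mixlr[OF ok_lr_bad])+

lemma nonneg: "lr_spiked x \<ge> 0" "lr_proxy x \<ge> 0" "lr_good x \<ge> 0" "lr_bad x \<ge> 0"
  by (simp_all add: lr_spiked_def lr_proxy_def lr_good_def lr_bad_def)

text \<open>The smallness that keeps all rescaled forms under the operator bound in the moment
  estimates; the slack comes from \<eta> \<le> 1 / 64.\<close>

lemma kd: "kk * d \<le> 1" "kk * d\<^sup>2 \<le> \<eta>" "kk\<^sup>2 * d\<^sup>2 \<le> \<eta>"
proof -
  have d64: "d \<le> 1 / 64" using d \<eta> by simp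
  have "kk * d \<le> 2 * (1 / 64)" using basic d d64 by (intro mult_mono) auto
  then have k: "kk * d \<le> 1 / 32" by simp
  then show "kk * d \<le> 1" by simp
  have "(kk * d) * d \<le> 1 * \<eta>" using k d basic by (intro mult_mono) auto
  then show "kk * d\<^sup>2 \<le> \<eta>" by (simp add: power2_eq_square mult.assoc)
  have "(kk * (kk * d)) * d \<le> 1 * \<eta>"
  proof (intro mult_mono)
    have "kk * (kk * d) \<le> 2 * (1 / 32)" using k basic d by (intro mult_mono) auto
    then show "kk * (kk * d) \<le> 1" by simp
  qed (use d basic in auto)
  then show "kk\<^sup>2 * d\<^sup>2 \<le> \<eta>" by (simp add: power2_eq_square mult_ac)
qed

lemma lr_spiked_second_moment: "(\<integral>\<^sup>+x. ennreal (lr_spiked x * lr_spiked x) \<partial>nulls n p) \<le> ennreal (exp (kk ^ 3 * mm / 2))"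
proof -
  let ?S = "real n * d\<^sup>2 * kk"
  have S: "0 \<le> ?S" "?S / real p \<le> \<eta>" "\<eta> < 1 / 2"
  proof -
    show "0 \<le> ?S" using basic by simp
    have "?S / real p = (real n / real p) * (kk * d\<^sup>2)" by simp
    also have "\<dots> \<le> 1 * \<eta>" using np p0 kd basic by (intro mult_mono) auto
    finally show "?S / real p \<le> \<eta>" by simp
  qed (use basic in simp)
  have fr: "frob_cross p r r (mat_fam d A) (mat_fam d Q) = d\<^sup>2 * frob_cross p r r (qf A) (qf Q)" for A Q
    unfolding mat_fam_eq frob_cross_scale using d by (simp add: power2_eq_square)
  have "(\<integral>\<^sup>+x. ennreal (lr_spiked x * lr_spiked x) \<partial>nulls n p) \<le>
    (\<integral>\<^sup>+A. (\<integral>\<^sup>+Q. ennreal (exp (real n * frob_cross p r r (mat_fam d A) (mat_fam d Q) / (1 - 4 * \<eta>) / 2)) \<partial>U) \<partial>U)"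
    unfolding lr_spiked_def by (rule nn_integral_mixlr_cross(2)[OF ok_lr_spiked ok_lr_spiked]) (use basic in auto)
  also have "\<dots> = (\<integral>\<^sup>+A. (\<integral>\<^sup>+Q. ennreal (exp (?S * frob_cross p r r (qf A) (qf Q) / 2)) \<partial>U) \<partial>U)"
    unfolding fr kk_def by (simp add: mult_ac)
  also have "\<dots> \<le> (\<integral>\<^sup>+A. ennreal (exp (?S * (real r)\<^sup>2 / real p / (1 - 2 * \<eta>) / 2)) \<partial>U)"
    by (intro nn_integral_mono cross_upper_bound[OF S]) (simp add: space_U)
  also have "\<dots> = ennreal (exp (?S * (real r)\<^sup>2 / real p / (1 - 2 * \<eta>) / 2))"
    using U.emeasure_space_1 by simp
  also have "\<dots> \<le> ennreal (exp (kk ^ 3 * mm / 2))"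
  proof (intro ennreal_leI, unfold exp_le_cancel_iff, intro divide_right_mono)
    have "?S * (real r)\<^sup>2 / real p / (1 - 2 * \<eta>) = (kk * mm) * (1 / (1 - 2 * \<eta>))" by (simp add: mm_def)
    also have "\<dots> \<le> (kk * mm) * (kk * kk)"
    proof (rule mult_left_mono)
      \<comment> \<open>The second loss is weakened to kk^2, so that both second moments are bounded
        by the same expression with kk^3.\<close>
      have "kk * 1 \<le> kk * kk" using basic by (intro mult_left_mono) auto
      then show "1 / (1 - 2 * \<eta>) \<le> kk * kk" using basic(12) by linarith
    qed (use basic in simp)
    finally show "?S * (real r)\<^sup>2 / real p / (1 - 2 * \<eta>) \<le> kk ^ 3 * mm" by (simp add: power3_eq_cube mult_ac)
  qed simp
  finally show ?thesis .
qed

text \<open>Two Gaussian integrations: over y with z fixed, which leaves a multiple of |z|^2, and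
  then over z against the identity. The three factors kk come from the cross bound and from these
  two integrations.\<close>

lemma lr_good_second_moment: "(\<integral>\<^sup>+x. ennreal (lr_good x * lr_good x) \<partial>nulls n p) \<le> ennreal (exp (kk ^ 3 * mm / 2))"
proof -
  let ?R = "restrict_space (gz p r) Z_good"
  let ?s = "real n * kk * cc\<^sup>2"
  let ?u = "real r * ?s * kk"
  have s0: "0 \<le> ?s" using basic by simp
  have sp: "space ?R = Z_good" using sets.sets_into_space[OF Z_good_sets(1)] by (simp add: space_restrict_space Int_absorb2)
  have se: "?s * (\<eta> / cc) \<le> \<eta>"
  proof -
    have "?s * (\<eta> / cc) = (real n / real p) * ((kk * d) * \<eta>)" using basic(1) by (simp add: power2_eq_square) (simp add: cc_def)
    also have "\<dots> \<le> 1 * (1 * \<eta>)" using np p0 kd(1) basic d by (intro mult_mono) auto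
    finally show ?thesis by simp
  qed
  have u0: "0 \<le> ?u" using basic by simp
  have u1: "?u * 1 \<le> \<eta>"
  proof -
    have "?u = (real r / real p) * ((real n / real p) * (kk\<^sup>2 * d\<^sup>2))" by (simp add: cc_def power2_eq_square)
    also have "\<dots> \<le> 1 * (1 * \<eta>)" using np rp p0 kd(3) basic by (intro mult_mono) auto
    finally show ?thesis by simp
  qed
  have "(\<integral>\<^sup>+x. ennreal (lr_good x * lr_good x) \<partial>nulls n p) \<le>
    (\<integral>\<^sup>+z. (\<integral>\<^sup>+y. ennreal (exp (real n * frob_cross p r r (tfam p r cc tt z) (tfam p r cc tt y) / (1 - 4 * \<eta>) / 2)) \<partial>?R) \<partial>?R)"
    unfolding lr_good_def by (rule nn_integral_mixlr_cross(2)[OF ok_lr_good ok_lr_good]) (use basic in auto)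
  also have "\<dots> \<le> (\<integral>\<^sup>+z. ennreal (exp (?u * frob_cross p r p (zfam z) idf / 2)) \<partial>gz p r)"
  proof (rule nn_integral_restrict_le[OF Z_good_sets(1)])
    fix z assume z: "z \<in> Z_good"
    have "(\<integral>\<^sup>+y. ennreal (exp (real n * frob_cross p r r (tfam p r cc tt z) (tfam p r cc tt y) / (1 - 4 * \<eta>) / 2)) \<partial>?R) \<le>
      (\<integral>\<^sup>+y. ennreal (exp (?s * frob_cross p r r (zfam y) (zfam z) / 2)) \<partial>gz p r)"
    \<comment> \<open>The restriction on y is dropped, which is harmless for an upper bound. The
      restriction on z supplies the operator bound for the inner integral.\<close>
    proof (rule nn_integral_restrict_le[OF Z_good_sets(1)])
      fix y assume y: "y \<in> Z_good"
      have "frob_cross p r r (tfam p r cc tt z) (tfam p r cc tt y) = cc * (cc * frob_cross p r r (zfam y) (zfam z))"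
        unfolding tfam_Z_good(3)[OF z] frob_cross_commute[of p r r "zfam z"] tfam_Z_good(3)[OF y] ..
      then have "real n * frob_cross p r r (tfam p r cc tt z) (tfam p r cc tt y) / (1 - 4 * \<eta>) / 2 = ?s * frob_cross p r r (zfam y) (zfam z) / 2"
        by (simp add: kk_def power2_eq_square)
      then show "ennreal (exp (real n * frob_cross p r r (tfam p r cc tt z) (tfam p r cc tt y) / (1 - 4 * \<eta>) / 2)) \<le>
        ennreal (exp (?s * frob_cross p r r (zfam y) (zfam z) / 2))" by simp
    qed
    also have "\<dots> \<le> ennreal (exp (real r * ?s * fnorm2 p r (zfam z) / (1 - 2 * \<eta>) / 2))"
      by (rule gauss_frob_bounds(2)[OF tfam_Z_good(2)[OF z] s0 _ se basic(6)]) (use basic in simp)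
    also have "\<dots> \<le> ennreal (exp (?u * frob_cross p r p (zfam z) idf / 2))"
    proof (intro ennreal_leI, unfold exp_le_cancel_iff, intro divide_right_mono)
      have "real r * ?s * fnorm2 p r (zfam z) / (1 - 2 * \<eta>) = (real r * ?s * fnorm2 p r (zfam z)) * (1 / (1 - 2 * \<eta>))" by simp
      also have "\<dots> \<le> (real r * ?s * fnorm2 p r (zfam z)) * kk" using basic(12) s0 by (intro mult_left_mono) auto
      finally show "real r * ?s * fnorm2 p r (zfam z) / (1 - 2 * \<eta>) \<le> ?u * frob_cross p r p (zfam z) idf"
        by (simp add: frob_cross_idf mult_ac)
    qed simp
    finally show "(\<integral>\<^sup>+y. ennreal (exp (real n * frob_cross p r r (tfam p r cc tt z) (tfam p r cc tt y) / (1 - 4 * \<eta>) / 2)) \<partial>?R) \<le>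
      ennreal (exp (?u * frob_cross p r p (zfam z) idf / 2))" .
  qed
  also have "\<dots> \<le> ennreal (exp (real r * ?u * fnorm2 p p idf / (1 - 2 * \<eta>) / 2))"
    by (rule gauss_frob_bounds(2)[OF op_bounded_idf u0 _ u1 basic(6)]) simp
  also have "\<dots> \<le> ennreal (exp (kk ^ 3 * mm / 2))"
  proof (intro ennreal_leI, unfold exp_le_cancel_iff, intro divide_right_mono)
    have "real r * ?u * fnorm2 p p idf / (1 - 2 * \<eta>) = (real r * ?u * real p) * (1 / (1 - 2 * \<eta>))" by (simp add: fnorm2_idf)
    also have "\<dots> \<le> (real r * ?u * real p) * kk" using basic(12) u0 by (intro mult_left_mono) auto
    also have "\<dots> = kk ^ 3 * mm" using p0 by (simp add: mm_def cc_def power2_eq_square power3_eq_cube)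
    finally show "real r * ?u * fnorm2 p p idf / (1 - 2 * \<eta>) \<le> kk ^ 3 * mm" .
  qed simp
  finally show ?thesis .
qed

text \<open>Here a lower bound is wanted, so dropping the bad event costs something. The loss is
  controlled by Cauchy-Schwarz in additive form, from the moment with doubled exponent and the mass
  of \<open>Z_bad\<close>.\<close>

lemma cross_moment: "ennreal (exp (mm / 2) - sqrt pb / 2 * (exp (kk * mm) + 1)) \<le> (\<integral>\<^sup>+x. ennreal (lr_spiked x * lr_good x) \<partial>nulls n p)"
proof -
  let ?R = "restrict_space (gz p r) Z_good"
  let ?s = "real n * d * cc"
  \<comment> \<open>The weight in x \<le> \<theta> x^2 / 2 + 1 / (2 \<theta>); with this value the
    mass term pb / (2 \<theta>) equals \<theta> / 2.\<close>
  let ?\<theta> = "sqrt pb"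
  let ?w = "exp (mm / 2) - ?\<theta> / 2 * (exp (kk * mm) + 1)"
  have \<theta>: "?\<theta> > 0" using basic by simp
  have s0: "0 \<le> ?s" using basic d by simp
  \<comment> \<open>The factor 2 prepares for the doubled exponent in the moment over the bad
    event.\<close>
  have s2: "2 * ?s * 1 \<le> \<eta>"
  proof -
    have "?s = (real n / real p) * (d * d)" by (simp add: cc_def)
    also have "\<dots> \<le> 1 * (1 / 64 * \<eta>)" using np p0 d \<eta> by (intro mult_mono) auto
    finally show ?thesis using basic(4) by simp
  qed
  have s1: "?s * 1 \<le> \<eta>" using s2 s0 by simp
  have rs: "real r * ?s * real r = mm" by (simp add: mm_def cc_def power2_eq_square)
  have inner: "ennreal ?w \<le> (\<integral>\<^sup>+z. ennreal (exp (real n * frob_cross p r r (mat_fam d Q) (tfam p r cc tt z) / 2)) \<partial>?R)"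
    if "Q \<in> space U" for Q
  proof -
    have Q: "Q \<in> stiefel p r" using that by (simp add: space_U)
    note oq = op_bounded_stiefel[OF Q] and fq = fnorm2_stiefel[OF Q]
    let ?F = "\<lambda>z. frob_cross p r r (zfam z) (qf Q)"
    note [measurable] = measurable_frob_cross_zfam Z_good_sets
    define I where "I = (\<integral>\<^sup>+z. ennreal (exp (?s * ?F z / 2)) * indicator Z_good z \<partial>gz p r)"
    have "ennreal (exp (mm / 2)) \<le> (\<integral>\<^sup>+z. ennreal (exp (?s * ?F z / 2)) \<partial>gz p r)"
      using gauss_frob_bounds(1)[OF oq s0 _ s1 basic(6), of r] unfolding fq rs by simp
    also have "\<dots> \<le> (\<integral>\<^sup>+z. ennreal (exp (?s * ?F z / 2)) * indicator Z_good z +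
       (ennreal (?\<theta> / 2) * ennreal (exp (2 * ?s * ?F z / 2)) + ennreal (1 / (2 * ?\<theta>)) * indicator Z_bad z) \<partial>gz p r)"
    proof (rule nn_integral_mono)
      fix z assume z: "z \<in> space (gz p r)"
      show "ennreal (exp (?s * ?F z / 2)) \<le> ennreal (exp (?s * ?F z / 2)) * indicator Z_good z +
       (ennreal (?\<theta> / 2) * ennreal (exp (2 * ?s * ?F z / 2)) + ennreal (1 / (2 * ?\<theta>)) * indicator Z_bad z)"
      proof (cases "z \<in> Z_good")
        case True
        then show ?thesis by simp
      next
        case False
        then have Z_bad: "z \<in> Z_bad" using z by (simp add: Z_bad_def)
        let ?x = "exp (?s * ?F z / 2)"
        have x2: "exp (2 * ?s * ?F z / 2) = ?x\<^sup>2" by (simp add: power2_eq_square flip: exp_add)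
        have "0 \<le> (?\<theta> * ?x - 1)\<^sup>2 / (2 * ?\<theta>)" using \<theta> by simp
        also have "\<dots> = ?\<theta> / 2 * ?x\<^sup>2 + 1 / (2 * ?\<theta>) - ?x" using \<theta> by (simp add: power2_eq_square field_simps)
        finally have "?x \<le> ?\<theta> / 2 * exp (2 * ?s * ?F z / 2) + 1 / (2 * ?\<theta>)" unfolding x2 by simp
        then have "ennreal ?x \<le> ennreal (?\<theta> / 2 * exp (2 * ?s * ?F z / 2) + 1 / (2 * ?\<theta>))" by (rule ennreal_leI)
        also have "\<dots> = ennreal (?\<theta> / 2) * ennreal (exp (2 * ?s * ?F z / 2)) + ennreal (1 / (2 * ?\<theta>))"
          using \<theta> by (subst ennreal_plus, simp, simp, subst ennreal_mult'[of "?\<theta> / 2"]) simp_all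
        finally show ?thesis using False Z_bad by simp
      qed
    qed
    also have "\<dots> = I + (ennreal (?\<theta> / 2) * (\<integral>\<^sup>+z. ennreal (exp (2 * ?s * ?F z / 2)) \<partial>gz p r) + ennreal (1 / (2 * ?\<theta>)) * emeasure (gz p r) Z_bad)"
      unfolding I_def
      by (subst nn_integral_add, measurable, subst nn_integral_add, measurable, subst nn_integral_cmult, measurable, subst nn_integral_cmult_indicator, measurable)
    also have "\<dots> \<le> I + (ennreal (?\<theta> / 2) * ennreal (exp (kk * mm)) + ennreal (1 / (2 * ?\<theta>)) * ennreal pb)"
    proof (intro add_mono mult_left_mono bad_mass order_refl)
      have "(\<integral>\<^sup>+z. ennreal (exp (2 * ?s * ?F z / 2)) \<partial>gz p r) \<le> ennreal (exp (real r * (2 * ?s) * fnorm2 p r (qf Q) / (1 - 2 * \<eta>) / 2))"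
        using gauss_frob_bounds(2)[OF oq _ _ s2 basic(6), of r] s0 by simp
      also have "real r * (2 * ?s) * fnorm2 p r (qf Q) = 2 * mm" unfolding fq rs[symmetric] by simp
      also have "ennreal (exp (2 * mm / (1 - 2 * \<eta>) / 2)) \<le> ennreal (exp (kk * mm))"
      proof (intro ennreal_leI, unfold exp_le_cancel_iff)
        have "2 * mm / a / 2 = mm * (1 / a)" for a :: real by simp
        then have "2 * mm / (1 - 2 * \<eta>) / 2 = mm * (1 / (1 - 2 * \<eta>))" .
        also have "\<dots> \<le> mm * kk" using basic by (intro mult_left_mono) auto
        finally show "2 * mm / (1 - 2 * \<eta>) / 2 \<le> kk * mm" by (simp add: mult.commute)
      qed
      finally show "(\<integral>\<^sup>+z. ennreal (exp (2 * ?s * ?F z / 2)) \<partial>gz p r) \<le> ennreal (exp (kk * mm))" .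
    qed simp_all
    also have "ennreal (?\<theta> / 2) * ennreal (exp (kk * mm)) + ennreal (1 / (2 * ?\<theta>)) * ennreal pb = ennreal (?\<theta> / 2 * (exp (kk * mm) + 1))"
    proof -
      have "1 / (2 * ?\<theta>) * pb = ?\<theta> / 2" using basic(10) by (simp add: real_div_sqrt)
      then have "?\<theta> / 2 * (exp (kk * mm) + 1) = ?\<theta> / 2 * exp (kk * mm) + 1 / (2 * ?\<theta>) * pb" by (simp add: algebra_simps)
      then show ?thesis using \<theta> basic(10) by (simp add: ennreal_mult'[symmetric] ennreal_plus[symmetric] del: ennreal_plus)
    qed
    finally have "ennreal (exp (mm / 2)) \<le> I + ennreal (?\<theta> / 2 * (exp (kk * mm) + 1))" .
    then have "ennreal ?w \<le> I" by (rule diff_le_of_le_add_ennreal) (use \<theta> in \<open>simp add: add_nonneg_nonneg\<close>)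
    also have "I = (\<integral>\<^sup>+z. ennreal (exp (?s * ?F z / 2)) \<partial>?R)"
      unfolding I_def using Z_good_sets(1) by (intro nn_integral_restrict_space[symmetric]) auto
    also have "\<dots> = (\<integral>\<^sup>+z. ennreal (exp (real n * frob_cross p r r (mat_fam d Q) (tfam p r cc tt z) / 2)) \<partial>?R)"
    proof (rule nn_integral_cong)
      fix z assume "z \<in> space ?R"
      then have z: "z \<in> Z_good" by (simp add: space_restrict_space)
      have "frob_cross p r r (mat_fam d Q) (tfam p r cc tt z) = cc * frob_cross p r r (zfam z) (mat_fam d Q)"
        unfolding frob_cross_commute[of p r r "mat_fam d Q"] tfam_Z_good(3)[OF z] ..
      also have "frob_cross p r r (zfam z) (mat_fam d Q) = d * ?F z"
        using frob_cross_scale[of p r r 1 "zfam z" "sqrt d" "qf Q"] d by (simp add: mat_fam_eq)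
      finally show "ennreal (exp (?s * ?F z / 2)) = ennreal (exp (real n * frob_cross p r r (mat_fam d Q) (tfam p r cc tt z) / 2))"
        by (simp add: mult_ac)
    qed
    finally show ?thesis .
  qed
  \<comment> \<open>The inner bound is the same for every frame, so averaging over U changes
    nothing.\<close>
  have "ennreal ?w = (\<integral>\<^sup>+Q. ennreal ?w \<partial>U)" using U.emeasure_space_1 by simp
  also have "\<dots> \<le> (\<integral>\<^sup>+Q. (\<integral>\<^sup>+z. ennreal (exp (real n * frob_cross p r r (mat_fam d Q) (tfam p r cc tt z) / 2)) \<partial>?R) \<partial>U)"
    by (rule nn_integral_mono) (rule inner)
  also have "\<dots> \<le> (\<integral>\<^sup>+x. ennreal (lr_spiked x * lr_good x) \<partial>nulls n p)"
    unfolding lr_spiked_def lr_good_def by (rule nn_integral_mixlr_cross(1)[OF ok_lr_spiked ok_lr_good]) (use basic in auto)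
  finally show ?thesis .
qed

lemma integrable_of_nn:
  assumes "f \<in> borel_measurable (nulls n p)" "\<And>x. f x \<ge> 0" "(\<integral>\<^sup>+x. ennreal (f x) \<partial>nulls n p) \<le> ennreal a"
  shows "integrable (nulls n p) f"
  by (rule integrableI_nonneg) (use assms in \<open>auto intro: le_less_trans\<close>)

text \<open>The proxy ratio is a good part plus a bad part of mean at most pb; the good part is
  compared with the spiked ratio in L2. Useful when mm stays bounded.\<close>

lemma lr_l1_bound:
  "\<bar>(\<integral>x. \<bar>lr_spiked x - 1\<bar> \<partial>nulls n p) - (\<integral>x. \<bar>lr_proxy x - 1\<bar> \<partial>nulls n p)\<bar> \<le>
    sqrt (2 * exp (kk ^ 3 * mm / 2) - 2 * exp (mm / 2) + sqrt pb * (exp (kk * mm) + 1)) + pb"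
proof -
  let ?P = "nulls n p"
  interpret P: prob_space ?P by (rule prob_space_nulls)
  have isp: "integrable ?P lr_spiked" by (rule integrable_of_nn[OF meas(1) nonneg(1), of 1]) (simp add: nn_lr_spiked)
  have ix: "integrable ?P lr_proxy" by (rule integrable_of_nn[OF meas(2) nonneg(2), of 1]) (simp add: nn_lr_proxy)
  have ib: "integrable ?P lr_bad" by (rule integrable_of_nn[OF meas(4) nonneg(4) nn_lr_bad])
  have ig: "integrable ?P lr_good"
    by (rule Bochner_Integration.integrable_bound[OF ix meas(3)]) (use lr_proxy_split nonneg in \<open>auto intro!: AE_I2\<close>)
  have "ennreal (\<integral>x. lr_bad x \<partial>?P) \<le> ennreal pb" using nn_lr_bad nn_integral_eq_integral[OF ib] nonneg(4) by simp
  then have pb: "(\<integral>x. lr_bad x \<partial>?P) \<le> pb" using basic(10) by simp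
  have "(\<integral>x. \<bar>lr_spiked x - lr_good x\<bar> \<partial>?P) \<le> sqrt (exp (kk ^ 3 * mm / 2) + exp (kk ^ 3 * mm / 2) - 2 * (exp (mm / 2) - sqrt pb / 2 * (exp (kk * mm) + 1)))"
    by (rule L1_le_sqrt_second_moments[OF prob_space_nulls meas(1) nonneg(1) meas(3) nonneg(3) lr_spiked_second_moment lr_good_second_moment cross_moment]) auto
  also have "exp (kk ^ 3 * mm / 2) + exp (kk ^ 3 * mm / 2) - 2 * (exp (mm / 2) - sqrt pb / 2 * (exp (kk * mm) + 1)) =
    2 * exp (kk ^ 3 * mm / 2) - 2 * exp (mm / 2) + sqrt pb * (exp (kk * mm) + 1)" by (simp add: algebra_simps)
  finally have a: "(\<integral>x. \<bar>lr_spiked x - lr_good x\<bar> \<partial>?P) \<le> sqrt (2 * exp (kk ^ 3 * mm / 2) - 2 * exp (mm / 2) + sqrt pb * (exp (kk * mm) + 1))" .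
  have e1: "(\<integral>x. \<bar>lr_spiked x - 1\<bar> \<partial>?P) - (\<integral>x. \<bar>lr_proxy x - 1\<bar> \<partial>?P) = (\<integral>x. \<bar>lr_spiked x - 1\<bar> - \<bar>lr_proxy x - 1\<bar> \<partial>?P)"
    using isp ix by simp
  have e2: "\<bar>\<integral>x. \<bar>lr_spiked x - 1\<bar> - \<bar>lr_proxy x - 1\<bar> \<partial>?P\<bar> \<le> (\<integral>x. \<bar>lr_spiked x - lr_good x\<bar> + lr_bad x \<partial>?P)"
  proof (rule integral_abs_bound[THEN order_trans], rule integral_mono)
    fix x assume x: "x \<in> space ?P"
    show "\<bar>\<bar>lr_spiked x - 1\<bar> - \<bar>lr_proxy x - 1\<bar>\<bar> \<le> \<bar>lr_spiked x - lr_good x\<bar> + lr_bad x"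
      using lr_proxy_split[OF x] nonneg(4)[of x] by (simp add: abs_if)
  qed (use isp ix ig ib in auto)
  have e3: "(\<integral>x. \<bar>lr_spiked x - lr_good x\<bar> + lr_bad x \<partial>?P) = (\<integral>x. \<bar>lr_spiked x - lr_good x\<bar> \<partial>?P) + (\<integral>x. lr_bad x \<partial>?P)"
    using isp ig ib by simp
  show ?thesis unfolding e1 using e2 a pb unfolding e3 by linarith
qed

text \<open>The Chernoff parameter. The gain is linear in it and the cost quadratic; the constant 32
  makes the cost mm / 256 half of the guaranteed gain mm / 128.\<close>

definition "ll = d * real r / (32 * real p)"

lemma ll: "0 \<le> ll" "ll \<le> 1 / 4" "1 + 2 * ll \<le> 2"
  "4 * ll\<^sup>2 * real p * real n = mm / 256" "real n * ll * d * real r / 4 = mm / 128"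
proof -
  show "0 \<le> ll" using d by (simp add: ll_def)
  have "ll = d / 32 * (real r / real p)" by (simp add: ll_def)
  also have "\<dots> \<le> (1 / 4) * 1" using d \<eta> rp p0 by (intro mult_mono) auto
  finally show "ll \<le> 1 / 4" by simp
  then show "1 + 2 * ll \<le> 2" by simp
  show "4 * ll\<^sup>2 * real p * real n = mm / 256" "real n * ll * d * real r / 4 = mm / 128"
    using p0 by (simp_all add: ll_def mm_def power2_eq_square field_simps)
qed

text \<open>Cost mm / 256 minus gain mm / 128 leaves - mm / 256, and the square root in
  \<open>affinity_le\<close> halves the exponent.\<close>

lemma affinity_bound:
  assumes f: "f \<in> borel_measurable (nulls n p)" "\<And>x. f x \<ge> 0"
    and b: "(\<integral>\<^sup>+x. ennreal (f x * exp (- ll * (\<Sum>i<n. dotp p (x i) (x i)))) \<partial>nulls n p) \<le>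
      ennreal ((1 / sqrt (1 + 2 * ll) ^ p) ^ n * exp (- mm / 128))"
  shows "(\<integral>\<^sup>+x. ennreal (min 1 (f x)) \<partial>nulls n p) \<le> ennreal (exp (- mm / 512))"
proof -
  have "(\<lambda>x. dotp p (x i) (x i)) \<in> borel_measurable (nulls n p)" if "i < n" for i
    using measurable_compose[OF measurable_component_singleton[of i "{..<n}" "\<lambda>_. gauss p"] dotp_self_measurable_gauss] that by simp
  then have [measurable]: "(\<lambda>x. \<Sum>i<n. dotp p (x i) (x i)) \<in> borel_measurable (nulls n p)" by auto
  let ?g = "\<lambda>x. exp (ll * (\<Sum>i<n. dotp p (x i) (x i)))"
  let ?a = "(1 / sqrt (1 - 2 * ll) ^ p) ^ n" and ?b = "(1 / sqrt (1 + 2 * ll) ^ p) ^ n * exp (- mm / 128)"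
  have g: "?g \<in> borel_measurable (nulls n p)" by measurable
  have ll2: "ll < 1 / 2" using ll by simp
  have a0: "?a > 0" and b0: "?b > 0" using ll by auto
  have b': "(\<integral>\<^sup>+x. ennreal (f x * (1 / ?g x)) \<partial>nulls n p) \<le> ennreal ?b"
    using b by (simp add: exp_minus inverse_eq_divide)
  have "(\<integral>\<^sup>+x. ennreal (min 1 (f x)) \<partial>nulls n p) \<le> ennreal (sqrt (?a * ?b))"
    by (rule affinity_le[OF f g _ _ a0 b' b0]) (simp_all add: nulls_exp_sq_norm[OF ll2])
  also have "\<dots> \<le> ennreal (exp (- mm / 512))"
  proof (rule ennreal_leI)
    have "?a * ?b = (?a * (1 / sqrt (1 + 2 * ll) ^ p) ^ n) * exp (- mm / 128)" by (simp only: mult.assoc)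
    also have "\<dots> \<le> exp (4 * ll\<^sup>2 * real p * real n) * exp (- mm / 128)"
      by (intro mult_right_mono damping_product_le ll) simp
    also have "\<dots> = exp (- mm / 256)" unfolding ll(4) by (simp flip: exp_add)
    finally have "sqrt (?a * ?b) \<le> sqrt (exp (- mm / 256))" by (rule real_sqrt_le_mono)
    then show "sqrt (?a * ?b) \<le> exp (- mm / 512)" by (simp add: sqrt_exp)
  qed
  finally show ?thesis .
qed

lemma ll_ratio: "ll / 2 \<le> ll / (1 + 2 * ll)"
  using ll by (intro divide_left_mono) auto

lemma lr_spiked_affinity: "(\<integral>\<^sup>+x. ennreal (min 1 (lr_spiked x)) \<partial>nulls n p) \<le> ennreal (exp (- mm / 512))"
proof (rule affinity_bound[OF meas(1) nonneg(1)])
  have "(\<integral>\<^sup>+x. ennreal (lr_spiked x * exp (- ll * (\<Sum>i<n. dotp p (x i) (x i)))) \<partial>nulls n p) \<le>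
    (\<integral>\<^sup>+Q. ennreal ((1 / sqrt (1 + 2 * ll) ^ p) ^ n * exp (- real n * (ll / (1 + 2 * ll)) * fnorm2 p r (mat_fam d Q))) \<partial>U)"
    unfolding lr_spiked_def by (rule nn_integral_mixlr_damped[OF ok_lr_spiked _ basic(6) ll(1)]) (use basic in simp)
  also have "\<dots> \<le> (\<integral>\<^sup>+Q. ennreal ((1 / sqrt (1 + 2 * ll) ^ p) ^ n * exp (- mm / 128)) \<partial>U)"
  proof (intro nn_integral_mono ennreal_leI mult_left_mono, unfold exp_le_cancel_iff)
    fix Q assume "Q \<in> space U"
    then have fn: "fnorm2 p r (mat_fam d Q) = d * real r"
      using fnorm2_stiefel[of Q p r] d unfolding mat_fam_eq fnorm2_scale by (simp add: space_U)
    have "mm / 128 = real n * (ll / 4) * (d * real r)" unfolding ll(5)[symmetric] by simp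
    also have "\<dots> \<le> real n * (ll / (1 + 2 * ll)) * (d * real r)"
    proof (intro mult_right_mono mult_left_mono)
      \<comment> \<open>For a frame |A|^2 is deterministic and more could be gained; a factor 2 is
        given away to reach the same rate as for the Gaussian family.\<close>
      show "ll / 4 \<le> ll / (1 + 2 * ll)" using ll_ratio ll(1) by linarith
    qed (use d in auto)
    finally show "- real n * (ll / (1 + 2 * ll)) * fnorm2 p r (mat_fam d Q) \<le> - mm / 128" unfolding fn by simp
  qed (use ll in simp)
  also have "\<dots> = ennreal ((1 / sqrt (1 + 2 * ll) ^ p) ^ n * exp (- mm / 128))" using U.emeasure_space_1 by simp
  finally show "(\<integral>\<^sup>+x. ennreal (lr_spiked x * exp (- ll * (\<Sum>i<n. dotp p (x i) (x i)))) \<partial>nulls n p) \<le>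
      ennreal ((1 / sqrt (1 + 2 * ll) ^ p) ^ n * exp (- mm / 128))" .
qed

text \<open>Now |Z|^2 is random and its Laplace transform (1 + u)^(- p r / 2) is used. Bounding it
  by exp (- u p r / 4) loses a factor 2 against the mean, which the gain mm / 128 allows
  for.\<close>

lemma lr_good_affinity: "(\<integral>\<^sup>+x. ennreal (min 1 (lr_good x)) \<partial>nulls n p) \<le> ennreal (exp (- mm / 512))"
proof (rule affinity_bound[OF meas(3) nonneg(3)])
  let ?R = "restrict_space (gz p r) Z_good"
  let ?A = "(1 / sqrt (1 + 2 * ll) ^ p) ^ n"
  let ?u = "2 * real n * (ll / (1 + 2 * ll)) * cc"
  note [measurable] = measurable_fnorm2_zfam
  have A0: "?A \<ge> 0" using ll by simp
  have u0: "0 \<le> ?u" using ll basic by simp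
  have u1: "?u \<le> 1"
  proof -
    have "ll / (1 + 2 * ll) \<le> ll / 1" using ll(1) by (intro divide_left_mono) auto
    then have 1: "ll / (1 + 2 * ll) \<le> 1 / 4" by (rule order_trans) (use ll(2) in simp)
    have "?u = 2 * (ll / (1 + 2 * ll)) * (d * (real n / real p))" by (simp add: cc_def)
    also have "\<dots> \<le> 2 * (1 / 4) * (1 * 1)" using ll(1) d \<eta> np p0 by (intro mult_mono 1) auto
    finally show ?thesis by simp
  qed
  have "(\<integral>\<^sup>+x. ennreal (lr_good x * exp (- ll * (\<Sum>i<n. dotp p (x i) (x i)))) \<partial>nulls n p) \<le>
    (\<integral>\<^sup>+z. ennreal (?A * exp (- real n * (ll / (1 + 2 * ll)) * fnorm2 p r (tfam p r cc tt z))) \<partial>?R)"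
    unfolding lr_good_def by (rule nn_integral_mixlr_damped[OF ok_lr_good _ basic(6) ll(1)]) (use basic in simp)
  also have "\<dots> \<le> (\<integral>\<^sup>+z. ennreal ?A * ennreal (exp (- ?u * fnorm2 p r (zfam z) / 2)) \<partial>gz p r)"
  proof (rule nn_integral_restrict_le[OF Z_good_sets(1)])
    fix z assume z: "z \<in> Z_good"
    have "- real n * (ll / (1 + 2 * ll)) * fnorm2 p r (tfam p r cc tt z) = - ?u * fnorm2 p r (zfam z) / 2"
    proof -
      have "- real n * q * (cc * F) = - (2 * real n * q * cc) * F / 2" for q F :: real by simp
      then show ?thesis unfolding tfam_Z_good(4)[OF z] .
    qed
    then show "ennreal (?A * exp (- real n * (ll / (1 + 2 * ll)) * fnorm2 p r (tfam p r cc tt z))) \<le>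
      ennreal ?A * ennreal (exp (- ?u * fnorm2 p r (zfam z) / 2))"
      by (simp only: ennreal_mult'[OF A0] order_refl)
  qed
  also have "\<dots> = ennreal ?A * ennreal ((1 / sqrt (1 + ?u) ^ p) ^ r)"
    unfolding gz_exp_neg_fnorm2[OF u0, symmetric] by (rule nn_integral_cmult) measurable
  also have "\<dots> = ennreal (?A * (1 / sqrt (1 + ?u) ^ p) ^ r)" by (rule ennreal_mult'[OF A0, symmetric])
  also have "\<dots> \<le> ennreal (?A * exp (- mm / 128))"
  proof (intro ennreal_leI mult_left_mono A0)
    have "(1 / sqrt (1 + ?u) ^ p) ^ r = (1 / sqrt (1 + ?u)) ^ (p * r)" by (simp add: power_mult power_divide)
    also have "\<dots> \<le> exp (- ?u / 4) ^ (p * r)"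
      by (intro power_mono inverse_sqrt_one_plus_le[OF u0 u1]) (use u0 in simp)
    also have "\<dots> = exp (real (p * r) * (- ?u / 4))" by (rule exp_of_nat_mult[symmetric])
    also have "\<dots> \<le> exp (- mm / 128)"
    proof (unfold exp_le_cancel_iff)
      have "mm / 128 = real n * (ll / 2) * (d * real r) / 2" unfolding ll(5)[symmetric] by simp
      also have "\<dots> \<le> real n * (ll / (1 + 2 * ll)) * (d * real r) / 2"
        using ll_ratio d by (intro divide_right_mono mult_right_mono mult_left_mono) auto
      also have "\<dots> = real (p * r) * (?u / 4)"
      proof -
        have "real n * q * (d * real r) / 2 = real (p * r) * (2 * real n * q * cc / 4)" for q :: real
          using p0 by (simp add: cc_def)
        then show ?thesis .
      qed
      finally show "real (p * r) * (- ?u / 4) \<le> - mm / 128" by simp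
    qed
    finally show "(1 / sqrt (1 + ?u) ^ p) ^ r \<le> exp (- mm / 128)" .
  qed
  finally show "(\<integral>\<^sup>+x. ennreal (lr_good x * exp (- ll * (\<Sum>i<n. dotp p (x i) (x i)))) \<partial>nulls n p) \<le>
      ennreal (?A * exp (- mm / 128))" .
qed

text \<open>Both distances lie between 2 minus a small quantity and 2, so their difference is small
  although the ratios themselves are not compared.\<close>

lemma lr_l1_bound_separated:
  "\<bar>(\<integral>x. \<bar>lr_spiked x - 1\<bar> \<partial>nulls n p) - (\<integral>x. \<bar>lr_proxy x - 1\<bar> \<partial>nulls n p)\<bar> \<le> 2 * exp (- mm / 512) + 2 * pb"
proof -
  have x: "(\<integral>\<^sup>+x. ennreal (min 1 (lr_proxy x)) \<partial>nulls n p) \<le> ennreal (exp (- mm / 512) + pb)"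
  proof -
    note [measurable] = meas
    have "(\<integral>\<^sup>+x. ennreal (min 1 (lr_proxy x)) \<partial>nulls n p) \<le> (\<integral>\<^sup>+x. ennreal (min 1 (lr_good x)) + ennreal (lr_bad x) \<partial>nulls n p)"
    proof (rule nn_integral_mono)
      fix x assume "x \<in> space (nulls n p)"
      then have "min 1 (lr_proxy x) \<le> min 1 (lr_good x) + lr_bad x" using lr_proxy_split[of x] nonneg(4)[of x] by simp
      then have "ennreal (min 1 (lr_proxy x)) \<le> ennreal (min 1 (lr_good x) + lr_bad x)" by (rule ennreal_leI)
      then show "ennreal (min 1 (lr_proxy x)) \<le> ennreal (min 1 (lr_good x)) + ennreal (lr_bad x)"
        using nonneg by (simp add: ennreal_plus)
    qed
    also have "\<dots> = (\<integral>\<^sup>+x. ennreal (min 1 (lr_good x)) \<partial>nulls n p) + (\<integral>\<^sup>+x. ennreal (lr_bad x) \<partial>nulls n p)"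
      by (rule nn_integral_add) measurable
    also have "\<dots> \<le> ennreal (exp (- mm / 512)) + ennreal pb" by (intro add_mono lr_good_affinity nn_lr_bad)
    also have "\<dots> = ennreal (exp (- mm / 512) + pb)" using basic(10) by simp
    finally show ?thesis .
  qed
  note s = integral_abs_minus_one[OF prob_space_nulls meas(1) nonneg(1) nn_lr_spiked lr_spiked_affinity]
  have "0 \<le> exp (- mm / 512) + pb" using basic(10) by (simp add: add_nonneg_nonneg)
  note t = integral_abs_minus_one[OF prob_space_nulls meas(2) nonneg(2) nn_lr_proxy x this]
  show ?thesis using s t basic(10) by (simp add: abs_if)
qed

end

end

section \<open>Asymptotics\<close>

text \<open>Carries the two estimates over to the ratios of the statement: the first is effective
  for bounded m, the second for large m.\<close>

lemma mixture_LR_l1_bounds: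
  fixes n p r :: nat and d \<eta> :: real
  assumes U: "uniform_on_stiefel p r U" and rp: "r \<le> p"
    and h: "0 < p" "0 < d" "d \<le> \<eta>" "\<eta> \<le> 1 / 64" "n \<le> p"
  defines "D \<equiv> \<bar>(\<integral>x. \<bar>mixture_LR n p d U x - 1\<bar> \<partial>null_law n p) -
      (\<integral>x. \<bar>mixture_LR n p (d / real p) (truncated_gaussian_mat p r (1 / 2 * sqrt (real p / d))) x - 1\<bar> \<partial>null_law n p)\<bar>"
    and "m \<equiv> real n * d\<^sup>2 * (real r)\<^sup>2 / real p" and "\<kappa> \<equiv> 1 / (1 - 4 * \<eta>)" and "b \<equiv> 320 * (real r + 1) * d\<^sup>2 / \<eta>\<^sup>2"
  shows "D \<le> sqrt (2 * exp (\<kappa> ^ 3 * m / 2) - 2 * exp (m / 2) + sqrt b * (exp (\<kappa> * m) + 1)) + b"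
    and "D \<le> 2 * exp (- m / 512) + 2 * b"
proof -
  interpret uniform_stiefel p r U by standard (fact U, fact rp)
  note bas = basic[OF h]
  have s: "mixture_LR n p d U x = lr_spiked n d x" for x
    unfolding lr_spiked_def[OF h] using h(2-4)
    by (intro mixture_LR_eq_mixlr[of d d]) (auto simp: space_U stiefel_def intro: fam_okD(3)[OF fam_ok_stiefel, unfolded space_U stiefel_def])
  have g: "mixture_LR n p (d / real p) (truncated_gaussian_mat p r (1 / 2 * sqrt (real p / d))) x = lr_proxy n d x" for x
    unfolding lr_proxy_def[OF h] tt_def[OF h, symmetric] cc_def[OF h, symmetric]
    by (rule mixture_LR_truncated) (use bas in auto)
  have D: "D = \<bar>(\<integral>x. \<bar>lr_spiked n d x - 1\<bar> \<partial>nulls n p) - (\<integral>x. \<bar>lr_proxy n d x - 1\<bar> \<partial>nulls n p)\<bar>"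
    unfolding D_def s g null_law_eq ..
  have mm: "mm n d = m" "kk \<eta> = \<kappa>" "pb d \<eta> = b"
    unfolding m_def \<kappa>_def b_def mm_def[OF h] kk_def[OF h] pb_def[OF h] by rule+
  show "D \<le> sqrt (2 * exp (\<kappa> ^ 3 * m / 2) - 2 * exp (m / 2) + sqrt b * (exp (\<kappa> * m) + 1)) + b"
    using lr_l1_bound[OF h] unfolding D mm .
  show "D \<le> 2 * exp (- m / 512) + 2 * b"
    using lr_l1_bound_separated[OF h] unfolding D mm .
qed

lemma rounded_powr_bounds:
  assumes k: "k = nat \<lfloor>x\<rfloor> \<or> k = nat \<lceil>x\<rceil>" and x: "0 \<le> x" "x \<le> real n"
  shows "real k \<le> x + 1" "x - 1 \<le> real k" "k \<le> n"
proof -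
  have "real (nat \<lfloor>x\<rfloor>) = of_int \<lfloor>x\<rfloor>" "real (nat \<lceil>x\<rceil>) = of_int \<lceil>x\<rceil>" using x by auto
  then show "real k \<le> x + 1" "x - 1 \<le> real k" using k by linarith+
  have "\<lfloor>x\<rfloor> \<le> int n" "\<lceil>x\<rceil> \<le> int n" using x by (auto simp: floor_le_iff ceiling_le_iff)
  then have "nat \<lfloor>x\<rfloor> \<le> n" "nat \<lceil>x\<rceil> \<le> n" by linarith+
  then show "k \<le> n" using k by blast
qed

text \<open>Uniform in m on [0, 4]; the right-hand side vanishes as q tends to 1.\<close>

lemma exp_difference_le:
  fixes q m :: real
  assumes "1 \<le> q" "0 \<le> m" "m \<le> 4"
  shows "exp (q * m / 2) - exp (m / 2) \<le> exp 2 * (exp (2 * (q - 1)) - 1)"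
proof -
  have "exp (q * m / 2) - exp (m / 2) = exp (m / 2) * (exp ((q - 1) * m / 2) - 1)"
    by (simp add: right_diff_distrib exp_add[symmetric] algebra_simps add_divide_distrib[symmetric])
  also have "\<dots> \<le> exp 2 * (exp (2 * (q - 1)) - 1)"
  proof (intro mult_mono)
    have "(q - 1) * m \<le> (q - 1) * 4" using assms by (intro mult_left_mono) auto
    then show "exp ((q - 1) * m / 2) - 1 \<le> exp (2 * (q - 1)) - 1" by simp
  qed (use assms in auto)
  finally show ?thesis .
qed

theorem lemma4p1:
  fixes \<alpha> \<beta> \<gamma> :: real and p r :: "nat \<Rightarrow> nat" and \<delta> :: "nat \<Rightarrow> real"
    and U :: "nat \<Rightarrow> real mat measure"
  assumes "0 < \<alpha>" "\<alpha> < 1" "0 < \<beta>" "\<beta> < 1" "1 \<le> \<gamma>"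
    and "\<And>n. n \<le> p n"
    and "(\<lambda>n. real (p n) / real n) \<longlonglongrightarrow> \<gamma>"
    and "\<And>n. r n = nat \<lfloor>real n powr (1 - \<beta>)\<rfloor> \<or> r n = nat \<lceil>real n powr (1 - \<beta>)\<rceil>"
    and "\<And>n. \<delta> n = real n powr (- \<alpha>)"
    and "\<And>n. uniform_on_stiefel (p n) (r n) (U n)"
    and "\<alpha> > max (1 - 5 * \<beta> / 4) ((1 - \<beta>) / 2)"
  shows "(\<lambda>n.
      (\<integral>x. \<bar>mixture_LR n (p n) (\<delta> n) (U n) x - 1\<bar> \<partial>null_law n (p n)) -
      (\<integral>x. \<bar>mixture_LR n (p n) (\<delta> n / real (p n))
              (truncated_gaussian_mat (p n) (r n) (1/2 * sqrt (real (p n) / \<delta> n))) x - 1\<bar>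
         \<partial>null_law n (p n)))
    \<longlonglongrightarrow> 0"
proof -
  \<comment> \<open>Chosen so that 1 - \<beta> - 2 \<alpha> = - 4 e. Dividing r \<delta>^2 by
    \<eta>^2 = n^(- 2 e) then leaves the order n^(- 2 e). Moreover e < \<alpha> gives \<delta> \<le>
    \<eta>.\<close>
  define e where "e = (2 * \<alpha> - (1 - \<beta>)) / 4"
  define \<eta> where "\<eta> n = real n powr (- e)" for n
  define b where "b n = 320 * (real (r n) + 1) * (\<delta> n)\<^sup>2 / (\<eta> n)\<^sup>2" for n
  define m where "m n = real n * (\<delta> n)\<^sup>2 * (real (r n))\<^sup>2 / real (p n)" for n
  define \<kappa> where "\<kappa> n = 1 / (1 - 4 * \<eta> n)" for n
  define D where "D n = (\<integral>x. \<bar>mixture_LR n (p n) (\<delta> n) (U n) x - 1\<bar> \<partial>null_law n (p n)) -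
      (\<integral>x. \<bar>mixture_LR n (p n) (\<delta> n / real (p n))
              (truncated_gaussian_mat (p n) (r n) (1/2 * sqrt (real (p n) / \<delta> n))) x - 1\<bar>
         \<partial>null_law n (p n))" for n
  have \<alpha>: "0 < \<alpha>" "\<alpha> < 1" and \<beta>: "0 < \<beta>" "\<beta> < 1" by fact+
  have e: "0 < e" "e < \<alpha>" using assms(11) \<alpha> \<beta> by (auto simp: e_def)
  have \<delta>: "\<delta> n = real n powr (- \<alpha>)" for n by fact
  have decay: "(\<lambda>n. real n powr (- s)) \<longlonglongrightarrow> 0" if "s > 0" for s
    using that by (intro tendsto_neg_powr filterlim_real_sequentially) auto
  have \<eta>0: "\<eta> \<longlonglongrightarrow> 0" unfolding \<eta>_def by (rule decay[OF e(1)])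
  have ev1: "eventually (\<lambda>n. \<eta> n \<le> 1 / 64) sequentially"
    using order_tendstoD(2)[OF \<eta>0, of "1 / 64"] by (auto elim: eventually_mono)
  have x: "0 \<le> real n powr (1 - \<beta>)" "real n powr (1 - \<beta>) \<le> real n" if "n \<ge> 1" for n
  proof -
    have "real n powr (1 - \<beta>) \<le> real n powr 1" using that \<beta> by (intro powr_mono) auto
    then show "real n powr (1 - \<beta>) \<le> real n" using that by simp
  qed simp
  note rb = rounded_powr_bounds[OF assms(8) x]
  have pos: "0 < p n" "0 < \<delta> n" "\<delta> n \<le> \<eta> n" "r n \<le> p n" "n \<le> p n" if n: "n \<ge> 1" for n
  proof -
    show "n \<le> p n" by fact
    then show "0 < p n" using n by simp
    show "0 < \<delta> n" unfolding \<delta> using n by simp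
    show "\<delta> n \<le> \<eta> n" unfolding \<delta> \<eta>_def using n e by (intro powr_mono) auto
    show "r n \<le> p n" using rb(3)[OF n n] assms(6)[of n] by linarith
  qed
  have bound: "\<bar>D n\<bar> \<le> sqrt (2 * exp (\<kappa> n ^ 3 * m n / 2) - 2 * exp (m n / 2) + sqrt (b n) * (exp (\<kappa> n * m n) + 1)) + b n"
    "\<bar>D n\<bar> \<le> 2 * exp (- m n / 512) + 2 * b n" if "n \<ge> 1" "\<eta> n \<le> 1 / 64" for n
    unfolding D_def m_def b_def \<kappa>_def
    using mixture_LR_l1_bounds[OF assms(10) pos(4)[OF that(1)] pos(1-3)[OF that(1)] that(2) pos(5)[OF that(1)]] by auto
  have b0: "b \<longlonglongrightarrow> 0"
  proof (rule Lim_null_comparison)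
    \<comment> \<open>The first power comes from n^(1 - \<beta>); the second, with its factor 2,
      from the rounding of r and from the 1 added in b.\<close>
    show "(\<lambda>n. 320 * (real n powr (- (2 * e)) + 2 * real n powr (- (2 * \<alpha> - 2 * e)))) \<longlonglongrightarrow> 0"
      using tendsto_mult_left[OF tendsto_add[OF decay[of "2 * e"] tendsto_mult_left[OF decay[of "2 * \<alpha> - 2 * e"], of 2]], of 320] e by simp
    show "eventually (\<lambda>n. norm (b n) \<le> 320 * (real n powr (- (2 * e)) + 2 * real n powr (- (2 * \<alpha> - 2 * e)))) sequentially"
    proof (rule eventually_sequentiallyI[of 1])
      fix n :: nat assume n: "1 \<le> n"
      have sq: "(\<delta> n)\<^sup>2 / (\<eta> n)\<^sup>2 = real n powr (- (2 * \<alpha> - 2 * e))"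
        unfolding \<delta> \<eta>_def using n by (simp add: power2_eq_square powr_add[symmetric] powr_diff[symmetric])
      have "norm (b n) = 320 * (real (r n) + 1) * real n powr (- (2 * \<alpha> - 2 * e))"
        unfolding b_def times_divide_eq_right[symmetric] sq by (simp add: abs_mult)
      also have "\<dots> \<le> 320 * (real n powr (1 - \<beta>) + 2) * real n powr (- (2 * \<alpha> - 2 * e))"
        using rb(1)[OF n n] by (intro mult_right_mono) auto
      also have "\<dots> = 320 * (real n powr (1 - \<beta> - (2 * \<alpha> - 2 * e)) + 2 * real n powr (- (2 * \<alpha> - 2 * e)))"
        by (simp add: algebra_simps powr_add[symmetric])
      also have "1 - \<beta> - (2 * \<alpha> - 2 * e) = - (2 * e)" by (simp add: e_def field_simps)
      finally show "norm (b n) \<le> 320 * (real n powr (- (2 * e)) + 2 * real n powr (- (2 * \<alpha> - 2 * e)))" .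
    qed
  qed
  have "D \<longlonglongrightarrow> 0"
  proof (cases "1 - \<beta> \<le> \<alpha>")
    case True
    have \<kappa>1: "\<kappa> \<longlonglongrightarrow> 1"
      unfolding \<kappa>_def using tendsto_divide[OF tendsto_const[of 1] tendsto_diff[OF tendsto_const[of 1] tendsto_mult_left[OF \<eta>0, of 4]]] by simp
    let ?B = "\<lambda>n. sqrt (2 * (exp 2 * (exp (2 * (\<kappa> n ^ 3 - 1)) - 1)) + sqrt (b n) * (exp (\<kappa> n * 4) + 1)) + b n"
    have "?B \<longlonglongrightarrow> sqrt (2 * (exp 2 * (exp (2 * (1 ^ 3 - 1)) - 1)) + sqrt 0 * (exp (1 * 4) + 1)) + 0"
      by (intro tendsto_intros \<kappa>1 b0)
    then have B: "?B \<longlonglongrightarrow> 0" by simp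
    show ?thesis
    proof (rule Lim_null_comparison[OF _ B])
      show "eventually (\<lambda>n. norm (D n) \<le> ?B n) sequentially"
        using ev1 eventually_ge_at_top[of 1]
      proof eventually_elim
        case (elim n)
        note q = pos[OF elim(2)]
        have \<kappa>: "1 \<le> \<kappa> n" using elim(1) q by (simp add: \<kappa>_def)
        \<comment> \<open>One unit from n^(1 - \<beta> - \<alpha>) \<le> 1 and one from the
          rounding; squared, this is the bound 4 for m.\<close>
        have dr: "\<delta> n * real (r n) \<le> 2"
        proof -
          have "\<delta> n * real (r n) \<le> real n powr (- \<alpha>) * (real n powr (1 - \<beta>) + 1)"
            unfolding \<delta> using rb(1)[OF elim(2) elim(2)] by (intro mult_left_mono) auto
          also have "\<dots> = real n powr (1 - \<beta> - \<alpha>) + real n powr (- \<alpha>)"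
            by (simp add: distrib_left powr_add[symmetric] algebra_simps)
          also have "\<dots> \<le> real n powr 0 + real n powr 0"
            using True \<alpha> elim(2) by (intro add_mono powr_mono) auto
          also have "\<dots> = 2" using elim(2) by simp
          finally show ?thesis .
        qed
        have m0: "0 \<le> m n" using q by (simp add: m_def)
        have m4: "m n \<le> 4"
        proof -
          have "m n = (real n / real (p n)) * (\<delta> n * real (r n))\<^sup>2" by (simp add: m_def power_mult_distrib)
          also have "\<dots> \<le> 1 * 2\<^sup>2" using q dr by (intro mult_mono power_mono) auto
          finally show ?thesis by simp
        qed
        have "1 ^ 3 \<le> \<kappa> n ^ 3" using \<kappa> by (intro power_mono) auto
        then have k3: "1 \<le> \<kappa> n ^ 3" by simp
        have "2 * exp (\<kappa> n ^ 3 * m n / 2) - 2 * exp (m n / 2) + sqrt (b n) * (exp (\<kappa> n * m n) + 1)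
          \<le> 2 * (exp 2 * (exp (2 * (\<kappa> n ^ 3 - 1)) - 1)) + sqrt (b n) * (exp (\<kappa> n * 4) + 1)"
        proof (rule add_mono)
          show "2 * exp (\<kappa> n ^ 3 * m n / 2) - 2 * exp (m n / 2) \<le> 2 * (exp 2 * (exp (2 * (\<kappa> n ^ 3 - 1)) - 1))"
            using exp_difference_le[OF k3 m0 m4] by simp
          show "sqrt (b n) * (exp (\<kappa> n * m n) + 1) \<le> sqrt (b n) * (exp (\<kappa> n * 4) + 1)"
            using m4 \<kappa> by (intro mult_left_mono) (auto simp: b_def)
        qed
        then have "sqrt (2 * exp (\<kappa> n ^ 3 * m n / 2) - 2 * exp (m n / 2) + sqrt (b n) * (exp (\<kappa> n * m n) + 1)) \<le>
          sqrt (2 * (exp 2 * (exp (2 * (\<kappa> n ^ 3 - 1)) - 1)) + sqrt (b n) * (exp (\<kappa> n * 4) + 1))"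
          by (rule real_sqrt_le_mono)
        then show ?case using bound(1)[OF elim(2) elim(1)] unfolding real_norm_def by linarith
      qed
    qed
  next
    case False
    \<comment> \<open>The product \<delta> r grows like n^s, so m grows at least like a multiple of
      n^s.\<close>
    define s where "s = 1 - \<beta> - \<alpha>"
    have s: "s > 0" using False by (simp add: s_def)
    have pn: "eventually (\<lambda>n. real (p n) / real n < \<gamma> + 1) sequentially"
      using order_tendstoD(2)[OF assms(7), of "\<gamma> + 1"] by simp
    have grow: "filterlim (\<lambda>n. real n powr s) at_top sequentially"
    proof -
      have "eventually (\<lambda>n. 0 < real n powr (- s)) sequentially"
        using eventually_gt_at_top[of 0] by eventually_elim simp
      from filterlim_inverse_at_top[OF decay[OF s] this] show ?thesis by (simp add: powr_minus)
    qed
    have big: "eventually (\<lambda>n. 2 \<le> real n powr s) sequentially"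
      using grow by (auto simp: filterlim_at_top)
    have m_top: "filterlim m at_top sequentially"
    proof (rule filterlim_at_top_mono)
      show "filterlim (\<lambda>n. (1 / (\<gamma> + 1)) * (- 1 + real n powr s)) at_top sequentially"
        by (rule filterlim_tendsto_pos_mult_at_top[OF tendsto_const _ filterlim_tendsto_add_at_top[OF tendsto_const grow]])
           (use assms(5) in simp)
      show "eventually (\<lambda>n. (1 / (\<gamma> + 1)) * (- 1 + real n powr s) \<le> m n) sequentially"
        using pn big eventually_ge_at_top[of 1]
      proof eventually_elim
        case (elim n)
        note q = pos[OF elim(3)]
        have "real n powr (- \<alpha>) \<le> real n powr 0" using \<alpha> elim(3) by (intro powr_mono) auto
        then have le1: "real n powr (- \<alpha>) \<le> 1" using elim(3) by simp
        have "real n powr s - 1 \<le> real n powr s - real n powr (- \<alpha>)" using le1 by simp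
        also have "\<dots> = real n powr (- \<alpha>) * (real n powr (1 - \<beta>) - 1)"
          by (simp add: right_diff_distrib powr_add[symmetric] s_def algebra_simps)
        also have "\<dots> \<le> \<delta> n * real (r n)"
          unfolding \<delta> using rb(2)[OF elim(3) elim(3)] by (intro mult_left_mono) auto
        finally have dr: "real n powr s - 1 \<le> \<delta> n * real (r n)" .
        \<comment> \<open>Once n^s \<ge> 2 the product \<delta> r is at least 1, so its square is no
          smaller than the product itself; linear growth is enough here.\<close>
        have "(real n powr s - 1) * 1 \<le> (\<delta> n * real (r n)) * (\<delta> n * real (r n))"
          using dr elim(2) by (intro mult_mono) auto
        then have dr2: "real n powr s - 1 \<le> (\<delta> n * real (r n))\<^sup>2" by (simp add: power2_eq_square)
        have np: "1 / (\<gamma> + 1) \<le> real n / real (p n)"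
          using elim(1,3) q assms(5) by (simp add: field_simps)
        have "(1 / (\<gamma> + 1)) * (- 1 + real n powr s) \<le> (real n / real (p n)) * (\<delta> n * real (r n))\<^sup>2"
          using np dr2 elim(2) assms(5) by (intro mult_mono) auto
        then show ?case by (simp add: m_def power_mult_distrib)
      qed
    qed
    have "filterlim (\<lambda>n. - (1 / 512 * m n)) at_bot sequentially"
      unfolding filterlim_uminus_at_top[symmetric]
      by (rule filterlim_tendsto_pos_mult_at_top[OF tendsto_const _ m_top]) simp
    then have "(\<lambda>n. exp (- (1 / 512 * m n))) \<longlonglongrightarrow> 0" by (rule filterlim_compose[OF exp_at_bot])
    then have "(\<lambda>n. exp (- m n / 512)) \<longlonglongrightarrow> 0" by simp
    from tendsto_add[OF tendsto_mult_left[OF this, of 2] tendsto_mult_left[OF b0, of 2]]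
    have B: "(\<lambda>n. 2 * exp (- m n / 512) + 2 * b n) \<longlonglongrightarrow> 0" by simp
    show ?thesis
    proof (rule Lim_null_comparison[OF _ B])
      show "eventually (\<lambda>n. norm (D n) \<le> 2 * exp (- m n / 512) + 2 * b n) sequentially"
        using ev1 eventually_ge_at_top[of 1] by eventually_elim (use bound(2) in simp)
    qed
  qed
  then show ?thesis unfolding D_def .
qed

end
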